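(* Let $\alpha\in[0,1]\setminus\mathbb{Q}$ have partial quotients $(\alpha_n)_{n\in\mathbb{N}_0}$, let $X_\alpha$ be the set of irrational $x\in[0,1]$ whose partial quotients satisfy $x_n\geqslant\alpha_n$ for all $n\in\mathbb{N}_0$, and let $\nu_0$ be the probability measure on $X_\alpha$ described in the context. Assume that $\sum_n1/\alpha_n<\infty$ and that there exists $\delta>0$ with $$\limsup_{n\to\infty}\frac1n\left(\frac{\log\alpha_n}{2}\left(\frac{(1+\delta)\log n}{\log\log\alpha_n}+1\right)-\sum_{k=0}^{n-1}\log\log\alpha_k\right)<1.$$ Then $X_\alpha$ has Hausdorff dimension $1/2$ and $\nu_0$ is absolutely continuous with respect to the $1/2$-dimensional Hausdorff measure $\mu_{1/2}$ on $X_\alpha$, but there exist subsets $A$ of $X_\alpha$ with $\nu_0(A)=0$ and $\mu_{1/2}(A)>0$. Furthermore, $\mu_{1/2}(\llbracket w\rrbracket)=\infty$ for each finite word $w=(w_0,\ldots,w_{n-1})$ with $w_i\in\mathbb{N}$, $w_i\geqslant\alpha_i$, where $\llbracket w\rrbracket:=\{x\in X_\alpha:x_i=w_i,\ 0\leqslant i\leqslant n-1\}$.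
   Context: $\mathbb{N}=\{1,2,\ldots\}$, $\mathbb{N}_0=\mathbb{N}\cup\{0\}$. For $x_i\in\mathbb{N}$ write $\llbracket x_0,x_1,\ldots\rrbracket:=\cfrac{1}{x_0+\cfrac{1}{x_1+\cdots}}$; every irrational $x\in[0,1]$ is uniquely $\llbracket x_0,x_1,\ldots\rrbracket$, and $(x_n)$ are its partial quotients. Definition of $\nu_0$. Let $\gamma_n\in(0,1]$ be the unique solution of $\gamma_n\alpha_n^{\gamma_n}=1$. Let $\mathcal{W}_n:=\{l\in\mathbb{N}:l\geqslant\alpha_n\}$ and $X_n:=\{(x_n,x_{n+1},\ldots):x_i\in\mathcal{W}_i\ \forall i\geqslant n\}$; a cylinder of length $k$ in $X_n$ is the set of all sequences in $X_n$ with prescribed first $k$ entries, and $X_n$ carries the $\sigma$-algebra generated by cylinders. Put $\delta_n:=(1+\gamma_n)/2$ and $\varphi_n:X_n\to(0,1)$, $\varphi_n(x_n,x_{n+1},\ldots):=\llbracket x_n,x_{n+1},\ldots\rrbracket^{2\delta_n}$. For $x\in X_{n+1}$ and $f:X_n\to\mathbb{R}$ set $\mathbb{L}_n(f)(x):=\sum_{w\in\mathcal{W}_n}\varphi_n(wx)f(wx)$, where $wx\in X_n$ is $x$ with $w$ prepended; $\mathbb{L}_n^k:=\mathbb{L}_{n+k-1}\circ\cdots\circ\mathbb{L}_n$ ($\mathbb{L}_n^0$ the identity) and $\mathbb{P}_n^k(f):=\mathbb{L}_n^k(f\cdot\mathbb{L}_0^n(\mathbf{1}))/\mathbb{L}_0^{n+k}(\mathbf{1})$,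 a function on $X_{n+k}$. There is $r\in(0,1)$ such that $\log\varphi_n$ has $r$-Hölder coefficients bounded uniformly in $n$, where the $r$-Hölder coefficient of $f:X_n\to\mathbb{R}$ is $D_r(f):=\sup\{|f(x)-f(y)|/r^k: k\geqslant1,\ x,y \text{ in a common cylinder of length } k\}$. There is a unique sequence of Borel probability measures $\nu_n$ on $X_n$ such that $\int f\,d\nu_n=\lim_{k\to\infty}\mathbb{P}_n^k(f)(x_k)$ for every bounded $f:X_n\to\mathbb{R}$ with $D_r(f)<\infty$ and every sequence $(x_k)$ with $x_k\in X_{n+k}$. The space $X_0$ is identified with $X_\alpha\subset[0,1]$ via $(x_0,x_1,\ldots)\mapsto\llbracket x_0,x_1,\ldots\rrbracket$, and $\nu_0$ is regarded as a probability measure on $X_\alpha$. *)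

theory Defs
  imports "HOL-Probability.Probability"
begin

section \<open>Continued fractions\<close>

text \<open>
  A sequence \<open>(x\<^sub>n, x\<^sub>n\<^sub>+\<^sub>1, \<dots>)\<close> is a function \<open>x :: nat \<Rightarrow> nat\<close> whose value at \<open>i\<close> is
  the entry \<open>x\<^sub>n\<^sub>+\<^sub>i\<close>; there is no leading integer part, so the value of \<open>x\<close> is
  \<open>1 / (x 0 + 1 / (x 1 + \<dots>))\<close>.
\<close>

primrec cf_convergent :: "nat \<Rightarrow> (nat \<Rightarrow> nat) \<Rightarrow> real" where
  "cf_convergent 0 x = 0"
| "cf_convergent (Suc k) x = 1 / (real (x 0) + cf_convergent k (\<lambda>i. x (Suc i)))"

definition cf_value :: "(nat \<Rightarrow> nat) \<Rightarrow> real" where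
  "cf_value x = lim (\<lambda>k. cf_convergent k x)"

definition partial_quotients :: "real \<Rightarrow> nat \<Rightarrow> nat" where
  "partial_quotients t = (THE x. (\<forall>n. 1 \<le> x n) \<and> cf_value x = t)"

definition X_alpha :: "(nat \<Rightarrow> nat) \<Rightarrow> real set" where
  "X_alpha a = {t \<in> {0..1}. t \<notin> \<rat> \<and> (\<forall>n. a n \<le> partial_quotients t n)}"

definition word_cylinder :: "(nat \<Rightarrow> nat) \<Rightarrow> nat list \<Rightarrow> real set" where
  "word_cylinder a w = {t \<in> X_alpha a. \<forall>i < length w. partial_quotients t i = w ! i}"


section \<open>Hausdorff measure and dimension\<close>

text \<open>
  \<open>gauge_diam s U\<close> is \<open>(diam U)\<^sup>s\<close> with the convention \<open>0\<^sup>0 = 1\<close> for nonempty \<open>U\<close>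
  (whereas \<open>0 powr 0 = 0\<close>). Covering sets have to be required to be bounded, since
  \<^const>\<open>diameter\<close> is not meaningful for unbounded sets.
\<close>

definition gauge_diam :: "real \<Rightarrow> 'a::metric_space set \<Rightarrow> ennreal" where
  "gauge_diam s U = (if U = {} then 0 else if s = 0 then 1 else ennreal (diameter U powr s))"

definition hausdorff_content :: "real \<Rightarrow> real \<Rightarrow> 'a::metric_space set \<Rightarrow> ennreal" where
  "hausdorff_content s d A =
     (INF U \<in> {U :: nat \<Rightarrow> 'a set. A \<subseteq> (\<Union>i. U i) \<and> (\<forall>i. bounded (U i) \<and> diameter (U i) \<le> d)}.
        \<Sum>i. gauge_diam s (U i))"

definition hausdorff_measure :: "real \<Rightarrow> 'a::metric_space set \<Rightarrow> ennreal" where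
  "hausdorff_measure s A = (SUP d \<in> {0<..}. hausdorff_content s d A)"

definition hausdorff_dim :: "'a::metric_space set \<Rightarrow> ennreal" where
  "hausdorff_dim A = Inf {ennreal s | s. 0 \<le> s \<and> hausdorff_measure s A = 0}"


section \<open>The measure \<open>\<nu>\<^sub>0\<close>\<close>

text \<open>Throughout, \<open>a\<close> is the sequence of partial quotients \<open>(\<alpha>\<^sub>n)\<close>.\<close>

definition gam :: "(nat \<Rightarrow> nat) \<Rightarrow> nat \<Rightarrow> real" where
  "gam a n = (THE g. 0 < g \<and> g \<le> 1 \<and> g * real (a n) powr g = 1)"

definition alphabet :: "(nat \<Rightarrow> nat) \<Rightarrow> nat \<Rightarrow> nat set" where
  "alphabet a n = {l. 1 \<le> l \<and> a n \<le> l}"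

definition seq_space :: "(nat \<Rightarrow> nat) \<Rightarrow> nat \<Rightarrow> (nat \<Rightarrow> nat) set" where
  "seq_space a n = {x. \<forall>i. x i \<in> alphabet a (n + i)}"

definition seq_cylinder :: "(nat \<Rightarrow> nat) \<Rightarrow> nat \<Rightarrow> nat list \<Rightarrow> (nat \<Rightarrow> nat) set" where
  "seq_cylinder a n u = {x \<in> seq_space a n. \<forall>i < length u. x i = u ! i}"

definition seq_algebra :: "(nat \<Rightarrow> nat) \<Rightarrow> nat \<Rightarrow> (nat \<Rightarrow> nat) set set" where
  "seq_algebra a n = sigma_sets (seq_space a n) (range (seq_cylinder a n))"

definition delt :: "(nat \<Rightarrow> nat) \<Rightarrow> nat \<Rightarrow> real" where
  "delt a n = (1 + gam a n) / 2"

definition phi :: "(nat \<Rightarrow> nat) \<Rightarrow> nat \<Rightarrow> (nat \<Rightarrow> nat) \<Rightarrow> real" where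
  "phi a n x = cf_value x powr (2 * delt a n)"

definition prepend :: "nat \<Rightarrow> (nat \<Rightarrow> nat) \<Rightarrow> nat \<Rightarrow> nat" where
  "prepend w x = case_nat w x"

definition L_op :: "(nat \<Rightarrow> nat) \<Rightarrow> nat \<Rightarrow> ((nat \<Rightarrow> nat) \<Rightarrow> real) \<Rightarrow> (nat \<Rightarrow> nat) \<Rightarrow> real" where
  "L_op a n f x = (\<Sum>\<^sub>\<infinity>w \<in> alphabet a n. phi a n (prepend w x) * f (prepend w x))"

primrec L_iter ::
  "(nat \<Rightarrow> nat) \<Rightarrow> nat \<Rightarrow> nat \<Rightarrow> ((nat \<Rightarrow> nat) \<Rightarrow> real) \<Rightarrow> (nat \<Rightarrow> nat) \<Rightarrow> real" where
  "L_iter a n 0 f = f"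
| "L_iter a n (Suc k) f = L_op a (n + k) (L_iter a n k f)"

definition P_iter ::
  "(nat \<Rightarrow> nat) \<Rightarrow> nat \<Rightarrow> nat \<Rightarrow> ((nat \<Rightarrow> nat) \<Rightarrow> real) \<Rightarrow> (nat \<Rightarrow> nat) \<Rightarrow> real" where
  "P_iter a n k f x =
     L_iter a n k (\<lambda>y. f y * L_iter a 0 n (\<lambda>_. 1) y) x / L_iter a 0 (n + k) (\<lambda>_. 1) x"

definition holder_coeff ::
  "(nat \<Rightarrow> nat) \<Rightarrow> nat \<Rightarrow> real \<Rightarrow> ((nat \<Rightarrow> nat) \<Rightarrow> real) \<Rightarrow> ennreal" where
  "holder_coeff a n r f =
     Sup {ennreal (\<bar>f x - f y\<bar> / r ^ k) | k x y.
            1 \<le> k \<and> (\<exists>u. length u = k \<and> x \<in> seq_cylinder a n u \<and> y \<in> seq_cylinder a n u)}"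

definition is_nu_seq :: "(nat \<Rightarrow> nat) \<Rightarrow> (nat \<Rightarrow> (nat \<Rightarrow> nat) measure) \<Rightarrow> bool" where
  "is_nu_seq a \<nu> \<longleftrightarrow>
     (\<exists>r. 0 < r \<and> r < 1 \<and> (SUP n. holder_coeff a n r (\<lambda>x. ln (phi a n x))) < \<infinity> \<and>
       (\<forall>n. prob_space (\<nu> n) \<and> space (\<nu> n) = seq_space a n \<and> sets (\<nu> n) = seq_algebra a n \<and>
         (\<forall>f xs. bounded (f ` seq_space a n) \<and> holder_coeff a n r f < \<infinity> \<and>
             (\<forall>k. xs k \<in> seq_space a (n + k)) \<longrightarrow>
           (\<lambda>k. P_iter a n k f (xs k)) \<longlonglongrightarrow> integral\<^sup>L (\<nu> n) f)))"

text \<open>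
  The sequence does not depend on the choice of \<open>r\<close>: indicators of cylinders have finite
  Hoelder coefficient for every \<open>r\<close>, and their integrals determine each \<open>\<nu> n\<close>.
\<close>

definition nu_seq :: "(nat \<Rightarrow> nat) \<Rightarrow> nat \<Rightarrow> (nat \<Rightarrow> nat) measure" where
  "nu_seq a = (THE \<nu>. is_nu_seq a \<nu>)"

definition nu0 :: "(nat \<Rightarrow> nat) \<Rightarrow> real measure" where
  "nu0 a = distr (nu_seq a 0) (restrict_space borel (X_alpha a)) cf_value"

end

theory Submission
  imports Defs
begin

text \<open>
  Let \<open>m\<close> be the product of the probability measures on \<open>{l. l \<ge> \<alpha>\<^sub>i}\<close> with weights proportional
  to \<open>l powr - (1 + \<gamma>\<^sub>i)\<close>. The iterated operators \<open>L\<^sub>0\<^sup>n\<close> are integrals against \<open>m\<close> with a weight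
  that converges to a density bounded away from 0 and \<open>\<infinity>\<close> (here \<open>\<Sum>1/\<alpha>\<^sub>n < \<infinity>\<close> enters), so
  \<open>\<nu>\<^sub>0\<close> is equivalent to \<open>m\<close>. By Borel-Cantelli the digits are almost surely at most
  \<open>t\<^sub>n = \<alpha>\<^sub>n n powr ((1 + \<delta>/2) / \<gamma>\<^sub>n)\<close> up to a constant factor. If a set \<open>U\<close> meets such sequences
  only in a cylinder of length \<open>n\<close>, their mass in \<open>U\<close> is at most
  \<open>C\<^sup>n (\<Prod>k<n. \<gamma>\<^sub>k) sqrt t\<^sub>n sqrt (diameter U)\<close>, and the growth condition makes the factor in front of
  \<open>sqrt (diameter U)\<close> tend to 0. Hence every set of positive mass has infinite 1/2-dimensional
  Hausdorff measure. The same holds for every product measure whose weights are dominated by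
  a multiple of those of \<open>m\<close>; doubling all digits gives one that lives on an \<open>m\<close>-null set.
\<close>


section \<open>Continued fractions\<close>

text \<open>The equation defining \<open>gam a n\<close> says that
  \<open>x powr - (1 + gam a n)\<close> has integral 1 over \<open>x \<ge> a n\<close>. Hence the
  weights of \<open>m\<close> have normalising constants at least 1, and
  \<open>a n powr - gam a n = gam a n\<close> makes a letter \<open>v\<close> weigh at most
  \<open>gam a n / v\<close>. Fixing digits \<open>x\<^sub>i\<close> shrinks distances by the
  product of the \<open>1 / x\<^sub>i\<^sup>2\<close>, up to a constant per digit, so mass over root
  of distance gains a factor \<open>gam a k\<close> per level, and these tend to 0. The critical
  sets are blocks of consecutive letters from \<open>l\<close> to \<open>L\<close> at one level:
  relative mass about \<open>(L - l) / l\<close>, relative distance about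
  \<open>(L - l) / (l * L)\<close>. Comparison with the square root costs \<open>sqrt L\<close>, so
  letters must be bounded first. Moreover, neighbouring letters give close values when the tail
  after the smaller one is near 1; \<open>gap\<close> controls this. The upper bound for the
  dimension does not involve \<open>\<nu>\<^sub>0\<close>: cylinder covers are summed by comparison
  with another product probability. All \<open>\<nu>\<^sub>n\<close> come from one measure, since
  \<open>P_iter\<close> from index \<open>n\<close> is a quotient of operators from index 0.\<close>

definition shift :: "nat \<Rightarrow> (nat \<Rightarrow> 'a) \<Rightarrow> nat \<Rightarrow> 'a" where
  "shift n x = (\<lambda>i. x (n + i))"

lemma shift_0 [simp]: "shift 0 x = x"
  by (simp add: shift_def)

lemma shift_apply: "shift n x i = x (n + i)"
  by (simp add: shift_def)

lemma shift_shift [simp]: "shift m (shift n x) = shift (n + m) x"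
  by (simp add: shift_def add.assoc)

lemma cf_convergent_Suc_shift:
  "cf_convergent (Suc k) x = 1 / (real (x 0) + cf_convergent k (shift 1 x))"
  by (simp add: shift_def)

declare cf_convergent.simps(2) [simp del] cf_convergent_Suc_shift [simp]

text \<open>The continued fraction whose first \<open>n\<close> partial quotients come from
  \<open>x\<close> and whose remaining tail has value \<open>s\<close>. Convergents are the case
  \<open>s = 0\<close>, values the case where \<open>s\<close> is the value of the shifted sequence,
  so one distance estimate serves both.\<close>

primrec cf_fold :: "nat \<Rightarrow> (nat \<Rightarrow> nat) \<Rightarrow> real \<Rightarrow> real" where
  "cf_fold 0 x s = s"
| "cf_fold (Suc n) x s = 1 / (real (x 0) + cf_fold n (shift 1 x) s)"

definition positive_seq :: "(nat \<Rightarrow> nat) \<Rightarrow> bool" where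
  "positive_seq x \<longleftrightarrow> (\<forall>i. 1 \<le> x i)"

lemma positive_seq_shift: "positive_seq x \<Longrightarrow> positive_seq (shift n x)"
  by (simp add: positive_seq_def shift_apply)

lemma cf_fold_cong: "(\<And>i. i < n \<Longrightarrow> x i = y i) \<Longrightarrow> cf_fold n x s = cf_fold n y s"
proof (induction n arbitrary: x y)
  case (Suc n)
  have "cf_fold n (shift 1 x) s = cf_fold n (shift 1 y) s"
    by (rule Suc.IH) (simp add: Suc.prems shift_apply)
  then show ?case using Suc.prems[of 0] by simp
qed simp

lemma cf_convergent_add:
  "cf_convergent (n + k) x = cf_fold n x (cf_convergent k (shift n x))"
  by (induction n arbitrary: x) simp_all

lemma cf_convergent_eq_fold: "cf_convergent n x = cf_fold n x 0"
  using cf_convergent_add[of n 0 x] by simp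

lemma cf_fold_range:
  assumes "positive_seq x" "0 \<le> s" "s \<le> 1"
  shows "0 \<le> cf_fold n x s \<and> cf_fold n x s \<le> 1"
  using assms(1)
proof (induction n arbitrary: x)
  case (Suc n)
  have "0 \<le> cf_fold n (shift 1 x) s" "1 \<le> real (x 0)"
    using Suc positive_seq_shift[of x 1] by (auto simp: positive_seq_def)
  then show ?case by (simp add: divide_le_eq)
qed (use assms in auto)

lemma cf_convergent_range:
  "positive_seq x \<Longrightarrow> 0 \<le> cf_convergent n x \<and> cf_convergent n x \<le> 1"
  unfolding cf_convergent_eq_fold by (rule cf_fold_range) auto

lemma cf_fold_step_diff:
  fixes b u v :: real
  assumes "1 \<le> b" "0 \<le> u" "0 \<le> v"
  shows "\<bar>1 / (b + u) - 1 / (b + v)\<bar> = \<bar>u - v\<bar> / ((b + u) * (b + v))"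
proof -
  have "1 / (b + u) - 1 / (b + v) = (v - u) / ((b + u) * (b + v))"
    using assms by (simp add: field_simps)
  then show ?thesis using assms by (simp add: abs_mult abs_minus_commute)
qed

text \<open>One step divides the distance of two tails by \<open>(b + u) * (b + v)\<close>, which
  lies between \<open>b\<^sup>2\<close> and \<open>(b + 1)\<^sup>2\<close> because tails lie in the
  unit interval. The upper bound later limits diameters of cylinders, the lower bound separates
  sequences.\<close>

lemma cf_fold_dist_bounds:
  assumes "positive_seq x" "0 \<le> s" "s \<le> 1" "0 \<le> t" "t \<le> 1"
  shows "(\<Prod>i<n. 1 / (real (x i) + 1)\<^sup>2) * \<bar>s - t\<bar> \<le> \<bar>cf_fold n x s - cf_fold n x t\<bar> \<and>
    \<bar>cf_fold n x s - cf_fold n x t\<bar> \<le> (\<Prod>i<n. 1 / (real (x i))\<^sup>2) * \<bar>s - t\<bar>"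
  using assms(1)
proof (induction n arbitrary: x)
  case (Suc n)
  define u v where "u = cf_fold n (shift 1 x) s" and "v = cf_fold n (shift 1 x) t"
  have px: "positive_seq (shift 1 x)" using Suc positive_seq_shift by blast
  have uv: "0 \<le> u" "u \<le> 1" "0 \<le> v" "v \<le> 1"
    using cf_fold_range[OF px] assms by (auto simp: u_def v_def)
  have x0: "1 \<le> real (x 0)" using Suc by (auto simp: positive_seq_def)
  have eq: "\<bar>cf_fold (Suc n) x s - cf_fold (Suc n) x t\<bar> = \<bar>u - v\<bar> / ((x 0 + u) * (x 0 + v))"
    using cf_fold_step_diff[OF x0 uv(1,3)] by (simp add: u_def v_def)
  have lo: "1 / (real (x 0) + 1)\<^sup>2 \<le> 1 / ((x 0 + u) * (x 0 + v))"
    unfolding power2_eq_square using x0 uv by (intro divide_left_mono mult_mono mult_pos_pos) auto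
  have hi: "1 / ((x 0 + u) * (x 0 + v)) \<le> 1 / (real (x 0))\<^sup>2"
    unfolding power2_eq_square using x0 uv by (intro divide_left_mono mult_mono mult_pos_pos) auto
  have IH: "(\<Prod>i<n. 1 / (real (x (Suc i)) + 1)\<^sup>2) * \<bar>s - t\<bar> \<le> \<bar>u - v\<bar>"
    "\<bar>u - v\<bar> \<le> (\<Prod>i<n. 1 / (real (x (Suc i)))\<^sup>2) * \<bar>s - t\<bar>"
    using Suc.IH[OF px] by (simp_all add: u_def v_def shift_def)
  have P: "0 \<le> (\<Prod>i<n. 1 / (real (x (Suc i)) + 1)\<^sup>2) * \<bar>s - t\<bar>"
    by (intro mult_nonneg_nonneg prod_nonneg) auto
  have "1 / (real (x 0) + 1)\<^sup>2 * ((\<Prod>i<n. 1 / (real (x (Suc i)) + 1)\<^sup>2) * \<bar>s - t\<bar>)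
      \<le> 1 / ((x 0 + u) * (x 0 + v)) * \<bar>u - v\<bar>"
    by (intro mult_mono) (use lo IH P x0 uv in auto)
  moreover have "1 / ((x 0 + u) * (x 0 + v)) * \<bar>u - v\<bar>
      \<le> 1 / (real (x 0))\<^sup>2 * ((\<Prod>i<n. 1 / (real (x (Suc i)))\<^sup>2) * \<bar>s - t\<bar>)"
    by (intro mult_mono) (use hi IH x0 uv in auto)
  moreover have "1 / ((x 0 + u) * (x 0 + v)) * \<bar>u - v\<bar> = \<bar>u - v\<bar> / ((x 0 + u) * (x 0 + v))"
    by simp
  ultimately show ?case unfolding eq prod.lessThan_Suc_shift mult.assoc by linarith
qed auto

text \<open>Two consecutive steps of \<^const>\<open>cf_fold\<close> contract by the factor \<open>1 / 4\<close>, although a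
  single step with partial quotient \<open>1\<close> need not contract at all.\<close>

lemma cf_fold_contraction:
  assumes "positive_seq x" "0 \<le> s" "s \<le> 1" "0 \<le> t" "t \<le> 1"
  shows "\<bar>cf_fold n x s - cf_fold n x t\<bar> \<le> 2 * (1 / 2) ^ n"
  using assms(1)
proof (induction n arbitrary: x rule: induct_nat_012)
  case (ge2 n)
  define u v where "u = cf_fold n (shift 2 x) s" and "v = cf_fold n (shift 2 x) t"
  have px: "positive_seq (shift 2 x)" using ge2 positive_seq_shift by blast
  have uv: "0 \<le> u" "u \<le> 1" "0 \<le> v" "v \<le> 1"
    using cf_fold_range[OF px] assms by (auto simp: u_def v_def)
  have x0: "1 \<le> real (x 0)" and x1: "1 \<le> real (x 1)"
    using ge2(3) by (auto simp: positive_seq_def)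
  have sh: "shift (Suc 0) (shift (Suc 0) x) = shift 2 x"
    by (simp add: numeral_2_eq_2)
  have 1: "\<bar>cf_fold (Suc (Suc n)) x s - cf_fold (Suc (Suc n)) x t\<bar>
      = \<bar>1 / (x 1 + u) - 1 / (x 1 + v)\<bar> / ((x 0 + 1 / (x 1 + u)) * (x 0 + 1 / (x 1 + v)))"
    using cf_fold_step_diff[OF x0, of "1 / (x 1 + u)" "1 / (x 1 + v)"] uv x1
    by (simp add: u_def v_def sh shift_apply del: shift_shift)
  also have "\<dots> = \<bar>u - v\<bar> / ((x 1 + u) * (x 1 + v)) / ((x 0 + 1 / (x 1 + u)) * (x 0 + 1 / (x 1 + v)))"
    using cf_fold_step_diff[OF x1 uv(1,3)] by simp
  \<comment> \<open>Clearing the inner fractions turns each factor into 1 plus a product of two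
    numbers that are at least 1, hence into something at least 2, even when both digits are
    1.\<close>
  also have "\<dots> = \<bar>u - v\<bar> / ((x 0 * (x 1 + u) + 1) * (x 0 * (x 1 + v) + 1))"
  proof -
    have "(x 1 + u) * (x 0 + 1 / (x 1 + u)) = x 0 * (x 1 + u) + 1"
      "(x 1 + v) * (x 0 + 1 / (x 1 + v)) = x 0 * (x 1 + v) + 1"
      using x1 uv by (simp_all add: field_simps)
    then have "((x 1 + u) * (x 0 + 1 / (x 1 + u))) * ((x 1 + v) * (x 0 + 1 / (x 1 + v)))
      = (x 0 * (x 1 + u) + 1) * (x 0 * (x 1 + v) + 1)" by simp
    then have "((x 1 + u) * (x 1 + v)) * ((x 0 + 1 / (x 1 + u)) * (x 0 + 1 / (x 1 + v)))
      = (x 0 * (x 1 + u) + 1) * (x 0 * (x 1 + v) + 1)" by (simp only: mult_ac)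
    then show ?thesis by (simp only: divide_divide_eq_left)
  qed
  also have "\<dots> \<le> \<bar>u - v\<bar> / (2 * 2)"
  proof (intro divide_left_mono mult_mono mult_pos_pos)
    have "1 * 1 \<le> real (x 0) * (x 1 + u)" "1 * 1 \<le> real (x 0) * (x 1 + v)"
      by (rule mult_mono; use x0 x1 uv in simp)+
    then show "2 \<le> real (x 0) * (x 1 + u) + 1" "2 \<le> real (x 0) * (x 1 + v) + 1"
      "0 < real (x 0) * (x 1 + u) + 1" "0 < real (x 0) * (x 1 + v) + 1" by auto
  qed (use x0 x1 uv in auto)
  also have "\<bar>u - v\<bar> / (2 * 2) \<le> 2 * (1 / 2) ^ n / (2 * 2)"
    using ge2(1)[OF px] by (intro divide_right_mono) (auto simp: u_def v_def)
  finally show ?case by simp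
next
  \<comment> \<open>The factor 2 in the bound makes it equal to 1 here, so the bare range of
    \<open>cf_fold\<close> suffices for a single step.\<close>
  case 1
  then have "0 \<le> cf_fold 1 x s \<and> cf_fold 1 x s \<le> 1" "0 \<le> cf_fold 1 x t \<and> cf_fold 1 x t \<le> 1"
    using cf_fold_range assms by blast+
  then have "\<bar>cf_fold 1 x s - cf_fold 1 x t\<bar> \<le> 1" by linarith
  then show ?case by simp
qed (use assms in auto)

lemma cf_convergent_tendsto:
  assumes "positive_seq x"
  shows "(\<lambda>k. cf_convergent k x) \<longlonglongrightarrow> cf_value x"
proof -
  have close: "\<bar>cf_convergent m x - cf_convergent n x\<bar> \<le> 2 * (1 / 2) ^ n" if "n \<le> m" for m n
    using cf_fold_contraction[OF assms, of "cf_convergent (m - n) (shift n x)" 0 n]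
      cf_convergent_range[OF positive_seq_shift[OF assms]] cf_convergent_add[of n "m - n" x]
      cf_convergent_add[of n 0 x] that by auto
  have "Cauchy (\<lambda>k. cf_convergent k x)"
  proof (rule metric_CauchyI)
    fix e :: real assume "0 < e"
    have "(\<lambda>n. 2 * (1 / 2) ^ n :: real) \<longlonglongrightarrow> 0"
      using LIMSEQ_realpow_zero[of "1 / 2 :: real"] by (auto intro: tendsto_mult_right_zero)
    then obtain N where N: "2 * (1 / 2) ^ N < e / 2"
      using \<open>0 < e\<close> order_tendstoD(2)[of _ 0 _ "e / 2"] by (metis eventually_sequentially half_gt_zero order_refl)
    have "dist (cf_convergent m x) (cf_convergent n x) < e" if "m \<ge> N" "n \<ge> N" for m n
      using close[OF that(1)] close[OF that(2)] N by (simp add: dist_real_def abs_le_iff abs_less_iff)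
    then show "\<exists>N. \<forall>m\<ge>N. \<forall>n\<ge>N. dist (cf_convergent m x) (cf_convergent n x) < e" by blast
  qed
  then show ?thesis
    unfolding cf_value_def by (rule iffD1[OF convergent_LIMSEQ_iff Cauchy_convergent])
qed

lemma cf_value_unit:
  assumes "positive_seq x" shows "0 \<le> cf_value x \<and> cf_value x \<le> 1"
  using cf_convergent_range[OF assms] cf_convergent_tendsto[OF assms]
  by (meson LIMSEQ_le_const LIMSEQ_le_const2)

lemma cf_value_fold:
  assumes "positive_seq x"
  shows "cf_value x = cf_fold n x (cf_value (shift n x))"
  using assms
proof (induction n arbitrary: x)
  case (Suc n)
  have px: "positive_seq (shift 1 x)" using Suc positive_seq_shift by blast
  have "(\<lambda>k. 1 / (real (x 0) + cf_convergent k (shift 1 x))) \<longlonglongrightarrow> 1 / (real (x 0) + cf_value (shift 1 x))"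
    using cf_convergent_tendsto[OF px] cf_value_unit[OF px] Suc(2)
    by (intro tendsto_intros) (auto simp: positive_seq_def add_nonneg_eq_0_iff Suc_le_eq)
  moreover have "(\<lambda>k. cf_convergent (Suc k) x) \<longlonglongrightarrow> cf_value x"
    by (rule LIMSEQ_Suc[OF cf_convergent_tendsto[OF Suc(2)]])
  ultimately have "cf_value x = 1 / (real (x 0) + cf_value (shift 1 x))"
    by (simp add: LIMSEQ_unique)
  then show ?case using Suc.IH[OF px] by simp
qed simp

lemma cf_value_step:
  "positive_seq x \<Longrightarrow> cf_value x = 1 / (real (x 0) + cf_value (shift 1 x))"
  using cf_value_fold[of x 1] by simp

lemma cf_value_pos: "positive_seq x \<Longrightarrow> 0 < cf_value x"
  using cf_value_step[of x] cf_value_unit[OF positive_seq_shift[of x 1]]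
  by (auto simp: positive_seq_def intro!: divide_pos_pos add_pos_nonneg simp: Suc_le_eq)

lemma cf_value_less: "positive_seq x \<Longrightarrow> cf_value x < 1 / real (x 0)"
  using cf_value_step[of x] cf_value_pos[OF positive_seq_shift[of x 1]]
  by (auto simp: positive_seq_def Suc_le_eq intro!: divide_strict_left_mono mult_pos_pos add_pos_pos)

lemma cf_value_less_1: "positive_seq x \<Longrightarrow> cf_value x < 1"
  using cf_value_less[of x] by (force simp: positive_seq_def divide_le_eq elim: less_le_trans)

lemma cf_value_ge: "positive_seq x \<Longrightarrow> 1 / (real (x 0) + 1) \<le> cf_value x"
  using cf_value_step[of x] cf_value_unit[OF positive_seq_shift[of x 1]]
  by (auto simp: positive_seq_def Suc_le_eq intro!: divide_left_mono mult_pos_pos add_pos_nonneg)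

lemma cf_value_cong_prefix:
  assumes "positive_seq x" "positive_seq y" "\<And>i. i < n \<Longrightarrow> x i = y i"
  shows "\<bar>cf_value x - cf_value y\<bar> \<le> (\<Prod>i<n. 1 / (real (x i))\<^sup>2)"
    "\<bar>cf_value x - cf_value y\<bar> \<le> 2 * (1 / 2) ^ n"
    "(\<Prod>i<n. 1 / (real (x i) + 1)\<^sup>2) * \<bar>cf_value (shift n x) - cf_value (shift n y)\<bar>
      \<le> \<bar>cf_value x - cf_value y\<bar>"
proof -
  let ?s = "cf_value (shift n x)" and ?t = "cf_value (shift n y)"
  have r: "0 \<le> ?s" "?s \<le> 1" "0 \<le> ?t" "?t \<le> 1"
    using cf_value_unit positive_seq_shift assms by blast+
  have e: "cf_value x = cf_fold n x ?s" "cf_value y = cf_fold n x ?t"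
    using cf_value_fold assms cf_fold_cong[of n x y] by metis+
  note b = cf_fold_dist_bounds[OF assms(1) r, of n, folded e]
  have "(\<Prod>i<n. 1 / (real (x i))\<^sup>2) * \<bar>?s - ?t\<bar> \<le> (\<Prod>i<n. 1 / (real (x i))\<^sup>2) * 1"
    using r by (intro mult_left_mono prod_nonneg) auto
  then show "\<bar>cf_value x - cf_value y\<bar> \<le> (\<Prod>i<n. 1 / (real (x i))\<^sup>2)" using b by simp
  show "\<bar>cf_value x - cf_value y\<bar> \<le> 2 * (1 / 2) ^ n"
    using cf_fold_contraction[OF assms(1) r, of n, folded e] .
  show "(\<Prod>i<n. 1 / (real (x i) + 1)\<^sup>2) * \<bar>?s - ?t\<bar> \<le> \<bar>cf_value x - cf_value y\<bar>"
    using b by simp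
qed

lemma cf_value_eqD:
  assumes "positive_seq x" "positive_seq y" "cf_value x = cf_value y"
  shows "x 0 = y 0 \<and> cf_value (shift 1 x) = cf_value (shift 1 y)"
proof -
  have p: "positive_seq (shift 1 x)" "positive_seq (shift 1 y)"
    using assms positive_seq_shift by blast+
  have "1 / cf_value x = 1 / cf_value y" using assms(3) by simp
  then have eq: "real (x 0) + cf_value (shift 1 x) = real (y 0) + cf_value (shift 1 y)"
    unfolding cf_value_step[OF assms(1)] cf_value_step[OF assms(2)] by simp
  then have "\<bar>real (x 0) - real (y 0)\<bar> < 1"
    using cf_value_pos[OF p(1)] cf_value_pos[OF p(2)] cf_value_less_1[OF p(1)] cf_value_less_1[OF p(2)]
    by linarith
  then have "x 0 = y 0" by linarith
  then show ?thesis using eq by simp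
qed

lemma cf_value_inj:
  assumes "positive_seq x" "positive_seq y" "cf_value x = cf_value y"
  shows "x = y"
proof
  fix i
  have "cf_value (shift i x) = cf_value (shift i y)"
  proof (induction i)
    case (Suc i)
    then show ?case
      using cf_value_eqD[of "shift i x" "shift i y"] assms positive_seq_shift by simp
  qed (use assms in simp)
  then show "x i = y i"
    using cf_value_eqD[of "shift i x" "shift i y"] assms positive_seq_shift by (simp add: shift_apply)
qed

text \<open>Infinite descent on the denominator: a value \<open>p / q\<close> is below 1, so
  \<open>p < q\<close>, and the shifted sequence has the value
  \<open>(q - y 0 * p) / p\<close>.\<close>

lemma cf_value_irrational:
  assumes "positive_seq x" shows "cf_value x \<notin> \<rat>"
proof
  have descent: "\<not> (positive_seq y \<and> 0 < q \<and> cf_value y * real q = real p)" for p q y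
  proof (induction q arbitrary: p y rule: less_induct)
    case (less q)
    show ?case
    proof
      assume *: "positive_seq y \<and> 0 < q \<and> cf_value y * real q = real p"
      then have y: "0 < cf_value y" "cf_value y < 1" "0 < cf_value (shift 1 y)" "positive_seq (shift 1 y)"
        using cf_value_pos cf_value_less_1 positive_seq_shift by blast+
      have "real p = cf_value y * real q" using * by simp
      then have "real p < 1 * real q" "0 < real p"
        using mult_strict_right_mono[OF y(2), of "real q"] mult_pos_pos[OF y(1), of "real q"] *
        by (simp_all only: of_nat_0_less_iff)
      then have pq: "p < q" "0 < p" by simp_all
      have "0 < real (y 0) + cf_value (shift 1 y)" using y by simp
      then have "cf_value y * (real (y 0) + cf_value (shift 1 y)) = 1"
        using * cf_value_step[of y] by simp
      moreover have "real p * (real (y 0) + cf_value (shift 1 y))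
          = real q * (cf_value y * (real (y 0) + cf_value (shift 1 y)))"
        using \<open>real p = cf_value y * real q\<close> by (simp only: mult_ac)
      ultimately have "real p * (real (y 0) + cf_value (shift 1 y)) = real q" by simp
      then have "cf_value (shift 1 y) * real p = real q - real (y 0 * p)"
        by (simp add: algebra_simps)
      moreover from this have "0 < real q - real (y 0 * p)" using y(3) pq(2) by (metis mult_pos_pos of_nat_0_less_iff)
      then have "real (y 0 * p) < real q" by linarith
      then have "y 0 * p < q" by (simp only: of_nat_less_iff)
      ultimately have "cf_value (shift 1 y) * real p = real (q - y 0 * p)" by (simp add: of_nat_diff)
      then show False using less[OF pq(1)] y pq by blast
    qed
  qed
  assume "cf_value x \<in> \<rat>"
  then obtain m n :: int where mn: "n > 0" "cf_value x = of_int m / of_int n"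
    by (rule Rats_cases')
  then have "0 < m" using cf_value_pos[OF assms] by (simp add: zero_less_divide_iff)
  have "cf_value x * real (nat n) = real (nat m)"
    using mn \<open>0 < m\<close> by (simp add: of_nat_nat)
  then show False using descent[of x "nat n" "nat m"] mn(1) assms by simp
qed

text \<open>The digits are read off the orbit of \<open>t\<close> under the Gauss map. Irrationality
  keeps the orbit away from 0, so it never stops, and the contraction of \<open>cf_fold\<close>
  forces the convergents back to \<open>t\<close>.\<close>

lemma cf_value_surj:
  assumes "0 \<le> t" "t \<le> 1" "t \<notin> \<rat>"
  shows "\<exists>x. positive_seq x \<and> cf_value x = t"
proof -
  define T where "T = rec_nat t (\<lambda>_ s. frac (1 / s))"
  have T0: "T 0 = t" and TS: "T (Suc n) = frac (1 / T n)" for n by (simp_all add: T_def)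
  define x where "x n = nat \<lfloor>1 / T n\<rfloor>" for n
  have T: "0 < T n \<and> T n < 1 \<and> T n \<notin> \<rat>" for n
  proof (induction n)
    case 0
    have "t \<noteq> 0" "t \<noteq> 1" using assms by auto
    then show ?case using assms by (simp add: T0)
  next
    case (Suc n)
    then have inv: "1 / T n \<notin> \<rat>"
      by (metis Rats_divide Rats_1 div_by_1 divide_divide_eq_right mult_1)
    then have "frac (1 / T n) \<notin> \<rat>"
      unfolding frac_def by (metis Rats_add Rats_of_int diff_add_cancel)
    moreover from this have "frac (1 / T n) \<noteq> 0" by (metis Rats_0)
    ultimately show ?case using frac_lt_1 frac_ge_0[of "1 / T n"] by (simp add: TS order_less_le)
  qed
  have x1: "1 \<le> x n" and step: "T n = 1 / (real (x n) + T (Suc n))" for n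
  proof -
    have "1 < 1 / T n" using T[of n] by simp
    then have "1 \<le> \<lfloor>1 / T n\<rfloor>" by linarith
    then show "1 \<le> x n" unfolding x_def by linarith
    have "real (x n) + T (Suc n) = 1 / T n"
      using of_nat_nat[of "\<lfloor>1 / T n\<rfloor>", where 'a = real] \<open>1 \<le> \<lfloor>1 / T n\<rfloor>\<close>
      unfolding x_def TS frac_def by linarith
    then show "T n = 1 / (real (x n) + T (Suc n))" by simp
  qed
  then have px: "positive_seq x" by (simp add: positive_seq_def)
  have fold: "T m = cf_fold n (shift m x) (T (m + n))" for m n
  proof (induction n arbitrary: m)
    case (Suc n)
    have "shift m x 0 = x m" by (simp add: shift_def)
    then show ?case using step[of m] Suc[of "Suc m"] by simp
  qed simp
  have "\<bar>cf_convergent n x - t\<bar> \<le> 2 * (1 / 2) ^ n" for n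
    using cf_fold_contraction[OF px, of 0 "T n" n] fold[of 0 n] T[of n] T0
    by (simp add: cf_convergent_eq_fold)
  moreover have "(\<lambda>n. 2 * (1 / 2) ^ n :: real) \<longlonglongrightarrow> 0"
    using LIMSEQ_realpow_zero[of "1 / 2 :: real"] by (auto intro: tendsto_mult_right_zero)
  ultimately have "(\<lambda>n. cf_convergent n x - t) \<longlonglongrightarrow> 0"
    by (intro Lim_null_comparison[of "\<lambda>n. cf_convergent n x - t" "\<lambda>n. 2 * (1 / 2) ^ n"]
        always_eventually allI) (simp_all only: real_norm_def)
  then have "(\<lambda>n. cf_convergent n x) \<longlonglongrightarrow> t" using LIM_zero_iff by blast
  then show ?thesis using cf_convergent_tendsto[OF px] px LIMSEQ_unique by blast
qed

section \<open>Digit sequences and partial quotients of irrationals\<close>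

lemma partial_quotients_cf_value:
  assumes "positive_seq x" shows "partial_quotients (cf_value x) = x"
  unfolding partial_quotients_def
  by (rule the_equality) (use assms cf_value_inj in \<open>auto simp: positive_seq_def\<close>)

lemma
  assumes "t \<in> {0..1}" "t \<notin> \<rat>"
  shows positive_partial_quotients: "positive_seq (partial_quotients t)"
    and cf_value_partial_quotients: "cf_value (partial_quotients t) = t"
proof -
  obtain x where "positive_seq x" "cf_value x = t"
    using cf_value_surj[of t] assms by auto
  then show "positive_seq (partial_quotients t)" "cf_value (partial_quotients t) = t"
    using partial_quotients_cf_value by auto
qed

lemma seq_space_positive: "x \<in> seq_space a n \<Longrightarrow> positive_seq x"
  by (auto simp: seq_space_def alphabet_def positive_seq_def)

lemma X_alpha_eq_image: "X_alpha a = cf_value ` seq_space a 0"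
proof (intro equalityI subsetI)
  fix t assume t: "t \<in> X_alpha a"
  then have "partial_quotients t \<in> seq_space a 0"
    using positive_partial_quotients[of t]
    by (auto simp: X_alpha_def seq_space_def alphabet_def positive_seq_def)
  then show "t \<in> cf_value ` seq_space a 0"
    using cf_value_partial_quotients[of t] t by (auto simp: X_alpha_def intro: image_eqI[of _ _ "partial_quotients t"])
next
  fix t assume "t \<in> cf_value ` seq_space a 0"
  then obtain x where x: "x \<in> seq_space a 0" "t = cf_value x" by blast
  then show "t \<in> X_alpha a"
    using seq_space_positive[OF x(1)] cf_value_unit cf_value_irrational partial_quotients_cf_value
    by (auto simp: X_alpha_def seq_space_def alphabet_def)
qed


section \<open>Hausdorff measure\<close>

lemma gauge_diam_antimono:
  assumes "0 \<le> s" "s \<le> t" "0 < t" "bounded U" "diameter U \<le> 1"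
  shows "gauge_diam t U \<le> gauge_diam s U"
proof (cases "U = {}")
  case False
  have "0 \<le> diameter U" using diameter_ge_0[OF assms(4)] .
  then have "diameter U powr t \<le> diameter U powr s"
    using assms by (cases "diameter U = 0") (auto intro!: powr_mono')
  moreover have "diameter U powr t \<le> 1"
    using \<open>0 \<le> diameter U\<close> assms by (intro powr_le1) auto
  ultimately show ?thesis using assms False
    by (auto simp: gauge_diam_def ennreal_le_iff intro!: ennreal_leI)
qed (simp add: gauge_diam_def)

lemma hausdorff_measure_antimono:
  assumes "0 \<le> s" "s \<le> t" "0 < t"
  shows "hausdorff_measure t A \<le> hausdorff_measure s A"
  unfolding hausdorff_measure_def
proof (rule SUP_least)
  fix d :: real assume d: "d \<in> {0<..}"
  \<comment> \<open>\<open>powr\<close> is antitone in the exponent only for bases at most 1, so the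
    mesh is first cut down to \<open>min d 1\<close>, which can only increase the content.\<close>
  have "hausdorff_content t d A \<le> hausdorff_content t (min d 1) A"
    unfolding hausdorff_content_def by (rule INF_superset_mono) auto
  also have "\<dots> \<le> hausdorff_content s (min d 1) A"
    unfolding hausdorff_content_def
  proof (rule INF_mono)
    fix U assume U: "U \<in> {U :: nat \<Rightarrow> 'a set. A \<subseteq> (\<Union>i. U i) \<and> (\<forall>i. bounded (U i) \<and> diameter (U i) \<le> min d 1)}"
    then have "(\<Sum>i. gauge_diam t (U i)) \<le> (\<Sum>i. gauge_diam s (U i))"
      using assms by (intro suminf_le gauge_diam_antimono) auto
    then show "\<exists>V\<in>{U. A \<subseteq> (\<Union>i. U i) \<and> (\<forall>i. bounded (U i) \<and> diameter (U i) \<le> min d 1)}.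
        (\<Sum>i. gauge_diam t (V i)) \<le> (\<Sum>i. gauge_diam s (U i))" using U by blast
  qed
  also have "\<dots> \<le> (SUP d\<in>{0<..}. hausdorff_content s d A)"
    using d by (intro SUP_upper) auto
  finally show "hausdorff_content t d A \<le> (SUP d\<in>{0<..}. hausdorff_content s d A)" .
qed

text \<open>Monotonicity in the exponent carries the nonvanishing at \<open>t\<close> down to every
  smaller exponent.\<close>

lemma hausdorff_dim_eqI:
  assumes "0 < t" "hausdorff_measure t A \<noteq> 0"
    and "\<And>s. t < s \<Longrightarrow> hausdorff_measure s A = 0"
  shows "hausdorff_dim A = ennreal t"
  unfolding hausdorff_dim_def
proof (rule antisym)
  show "Inf {ennreal s |s. 0 \<le> s \<and> hausdorff_measure s A = 0} \<le> ennreal t"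
  proof (rule ennreal_le_epsilon)
    fix e :: real assume "0 < e"
    then have "ennreal (t + e) \<in> {ennreal s |s. 0 \<le> s \<and> hausdorff_measure s A = 0}"
      using assms(1) assms(3)[of "t + e"] by (intro CollectI exI[of _ "t + e"]) auto
    then show "Inf {ennreal s |s. 0 \<le> s \<and> hausdorff_measure s A = 0} \<le> ennreal t + ennreal e"
      using assms(1) \<open>0 < e\<close> by (intro Inf_lower2) (auto simp flip: ennreal_plus)
  qed
  show "ennreal t \<le> Inf {ennreal s |s. 0 \<le> s \<and> hausdorff_measure s A = 0}"
  proof (rule Inf_greatest)
    fix u assume "u \<in> {ennreal s |s. 0 \<le> s \<and> hausdorff_measure s A = 0}"
    then obtain s where s: "u = ennreal s" "0 \<le> s" "hausdorff_measure s A = 0" by blast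
    have "\<not> s \<le> t"
      using hausdorff_measure_antimono[of s t A] s assms(1,2) by auto
    then show "ennreal t \<le> u" using s by (simp add: ennreal_leI)
  qed
qed

lemma hausdorff_measure_eq_0I:
  assumes "0 < s"
    and "\<And>e d :: real. 0 < e \<Longrightarrow> 0 < d \<Longrightarrow> \<exists>U :: nat \<Rightarrow> 'a::metric_space set. A \<subseteq> (\<Union>i. U i) \<and>
      (\<forall>i. bounded (U i) \<and> diameter (U i) \<le> d) \<and> (\<Sum>i. ennreal (diameter (U i) powr s)) \<le> ennreal e"
  shows "hausdorff_measure s A = 0"
proof -
  have le: "hausdorff_content s d A \<le> ennreal e" if de: "0 < d" "0 < e" for d e
  proof -
    obtain U :: "nat \<Rightarrow> 'a set" where U: "A \<subseteq> (\<Union>i. U i)" "\<And>i. bounded (U i) \<and> diameter (U i) \<le> d"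
      "(\<Sum>i. ennreal (diameter (U i) powr s)) \<le> ennreal e"
      using assms(2)[OF de(2,1)] by blast
    have "(\<Sum>i. gauge_diam s (U i)) \<le> (\<Sum>i. ennreal (diameter (U i) powr s))"
      using assms(1) by (intro suminf_le) (auto simp: gauge_diam_def)
    then show ?thesis
      unfolding hausdorff_content_def using U by (intro INF_lower2[of U]) auto
  qed
  have "hausdorff_content s d A \<le> 0" if "0 < d" for d
  proof (rule ennreal_le_epsilon)
    fix e :: real assume "0 < e"
    then show "hausdorff_content s d A \<le> 0 + ennreal e" using le[OF that] by simp
  qed
  then have "hausdorff_measure s A \<le> 0"
    unfolding hausdorff_measure_def by (intro SUP_least) auto
  then show ?thesis by simp
qed

text \<open>Mass distribution principle, for a measure carried over to the metric space by \<open>f\<close>.\<close>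

lemma hausdorff_measure_eq_top:
  fixes f :: "'b \<Rightarrow> 'a::metric_space"
  assumes s: "0 < s" and E: "E \<in> sets M" "emeasure M E > 0" "f ` E \<subseteq> B"
    and fin: "emeasure M E < \<infinity>"
    and cover: "\<And>e :: real. 0 < e \<Longrightarrow> \<exists>d>0. \<forall>U. bounded U \<and> diameter U \<le> d \<longrightarrow>
      (\<exists>S\<in>sets M. E \<inter> f -` U \<subseteq> S \<and> emeasure M S \<le> ennreal (e * diameter U powr s))"
  shows "hausdorff_measure s B = \<infinity>"
proof -
  \<comment> \<open>Here \<open>e\<close> is the factor in front of \<open>diameter U powr s\<close>
    at fine scales. The usual lower bound is \<open>measure M E / e\<close>, and as \<open>e\<close>
    may be arbitrarily small the measure is infinite rather than merely positive.\<close>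
  have bound: "ennreal (measure M E / e) \<le> hausdorff_measure s B" if e: "0 < e" for e
  proof -
    obtain d where d: "0 < d" and cov: "\<And>U. bounded U \<Longrightarrow> diameter U \<le> d \<Longrightarrow>
      \<exists>S\<in>sets M. E \<inter> f -` U \<subseteq> S \<and> emeasure M S \<le> ennreal (e * diameter U powr s)"
      using cover[OF e] by blast
    have "ennreal (measure M E / e) \<le> hausdorff_content s d B"
      unfolding hausdorff_content_def
    proof (rule INF_greatest)
      fix U assume "U \<in> {U :: nat \<Rightarrow> 'a set. B \<subseteq> (\<Union>i. U i) \<and> (\<forall>i. bounded (U i) \<and> diameter (U i) \<le> d)}"
      then have U: "B \<subseteq> (\<Union>i. U i)" "\<And>i. bounded (U i)" "\<And>i. diameter (U i) \<le> d" by auto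
      \<comment> \<open>Covering sets are arbitrary, so their preimages need not be measurable;
        measurable supersets \<open>S i\<close> stand in for them.\<close>
      have "\<forall>i. \<exists>S. S \<in> sets M \<and> E \<inter> f -` U i \<subseteq> S \<and>
          emeasure M S \<le> ennreal (e * diameter (U i) powr s)"
      proof
        fix i
        show "\<exists>S. S \<in> sets M \<and> E \<inter> f -` U i \<subseteq> S \<and>
          emeasure M S \<le> ennreal (e * diameter (U i) powr s)"
          using cov[OF U(2,3)[of i]] by blast
      qed
      from choice[OF this] obtain S where S: "\<And>i. S i \<in> sets M" "\<And>i. E \<inter> f -` U i \<subseteq> S i"
        "\<And>i. emeasure M (S i) \<le> ennreal (e * diameter (U i) powr s)"
        by auto
      have "E \<subseteq> (\<Union>i. S i)"
      proof
        fix x assume x: "x \<in> E"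
        then have "f x \<in> (\<Union>i. U i)" using U(1) E(3) by (meson image_subset_iff subsetD)
        then obtain i where "f x \<in> U i" by auto
        then show "x \<in> (\<Union>i. S i)" using S(2)[of i] x by auto
      qed
      then have "emeasure M E \<le> emeasure M (\<Union>i. S i)"
        using S(1) by (intro emeasure_mono) auto
      also have "\<dots> \<le> (\<Sum>i. emeasure M (S i))"
        using S(1) by (intro emeasure_subadditive_countably) auto
      also have "\<dots> \<le> (\<Sum>i. ennreal e * gauge_diam s (U i))"
      proof (rule suminf_le)
        fix i
        show "emeasure M (S i) \<le> ennreal e * gauge_diam s (U i)"
        proof -
          have "ennreal (diameter (U i) powr s) \<le> gauge_diam s (U i)"
            using s by (simp add: gauge_diam_def)
          then have "ennreal e * ennreal (diameter (U i) powr s) \<le> ennreal e * gauge_diam s (U i)"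
            by (rule mult_left_mono) simp
          then show ?thesis
            using S(3)[of i] ennreal_mult[of e "diameter (U i) powr s"] e by simp
        qed
      qed auto
      also have "\<dots> = ennreal e * (\<Sum>i. gauge_diam s (U i))"
        by (rule ennreal_suminf_cmult)
      finally have le: "emeasure M E \<le> ennreal e * (\<Sum>i. gauge_diam s (U i))" .
      have "ennreal (measure M E / e) = emeasure M E / ennreal e"
        using fin e by (subst emeasure_eq_ennreal_measure) (auto simp: divide_ennreal)
      also have "\<dots> \<le> (ennreal e * (\<Sum>i. gauge_diam s (U i))) / ennreal e"
        by (rule divide_right_mono_ennreal[OF le])
      also have "\<dots> = (\<Sum>i. gauge_diam s (U i))"
        using e by (subst mult.commute, intro mult_divide_eq_ennreal) auto
      finally show "ennreal (measure M E / e) \<le> (\<Sum>i. gauge_diam s (U i))" .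
    qed
    also have "\<dots> \<le> hausdorff_measure s B"
      unfolding hausdorff_measure_def using d by (intro SUP_upper) auto
    finally show ?thesis .
  qed
  have pos: "0 < measure M E"
    using E(2) fin by (simp add: measure_def enn2real_positive_iff)
  show ?thesis
  proof (rule ccontr)
    assume "hausdorff_measure s B \<noteq> \<infinity>"
    then obtain h where h: "0 \<le> h" "hausdorff_measure s B = ennreal h"
      by (metis ennreal_cases infinity_ennreal_def)
    have "ennreal (h + 1) \<le> hausdorff_measure s B"
      using bound[of "measure M E / (h + 1)"] pos h(1) by simp
    then show False using h by (simp add: ennreal_le_iff)
  qed
qed


section \<open>Independent random digits\<close>

definition digit_measure :: "(nat \<Rightarrow> nat pmf) \<Rightarrow> (nat \<Rightarrow> nat) measure" where
  "digit_measure p = (\<Pi>\<^sub>M i\<in>UNIV. measure_pmf (p i))"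

lemma space_digit_measure [simp]: "space (digit_measure p) = UNIV"
  by (simp add: digit_measure_def space_PiM PiE_UNIV_domain)

lemma sets_digit_measure: "sets (digit_measure p) = sets (digit_measure q)"
  unfolding digit_measure_def by (rule sets_PiM_cong) simp_all

lemma prob_space_digit_measure: "prob_space (digit_measure p)"
  unfolding digit_measure_def by (intro prob_space_PiM measure_pmf.prob_space_axioms)

lemma product_prob_space_pmf: "product_prob_space (\<lambda>i. measure_pmf (p i))"
  by (intro product_prob_spaceI measure_pmf.prob_space_axioms)

lemma measurable_digit [measurable]: "(\<lambda>z. z i) \<in> measurable (digit_measure p) (count_space UNIV)"
proof -
  have "(\<lambda>z. z i) \<in> measurable (digit_measure p) (measure_pmf (p i))"
    unfolding digit_measure_def by (rule measurable_component_singleton) simp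
  then show ?thesis by simp
qed

lemma measurable_map_digits [measurable]:
  "(\<lambda>z. map z xs) \<in> measurable (digit_measure p) (count_space UNIV)"
  unfolding measurable_count_space_eq2_countable
proof (intro conjI ballI)
  fix u :: "nat list"
  have "{z \<in> space (digit_measure p). length xs = length u \<and> (\<forall>i\<in>{..<length u}. z (xs ! i) = u ! i)}
      \<in> sets (digit_measure p)" by measurable
  also have "{z \<in> space (digit_measure p). length xs = length u \<and> (\<forall>i\<in>{..<length u}. z (xs ! i) = u ! i)}
      = (\<lambda>z. map z xs) -` {u} \<inter> space (digit_measure p)"
    by (auto simp: list_eq_iff_nth_eq)
  finally show "(\<lambda>z. map z xs) -` {u} \<inter> space (digit_measure p) \<in> sets (digit_measure p)" .
qed auto

definition prefix_determined :: "nat \<Rightarrow> ((nat \<Rightarrow> 'a) \<Rightarrow> 'b) \<Rightarrow> bool" where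
  "prefix_determined n F \<longleftrightarrow> (\<forall>z z'. (\<forall>i<n. z i = z' i) \<longrightarrow> F z = F z')"

lemma prefix_determined_factor:
  fixes F :: "(nat \<Rightarrow> nat) \<Rightarrow> 'b"
  assumes "prefix_determined n F"
  shows "F z = F (\<lambda>i. map z [0..<n] ! i)"
  using assms unfolding prefix_determined_def by auto

text \<open>\<open>F\<close> factors through the words of length \<open>n\<close>, a countable
  discrete space, so no regularity of \<open>F\<close> is required.\<close>

lemma prefix_determined_measurable:
  assumes "prefix_determined n F" "\<And>z. F z \<in> space N"
  shows "F \<in> measurable (digit_measure p) N"
proof -
  have "F = (\<lambda>z. (\<lambda>u. F (\<lambda>i. u ! i)) (map z [0..<n]))"
    by (rule ext, rule prefix_determined_factor[OF assms(1)])
  moreover have "(\<lambda>z. (\<lambda>u. F (\<lambda>i. u ! i)) (map z [0..<n])) \<in> measurable (digit_measure p) N"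
    by (rule measurable_compose[OF measurable_map_digits]) (simp add: assms(2))
  ultimately show ?thesis
    by (rule ssubst[where P = "\<lambda>G. G \<in> measurable (digit_measure p) N"])
qed

lemma emeasure_digit_measure_box:
  assumes "finite J"
  shows "emeasure (digit_measure p) {z. \<forall>i\<in>J. z i \<in> X i} = (\<Prod>i\<in>J. emeasure (measure_pmf (p i)) (X i))"
  using product_prob_space.emeasure_PiM_Collect[OF product_prob_space_pmf, of J UNIV X p] assms
    space_digit_measure[of p]
  by (simp add: digit_measure_def)

lemma emeasure_digit_measure_digit:
  "emeasure (digit_measure p) {z. z i \<in> X} = emeasure (measure_pmf (p i)) X"
  using emeasure_digit_measure_box[of "{i}" p "\<lambda>_. X"] by simp

lemma sets_digit_box:
  "finite J \<Longrightarrow> {z. \<forall>i\<in>J. z i \<in> X i} \<in> sets (digit_measure p)"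
proof -
  assume "finite J"
  then have "{z \<in> space (digit_measure p). \<forall>i\<in>J. z i \<in> X i} \<in> sets (digit_measure p)"
    by measurable
  then show ?thesis by simp
qed

lemma AE_digit_measure_digits: "AE z in digit_measure p. \<forall>i. z i \<in> set_pmf (p i)"
  unfolding AE_all_countable
proof
  fix i
  show "AE z in digit_measure p. z i \<in> set_pmf (p i)"
    unfolding digit_measure_def
    by (rule product_prob_space.AE_component[OF product_prob_space_pmf]) (auto intro: AE_measure_pmf)
qed

lemma distr_digit_measure_upd:
  "distr (measure_pmf (p i) \<Otimes>\<^sub>M digit_measure p) (digit_measure p) (\<lambda>(w, z). z(i := w)) = digit_measure p"
  using distr_pair_PiM_eq_PiM[of UNIV "\<lambda>i. measure_pmf (p i)" i]
  by (simp add: digit_measure_def measure_pmf.prob_space_axioms)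

lemma measurable_digit_upd [measurable]:
  "(\<lambda>(w, z). z(i := w)) \<in> measurable (measure_pmf (p i) \<Otimes>\<^sub>M digit_measure p) (digit_measure p)"
proof -
  have "(\<lambda>x. (snd x)(i := fst x)) \<in> measurable (measure_pmf (p i) \<Otimes>\<^sub>M digit_measure p)
      (\<Pi>\<^sub>M i\<in>UNIV. measure_pmf (p i))"
    by (rule measurable_fun_upd[of _ UNIV]) (auto simp: digit_measure_def)
  then show ?thesis by (simp add: digit_measure_def case_prod_beta')
qed

text \<open>Fubini with digit \<open>i\<close> split off. Resampling one coordinate independently
  preserves the product measure, so the inner integral can stay over the full measure although its
  digit \<open>i\<close> is overwritten. The bound is asked only where the digits lie in the
  supports, which is almost everywhere.\<close>

lemma integral_digit_measure_upd:
  fixes F :: "(nat \<Rightarrow> nat) \<Rightarrow> real"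
  assumes F: "F \<in> borel_measurable (digit_measure p)"
    and bound: "\<And>w z. w \<in> set_pmf (p i) \<Longrightarrow> (\<forall>j. z j \<in> set_pmf (p j)) \<Longrightarrow> \<bar>F (z(i := w))\<bar> \<le> B"
  shows "(\<integral>z. F z \<partial>digit_measure p) = (\<integral>w. (\<integral>z. F (z(i := w)) \<partial>digit_measure p) \<partial>measure_pmf (p i))"
proof -
  let ?P = "measure_pmf (p i) \<Otimes>\<^sub>M digit_measure p"
  interpret m: prob_space "digit_measure p" by (rule prob_space_digit_measure)
  interpret pair_sigma_finite "measure_pmf (p i)" "digit_measure p" ..
  interpret P: prob_space ?P
    by (intro pair_prob_space.intro measure_pmf.prob_space_axioms prob_space_digit_measure
        prob_space_pair)
  have meas: "(\<lambda>wz. F (case wz of (w, z) \<Rightarrow> z(i := w))) \<in> borel_measurable ?P"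
    using measurable_compose[OF measurable_digit_upd F] by simp
  have "AE x in distr ?P (digit_measure p) (\<lambda>(w, z). z(i := w)). \<bar>F x\<bar> \<le> B"
    unfolding distr_digit_measure_upd
    using AE_digit_measure_digits
  proof (rule AE_mp, intro AE_I2 impI)
    fix z assume "\<forall>j. z j \<in> set_pmf (p j)"
    then show "\<bar>F z\<bar> \<le> B" using bound[of "z i" z] by simp
  qed
  then have "AE wz in ?P. \<bar>F (case wz of (w, z) \<Rightarrow> z(i := w))\<bar> \<le> B"
    by (rule AE_distrD[OF measurable_digit_upd])
  then have int: "integrable ?P (\<lambda>wz. F (case wz of (w, z) \<Rightarrow> z(i := w)))"
    using meas by (intro P.integrable_const_bound[of _ B]) auto
  have "(\<integral>z. F z \<partial>digit_measure p) = (\<integral>z. F z \<partial>distr ?P (digit_measure p) (\<lambda>(w, z). z(i := w)))"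
    by (simp only: distr_digit_measure_upd)
  also have "\<dots> = (\<integral>wz. F (case wz of (w, z) \<Rightarrow> z(i := w)) \<partial>?P)"
    by (rule integral_distr[OF measurable_digit_upd F])
  also have "\<dots> = (\<integral>w. (\<integral>z. F (z(i := w)) \<partial>digit_measure p) \<partial>measure_pmf (p i))"
    using integral_fst'[OF int] by simp
  finally show ?thesis .
qed

lemma digit_measure_eventually_le:
  assumes "\<And>n. emeasure (measure_pmf (p n)) {t n<..} \<le> ennreal (b n)" "summable b" "\<And>n. 0 \<le> b n"
  shows "AE z in digit_measure p. \<forall>\<^sub>F n in sequentially. z n \<le> t n"
proof -
  interpret m: prob_space "digit_measure p" by (rule prob_space_digit_measure)
  have A: "{z. z n \<in> {t n<..}} \<in> sets (digit_measure p)" for n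
    using sets_digit_box[of "{n}" "\<lambda>n. {t n<..}" p] by simp
  have "measure (digit_measure p) {z. z n \<in> {t n<..}} \<le> b n" for n
  proof -
    have "ennreal (measure (digit_measure p) {z. z n \<in> {t n<..}}) \<le> ennreal (b n)"
      using assms(1)[of n] emeasure_digit_measure_digit[of p n "{t n<..}"]
      by (simp only: m.emeasure_eq_measure)
    then show ?thesis using assms(3)[of n] ennreal_le_iff by blast
  qed
  then have "summable (\<lambda>n. measure (digit_measure p) {z. z n \<in> {t n<..}})"
    by (intro summable_comparison_test'[OF assms(2), of 0]) simp
  then have "AE z in digit_measure p. eventually (\<lambda>n. z \<in> space (digit_measure p) - {z. z n \<in> {t n<..}}) sequentially"
    by (intro borel_cantelli_AE1 A) (simp_all add: m.emeasure_eq_measure)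
  then show ?thesis by (rule AE_mp) (auto elim!: eventually_mono intro!: AE_I2)
qed


section \<open>Power-law distributions on the digits\<close>

text \<open>\<open>x * b powr x\<close> increases strictly from 0 at \<open>x = 0\<close> to
  \<open>b\<close> at \<open>x = 1\<close>. This makes the description in \<open>gam\<close> well
  defined.\<close>

lemma gam_exists1:
  assumes "1 \<le> (b::real)" shows "\<exists>!g::real. 0 < g \<and> g \<le> 1 \<and> g * b powr g = 1"
proof -
  have "\<exists>g\<ge>0. g \<le> 1 \<and> g * b powr g = 1"
    by (rule IVT') (use assms in \<open>auto intro!: continuous_intros\<close>)
  then obtain g where g: "0 \<le> g" "g \<le> 1" "g * b powr g = 1" by blast
  have lt: "x * b powr x < y * b powr y" if "0 < x" "x < y" for x y :: real
  proof -
    have "x * b powr x \<le> x * b powr y"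
      using that assms by (intro mult_left_mono powr_mono) auto
    also have "\<dots> < y * b powr y" using that assms by (intro mult_strict_right_mono) auto
    finally show ?thesis .
  qed
  show ?thesis
  proof (rule ex1I[of _ g])
    show "0 < g \<and> g \<le> 1 \<and> g * b powr g = 1" using g by (cases "g = 0") auto
    fix h assume "0 < h \<and> h \<le> 1 \<and> h * b powr h = 1"
    then show "h = g" using g lt[of h g] lt[of g h] by (cases "g = 0") force+
  qed
qed

lemma
  assumes "1 \<le> a n"
  shows gam_pos: "0 < gam a n" and gam_le_1: "gam a n \<le> 1"
    and gam_powr: "gam a n * real (a n) powr gam a n = 1"
  using theI'[OF gam_exists1[of "real (a n)"]] assms by (auto simp: gam_def)

lemma gam_eq_powr:
  assumes "1 \<le> a n" shows "real (a n) powr - gam a n = gam a n"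
  using gam_powr[of a n] gam_pos[of a n] assms by (simp add: powr_minus field_simps)

text \<open>Comparison of a decreasing function with its integral over one unit interval; the
  integral is written as a difference of antiderivatives and estimated by the mean value
  theorem.\<close>

lemma powr_diff_bounds:
  assumes g: "0 < (g::real)" and l: "1 \<le> (l::nat)"
  shows "(real l powr - g - real (Suc l) powr - g) / g \<le> real l powr - (1 + g)"
    and "real (Suc l) powr - (1 + g) \<le> (real l powr - g - real (Suc l) powr - g) / g"
proof -
  have "\<exists>z>real l. z < real (Suc l) \<and> real (Suc l) powr - g - real l powr - g
      = (real (Suc l) - real l) * (- g * z powr (- g - 1))"
    by (rule MVT2) (use l in \<open>auto intro!: derivative_eq_intros\<close>)
  then obtain z where z: "real l < z" "z < real (Suc l)"
    "real (Suc l) powr - g - real l powr - g = - g * z powr (- g - 1)" by auto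
  then have eq: "(real l powr - g - real (Suc l) powr - g) / g = z powr (- g - 1)"
    using g by (simp add: field_simps)
  have exponent: "- (1 + g) = - g - 1" by simp
  show "(real l powr - g - real (Suc l) powr - g) / g \<le> real l powr - (1 + g)"
    unfolding eq exponent using z l g by (intro powr_mono2') auto
  show "real (Suc l) powr - (1 + g) \<le> (real l powr - g - real (Suc l) powr - g) / g"
    unfolding eq exponent using z l g by (intro powr_mono2') auto
qed

lemma powr_telescope_sums:
  assumes "0 < (g::real)"
  shows "(\<lambda>k. (real (N + k) powr - g - real (Suc (N + k)) powr - g) / g) sums (real N powr - g / g)"
proof -
  have "filterlim (\<lambda>k. real N + real k) at_top sequentially"
    by (rule filterlim_tendsto_add_at_top[OF tendsto_const filterlim_real_sequentially])
  then have "(\<lambda>k. real (N + k) powr - g) \<longlonglongrightarrow> 0"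
    using assms by (intro tendsto_neg_powr) simp_all
  from telescope_sums'[OF this] have "(\<lambda>k. real (N + k) powr - g - real (Suc (N + k)) powr - g) sums (real N powr - g)"
    by simp
  then show ?thesis by (rule sums_divide)
qed

text \<open>For positive \<open>N\<close> this is the Hurwitz zeta value at \<open>s\<close> with
  parameter \<open>N\<close>.\<close>

definition zeta_tail :: "nat \<Rightarrow> real \<Rightarrow> real" where
  "zeta_tail N s = (\<Sum>k. real (N + k) powr - s)"

lemma summable_zeta_tail: "1 < s \<Longrightarrow> summable (\<lambda>k. real (N + k) powr - s)"
  using summable_iff_shift[of "\<lambda>k. real k powr - s" N]
  by (simp add: summable_real_powr_iff add.commute)

lemma zeta_tail_ge:
  assumes "0 < g" "1 \<le> N" shows "real N powr - g / g \<le> zeta_tail N (1 + g)"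
  unfolding zeta_tail_def
proof (rule sums_le[OF _ powr_telescope_sums summable_sums[OF summable_zeta_tail]])
  fix k
  show "(real (N + k) powr - g - real (Suc (N + k)) powr - g) / g \<le> real (N + k) powr - (1 + g)"
    using powr_diff_bounds(1)[OF assms(1), of "N + k"] assms(2) by simp
qed (use assms in auto)

text \<open>The sum strictly beyond \<open>N\<close> is below the integral from \<open>N\<close> on.
  The index shift avoids an extra constant and has the shape of the probability of exceeding a
  level.\<close>

lemma zeta_tail_le:
  assumes "0 < g" "1 \<le> N" shows "zeta_tail (Suc N) (1 + g) \<le> real N powr - g / g"
  unfolding zeta_tail_def
proof (rule sums_le[OF _ summable_sums[OF summable_zeta_tail] powr_telescope_sums])
  fix k
  show "real (Suc N + k) powr - (1 + g) \<le> (real (N + k) powr - g - real (Suc (N + k)) powr - g) / g"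
    using powr_diff_bounds(2)[OF assms(1), of "N + k"] assms(2) by simp
qed (use assms in auto)

lemma zeta_tail_pos:
  assumes "1 < s" "1 \<le> N" shows "0 < zeta_tail N s"
  unfolding zeta_tail_def using assms by (intro suminf_pos[OF summable_zeta_tail]) auto

lemma zeta_tail_tendsto_0:
  assumes "1 < s" shows "(\<lambda>N. zeta_tail N s) \<longlonglongrightarrow> 0"
proof -
  have "(\<lambda>N. \<Sum>k. real (k + N) powr - s) \<longlonglongrightarrow> 0"
    by (rule suminf_exist_split2) (use assms in \<open>simp add: summable_real_powr_iff\<close>)
  then show ?thesis by (simp add: zeta_tail_def add.commute)
qed

definition power_pmf :: "nat \<Rightarrow> real \<Rightarrow> nat pmf" where
  "power_pmf N s = embed_pmf (\<lambda>l. if N \<le> l then real l powr - s / zeta_tail N s else 0)"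

lemma pmf_power_pmf:
  assumes "1 < s" "1 \<le> N"
  shows "pmf (power_pmf N s) l = (if N \<le> l then real l powr - s / zeta_tail N s else 0)"
  unfolding power_pmf_def
proof (rule pmf_embed_pmf)
  let ?f = "\<lambda>l. if N \<le> l then real l powr - s / zeta_tail N s else 0"
  show nn: "0 \<le> ?f l" for l using zeta_tail_pos[OF assms] by simp
  have "(\<lambda>k. ?f (k + N)) sums (zeta_tail N s / zeta_tail N s)"
    using sums_divide[OF summable_sums[OF summable_zeta_tail[OF assms(1), of N]], of "zeta_tail N s"]
    by (simp add: zeta_tail_def add.commute)
  then have "?f sums 1"
    using zeta_tail_pos[OF assms] sums_iff_shift[of ?f N "1 - (\<Sum>i<N. ?f i)"] by simp
  then show "(\<integral>\<^sup>+ l. ennreal (?f l) \<partial>count_space UNIV) = 1"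
    unfolding nn_integral_count_space_nat
    by (subst suminf_ennreal2) (use nn in \<open>auto simp: sums_iff\<close>)
qed

lemma set_power_pmf: "1 < s \<Longrightarrow> 1 \<le> N \<Longrightarrow> set_pmf (power_pmf N s) = {N..}"
  using zeta_tail_pos[of s N] by (auto simp: set_pmf_eq pmf_power_pmf)

lemma emeasure_pmf_greaterThan_le:
  assumes g: "0 < g" and t: "1 \<le> t" and D: "0 \<le> D"
    and le: "\<And>l. 1 \<le> l \<Longrightarrow> pmf q l \<le> D * real l powr - (1 + g)"
  shows "emeasure (measure_pmf q) {t<..} \<le> ennreal (D * (real t powr - g / g))"
proof -
  have img: "{t<..} = range (\<lambda>k. Suc t + k)"
    using less_iff_Suc_add by (auto simp: image_iff)
  have "emeasure (measure_pmf q) {t<..} = (\<Sum>k. ennreal (pmf q (Suc t + k)))"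
    unfolding img by (subst nn_integral_pmf'[symmetric]) (auto simp: nn_integral_count_space_nat inj_on_def)
  also have "\<dots> \<le> (\<Sum>k. ennreal (D * real (Suc t + k) powr - (1 + g)))"
    by (intro suminf_le ennreal_leI le) auto
  also have "\<dots> = ennreal (\<Sum>k. D * real (Suc t + k) powr - (1 + g))"
    using summable_mult[OF summable_zeta_tail[of "1 + g" "Suc t"], of D] g D by (intro suminf_ennreal2) auto
  also have "(\<Sum>k. D * real (Suc t + k) powr - (1 + g)) = D * zeta_tail (Suc t) (1 + g)"
    using g by (simp only: zeta_tail_def) (intro suminf_mult summable_zeta_tail, simp)
  also have "ennreal \<dots> \<le> ennreal (D * (real t powr - g / g))"
    using zeta_tail_le[OF g t] D by (intro ennreal_leI mult_left_mono)
  finally show ?thesis .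
qed

text \<open>The interval has \<open>L - l + 1\<close> letters, at most twice \<open>L - l\<close>,
  each of weight at most \<open>D / l\<close> once the exponent is relaxed to 1. What matters is the
  proportionality to \<open>L - l\<close>, which also governs the distance of the corresponding
  values.\<close>

lemma measure_pmf_atLeastAtMost_le:
  assumes g: "0 < g" and D: "0 \<le> D" and l: "1 \<le> l" "l < L"
    and le: "\<And>l. 1 \<le> l \<Longrightarrow> pmf q l \<le> D * real l powr - (1 + g)"
  shows "measure (measure_pmf q) {l..L} \<le> 2 * D * ((real L - real l) / real l)"
proof -
  have "measure (measure_pmf q) {l..L} = (\<Sum>v\<in>{l..L}. pmf q v)"
    by (simp add: measure_measure_pmf_finite)
  also have "\<dots> \<le> (\<Sum>v\<in>{l..L}. D * (1 / real l))"
  proof (rule sum_mono)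
    fix v assume v: "v \<in> {l..L}"
    have "real v powr - (1 + g) \<le> real l powr - (1 + g)"
      using v l g by (intro powr_mono2') auto
    also have "\<dots> \<le> real l powr - 1" using l g by (intro powr_mono) auto
    finally have "D * real v powr - (1 + g) \<le> D * (1 / real l)"
      using D l by (intro mult_left_mono) (auto simp: powr_minus_divide)
    then show "pmf q v \<le> D * (1 / real l)" using le[of v] v l by simp
  qed
  also have "\<dots> = (real L - real l + 1) * (D * (1 / real l))"
    using l by (simp add: of_nat_diff)
  also have "\<dots> \<le> (2 * (real L - real l)) * (D * (1 / real l))"
    using l D by (intro mult_right_mono) auto
  finally show ?thesis by (simp add: field_simps)
qed


section \<open>The growth condition\<close>

text \<open>The last equation also holds for \<open>a n = 1\<close>, where both sides are \<open>0\<close> because \<open>ln 0 = 0\<close>.\<close>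

lemma gam_ln:
  assumes "1 \<le> a n"
  shows "0 \<le> - ln (gam a n)" "ln (real (a n)) = - ln (gam a n) / gam a n"
    "ln (ln (real (a n))) = - ln (gam a n) + ln (- ln (gam a n))"
proof -
  have g: "0 < gam a n" "gam a n \<le> 1" using gam_pos gam_le_1 assms by blast+
  then show "0 \<le> - ln (gam a n)" by simp
  have "ln (gam a n * real (a n) powr gam a n) = 0" using gam_powr[of a n] assms by simp
  then have "ln (gam a n) + gam a n * ln (real (a n)) = 0"
    using g assms by (simp add: ln_mult ln_powr)
  then show eq: "ln (real (a n)) = - ln (gam a n) / gam a n"
    using g by (simp add: field_simps)
  show "ln (ln (real (a n))) = - ln (gam a n) + ln (- ln (gam a n))"
  proof (cases "gam a n = 1")
    case False
    then have "0 < - ln (gam a n)" using g by simp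
    then have "ln (- ln (gam a n) / gam a n) = ln (- ln (gam a n)) - ln (gam a n)"
      using g by (intro ln_divide_pos) auto
    then show ?thesis unfolding eq by simp
  qed (simp add: eq)
qed

text \<open>A bootstrap: bounds of this shape below \<open>n\<close> make the right-hand side at
  most quadratic in \<open>n\<close>, and the logarithm of a quadratic is
  \<open>2 * ln (n + 1)\<close> up to a constant, with the same \<open>C\<close> again.\<close>

lemma log_growth_bound:
  fixes l :: "nat \<Rightarrow> real"
  assumes "\<forall>\<^sub>F n in sequentially. exp (l n) \<le> 2 * real n + 2 * (\<Sum>k<n. l k)"
  shows "\<exists>C. \<forall>n. l n \<le> C + 2 * ln (real n + 1)"
proof -
  obtain N where N: "\<And>n. N \<le> n \<Longrightarrow> exp (l n) \<le> 2 * real n + 2 * (\<Sum>k<n. l k)"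
    using assms by (auto simp: eventually_sequentially)
  \<comment> \<open>The summand 2 secures \<open>4 \<le> exp C\<close>; the sum covers the indices
    below \<open>N\<close>.\<close>
  define C where "C = 2 + (\<Sum>k<N. \<bar>l k\<bar>)"
  have C2: "2 \<le> C" by (simp add: C_def sum_nonneg)
  have "l n \<le> C + 2 * ln (real n + 1)" for n
  proof (induction n rule: less_induct)
    case (less n)
    show ?case
    proof (cases "n < N")
      case True
      then have "\<bar>l n\<bar> \<le> (\<Sum>k<N. \<bar>l k\<bar>)" by (intro member_le_sum) auto
      moreover have "0 \<le> ln (real n + 1)" by simp
      ultimately show ?thesis unfolding C_def by linarith
    next
      case False
      have "l k \<le> C + 2 * real n" if "k < n" for k
        using less[OF that] ln_add_one_self_le_self[of "real k"] that by (simp add: add.commute)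
      then have "(\<Sum>k<n. l k) \<le> real n * (C + 2 * real n)"
        using sum_bounded_above[of "{..<n}" l "C + 2 * real n"] by simp
      then have "exp (l n) \<le> 2 * real n + 2 * (real n * (C + 2 * real n))"
        using N[of n] False by simp
      also have "\<dots> = 4 * real n ^ 2 + (1 + C) * (2 * real n)"
        by (simp add: algebra_simps power2_eq_square)
      also have "\<dots> \<le> exp C * real n ^ 2 + exp C * (2 * real n)"
      proof (intro add_mono mult_right_mono)
        have "2 ^ 2 \<le> C ^ 2" using C2 by (intro power_mono) auto
        then show "4 \<le> exp C" using exp_lower_Taylor_quadratic[of C] C2 by simp
        show "1 + C \<le> exp C" by (rule exp_ge_add_one_self)
      qed auto
      also have "\<dots> \<le> exp C * (real n + 1) ^ 2"
        by (simp add: algebra_simps power2_eq_square)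
      also have "\<dots> = exp (C + 2 * ln (real n + 1))"
        by (simp add: exp_add exp_double)
      finally show ?thesis by simp
    qed
  qed
  then show ?thesis by blast
qed

lemma sum_at_top:
  fixes c :: "nat \<Rightarrow> real"
  assumes "filterlim c at_top sequentially"
  shows "filterlim (\<lambda>n. \<Sum>k<n. c k) at_top sequentially"
proof -
  obtain N where N: "\<And>n. N \<le> n \<Longrightarrow> 1 \<le> c n"
    using assms by (auto simp: filterlim_at_top eventually_sequentially)
  have "(\<Sum>k<N. c k) - real N + real n \<le> (\<Sum>k<n. c k)" if "N \<le> n" for n
    using that
  proof (induction n rule: dec_induct)
    case (step n)
    then show ?case using N[of n] by simp
  qed simp
  then have "\<forall>\<^sub>F n in sequentially. (\<Sum>k<N. c k) - real N + real n \<le> (\<Sum>k<n. c k)"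
    by (auto simp: eventually_sequentially)
  moreover have "filterlim (\<lambda>n. (\<Sum>k<N. c k) - real N + real n) at_top sequentially"
    by (rule filterlim_tendsto_add_at_top[OF tendsto_const filterlim_real_sequentially])
  ultimately show ?thesis by (rule filterlim_at_top_mono[rotated])
qed

text \<open>The exponent is such that raising the level to \<open>- gam a n\<close> leaves
  \<open>gam a n * (n + 1) powr - (1 + d)\<close> at most, so the tail probabilities are summable.
  The base \<open>n + 1\<close> keeps the level at least \<open>a n\<close> from
  \<open>n = 0\<close> on.\<close>

definition trunc :: "(nat \<Rightarrow> nat) \<Rightarrow> real \<Rightarrow> nat \<Rightarrow> nat" where
  "trunc a d n = a n * nat \<lceil>(real n + 1) powr ((1 + d) / gam a n)\<rceil>"

lemma trunc_bounds:
  assumes "1 \<le> a n" "0 \<le> d"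
  shows "real (a n) * (real n + 1) powr ((1 + d) / gam a n) \<le> real (trunc a d n)"
    "real (trunc a d n) \<le> 2 * (real (a n) * (real n + 1) powr ((1 + d) / gam a n))"
    "1 \<le> trunc a d n"
proof -
  let ?x = "(real n + 1) powr ((1 + d) / gam a n)"
  have x: "1 \<le> ?x" using gam_pos[of a n] assms by (intro ge_one_powr_ge_zero) auto
  have "?x \<le> real (nat \<lceil>?x\<rceil>)" by linarith
  then show "real (a n) * ?x \<le> real (trunc a d n)"
    unfolding trunc_def of_nat_mult by (rule mult_left_mono) simp
  have "real (nat \<lceil>?x\<rceil>) \<le> 2 * ?x" using x by linarith
  then have "real (a n) * real (nat \<lceil>?x\<rceil>) \<le> real (a n) * (2 * ?x)" by (rule mult_left_mono) simp
  then show "real (trunc a d n) \<le> 2 * (real (a n) * ?x)"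
    unfolding trunc_def of_nat_mult by (simp add: mult_ac)
  have "1 \<le> nat \<lceil>?x\<rceil>" using x by linarith
  then have "1 * 1 \<le> a n * nat \<lceil>?x\<rceil>" using assms(1) by (intro mult_le_mono)
  then show "1 \<le> trunc a d n" by (simp add: trunc_def)
qed

lemma trunc_powr_le:
  assumes "1 \<le> a n" "0 \<le> d"
  shows "real (trunc a d n) powr - gam a n / gam a n \<le> (real n + 1) powr - (1 + d)"
proof -
  have g: "0 < gam a n" using gam_pos assms by blast
  have x: "0 < real (a n) * (real n + 1) powr ((1 + d) / gam a n)" using assms by simp
  have "real (trunc a d n) powr - gam a n \<le> (real (a n) * (real n + 1) powr ((1 + d) / gam a n)) powr - gam a n"
    using trunc_bounds(1)[of a n d] assms g x by (intro powr_mono2') auto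
  also have "\<dots> = gam a n * (real n + 1) powr - (1 + d)"
    using g gam_eq_powr[of a n] assms(1) by (simp add: powr_mult powr_powr)
  finally show ?thesis using g by (simp add: field_simps)
qed

text \<open>The growth hypothesis alone bounds the left-hand side by \<open>exp (O(n) + \<Sum>k<n. ln (- ln \<gamma>\<^sub>k))\<close>,
  which is too weak. A positive proportion of \<open>\<Sum>k<n. ln (ln \<alpha>\<^sub>k)\<close> is gained by passing from \<open>\<delta>\<close>
  to \<open>\<delta> / 2\<close>, because the hypothesis forces \<open>ln (ln \<alpha>\<^sub>n) \<le> 3 ln n\<close>.\<close>

lemma sqrt_trunc_prod_tendsto_0:
  assumes a1: "\<And>n. 1 \<le> a n" and alim: "filterlim a at_top sequentially"
    and \<delta>: "0 < (\<delta>::real)"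
    and growth: "limsup (\<lambda>n. ereal (1 / real n *
        (ln (real (a n)) / 2 * ((1 + \<delta>) * ln (real n) / ln (ln (real (a n))) + 1)
          - (\<Sum>k<n. ln (ln (real (a k))))))) < 1"
    and D: "1 \<le> (D::real)"
  shows "(\<lambda>n. sqrt (real (trunc a (\<delta> / 2) n)) * (D ^ n * (\<Prod>k<n. gam a k))) \<longlonglongrightarrow> 0"
proof -
  define g where "g n = gam a n" for n
  \<comment> \<open>As \<open>g n = exp (- G n)\<close>, the product of the \<open>gam a k\<close>
    is \<open>exp\<close> of minus the sum of the \<open>G k\<close>, whereas the hypothesis
    controls the sum of the \<open>l k = G k + ln (G k)\<close>. The discrepancy
    \<open>ln (G k)\<close> has to be paid for.\<close>
  define G where "G n = - ln (g n)" for n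
  define l where "l n = ln (ln (real (a n)))" for n
  have g: "0 < g n" for n using gam_pos[of a n] a1 by (simp add: g_def)
  have G0: "0 \<le> G n" and lnaG: "ln (real (a n)) = G n / g n" and lG: "l n = G n + ln (G n)" for n
    using gam_ln[of a n] a1[of n] by (simp_all add: G_def g_def l_def)
  have l_top: "filterlim l at_top sequentially"
    unfolding l_def
    by (intro filterlim_compose[OF ln_at_top] filterlim_compose[OF filterlim_real_sequentially alim])
  have G_top: "filterlim G at_top sequentially"
  proof -
    have half: "l n / 2 \<le> G n" for n
    proof (cases "G n = 0")
      case False
      then show ?thesis using lG[of n] ln_le_minus_one[of "G n"] G0[of n] by simp
    qed (use lG[of n] in simp)
    have "filterlim (\<lambda>n. l n / 2) at_top sequentially"
      using filterlim_tendsto_pos_mult_at_top[OF tendsto_const[of "1 / 2 :: real"] _ l_top] by simp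
    then show ?thesis by (rule filterlim_at_top_mono) (intro always_eventually allI half)
  qed
  have ln_top: "filterlim (\<lambda>n. ln (real n)) at_top sequentially"
    by (rule filterlim_compose[OF ln_at_top filterlim_real_sequentially])
  have lnG_small: "\<forall>\<^sub>F n in sequentially. ln (G n) \<le> e * G n" if "0 < e" for e
  proof -
    have "\<forall>\<^sub>F x in at_top. ln x / x < e"
      using order_tendstoD(2)[OF ln_x_over_x_tendsto_0 that] .
    moreover have "\<forall>\<^sub>F x::real in at_top. 0 < x" by (rule eventually_gt_at_top)
    ultimately have "\<forall>\<^sub>F x in at_top. ln x \<le> e * x"
      by eventually_elim (simp add: field_simps)
    then show ?thesis by (rule eventually_compose_filterlim[OF _ G_top])
  qed
  have hyp: "\<forall>\<^sub>F n in sequentially.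
      ln (real (a n)) / 2 * ((1 + \<delta>) * ln (real n) / l n + 1) \<le> real n + (\<Sum>k<n. l k)"
    using Limsup_lessD[OF growth] eventually_gt_at_top[of 0]
  proof eventually_elim
    case (elim n)
    then have "1 / real n * (ln (real (a n)) / 2 * ((1 + \<delta>) * ln (real n) / l n + 1) - (\<Sum>k<n. l k)) < 1"
      by (simp add: l_def)
    then show ?case using elim(2) by (simp add: field_simps)
  qed
  \<comment> \<open>Only the summand 1 of the bracket in \<open>hyp\<close> is kept; the quotient is
    nonnegative for large \<open>n\<close>.\<close>
  have "\<forall>\<^sub>F n in sequentially. exp (l n) \<le> 2 * real n + 2 * (\<Sum>k<n. l k)"
    using hyp eventually_gt_at_top[of 1]
      filterlim_at_top_dense[THEN iffD1, OF l_top, rule_format, of 0]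
  proof eventually_elim
    case (elim n)
    have "ln (real (a n)) \<noteq> 0" using elim(3) by (auto simp: l_def)
    then have lna: "0 < ln (real (a n))" using a1[of n] by (simp add: order_less_le)
    have "0 \<le> (1 + \<delta>) * ln (real n) / l n" using elim \<delta> by simp
    then have le: "ln (real (a n)) / 2 * 1 \<le> ln (real (a n)) / 2 * ((1 + \<delta>) * ln (real n) / l n + 1)"
      using lna by (intro mult_left_mono) auto
    have "exp (l n) = ln (real (a n))" using lna by (simp add: l_def)
    then show ?case using order_trans[OF le elim(1)] by linarith
  qed
  then obtain C where C: "\<And>n. l n \<le> C + 2 * ln (real n + 1)"
    using log_growth_bound by blast
  \<comment> \<open>The room between \<open>1 + \<delta> / 2\<close> and \<open>1 + \<delta>\<close>
    is split in half: \<open>\<kappa>\<close> brings \<open>1 + \<delta>\<close> down to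
    \<open>1 + 3 * \<delta> / 4\<close>, and \<open>\<eta>\<close> is so small that two factors
    \<open>1 + \<eta>\<close> lift \<open>1 + \<delta> / 2\<close> at most to that. These two
    factors pay for replacing \<open>ln (n + 1)\<close> by \<open>ln n\<close> and
    \<open>G n\<close> by \<open>l n\<close>.\<close>
  define \<eta> where "\<eta> = \<delta> / (12 + 6 * \<delta>)"
  define \<kappa> where "\<kappa> = (\<delta> / 4) / (1 + \<delta>)"
  have \<eta>: "0 < \<eta>" "\<eta> \<le> 1" using \<delta> by (auto simp: \<eta>_def field_simps)
  have \<kappa>: "0 < \<kappa>" "\<kappa> < 1" "(1 - \<kappa>) * (1 + \<delta>) = 1 + 3 * \<delta> / 4"
    using \<delta> by (auto simp: \<kappa>_def field_simps)
  have \<eta>\<kappa>: "(1 + \<delta> / 2) * (1 + \<eta>) ^ 2 \<le> (1 - \<kappa>) * (1 + \<delta>)"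
  proof -
    have "\<eta> * \<eta> \<le> \<eta> * 1" using \<eta> by (intro mult_left_mono) auto
    then have "(1 + \<eta>) ^ 2 \<le> 1 + 3 * \<eta>" by (simp add: power2_eq_square algebra_simps)
    then have "(1 + \<delta> / 2) * (1 + \<eta>) ^ 2 \<le> (1 + \<delta> / 2) * (1 + 3 * \<eta>)"
      using \<delta> by (intro mult_left_mono) auto
    also have "\<dots> = 1 + 3 * \<delta> / 4" using \<delta> by (simp add: \<eta>_def field_simps)
    finally show ?thesis using \<kappa> by simp
  qed
  \<comment> \<open>The gain \<open>\<kappa> / 4 * l k\<close> minus the losses at index
    \<open>k\<close>: the discrepancy \<open>ln (G k)\<close>, the share of the summand
    \<open>n\<close> in the hypothesis, and \<open>ln D\<close>. The gain wins because
    \<open>ln (G k)\<close> is small against \<open>G k\<close>.\<close>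
  define c where "c k = \<kappa> / 4 * l k - ln (G k) - (1 - \<kappa> / 4) - ln D" for k
  have c_top: "filterlim c at_top sequentially"
  proof (rule filterlim_at_top_mono)
    have "filterlim (\<lambda>k. - (1 - \<kappa> / 4 + ln D) + \<kappa> / 8 * G k) at_top sequentially"
      using \<kappa> by (intro filterlim_tendsto_add_at_top[OF tendsto_const]
          filterlim_tendsto_pos_mult_at_top[OF tendsto_const _ G_top]) auto
    then show "filterlim (\<lambda>k. - (1 - \<kappa> / 4 + ln D) + \<kappa> / 8 * G k) at_top sequentially" .
    have small: "\<forall>\<^sub>F k in sequentially. ln (G k) \<le> \<kappa> / 8 * G k"
      using \<kappa> by (intro lnG_small) auto
    show "\<forall>\<^sub>F k in sequentially. - (1 - \<kappa> / 4 + ln D) + \<kappa> / 8 * G k \<le> c k"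
      using small filterlim_at_top_dense[THEN iffD1, OF G_top, rule_format, of 1]
    proof eventually_elim
      case (elim k)
      then have "\<kappa> / 4 * G k \<le> \<kappa> / 4 * l k"
        using lG[of k] \<kappa> by (intro mult_left_mono) auto
      then show ?case unfolding c_def using elim(1) by linarith
    qed
  qed
  \<comment> \<open>The logarithm of the quantity to be bounded, with \<open>trunc\<close> taken
    before rounding; rounding up costs the factor \<open>sqrt 2\<close>.\<close>
  define E where "E n = ln (real (a n)) / 2 + (1 + \<delta> / 2) / g n * ln (real n + 1) / 2
      + real n * ln D - (\<Sum>k<n. G k)" for n
  have "\<forall>\<^sub>F n in sequentially. E n \<le> - (\<Sum>k<n. c k)"
    using hyp lnG_small[OF \<eta>(1)] filterlim_at_top_dense[THEN iffD1, OF G_top, rule_format, of 1]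
      filterlim_at_top_dense[THEN iffD1, OF ln_top, rule_format, of "ln 2 / \<eta>"]
      filterlim_at_top_dense[THEN iffD1, OF ln_top, rule_format, of "C + 2 * ln 2"]
      eventually_gt_at_top[of 1]
  proof eventually_elim
    case (elim n)
    define A where "A = ln (real (a n)) / 2"
    define Y where "Y = (1 + \<delta>) * ln (real n) / l n"
    have G: "1 < G n" "0 < ln (G n)" using elim by auto
    have lpos: "G n < l n" "0 < l n" using lG[of n] G by linarith+
    have lnn: "0 < ln (real n)" using elim by simp
    have A0: "0 \<le> A" using a1[of n] by (simp add: A_def)
    have "ln (real n + 1) \<le> ln (real n * 2)" using elim by (subst ln_le_cancel_iff) auto
    then have ln1: "ln (real n + 1) \<le> ln 2 + ln (real n)" using elim by (simp add: ln_mult)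
    have "ln 2 \<le> \<eta> * ln (real n)" using elim(4) \<eta> by (simp add: field_simps)
    then have ln1': "ln (real n + 1) \<le> (1 + \<eta>) * ln (real n)" using ln1 by (simp add: algebra_simps)
    have l_le: "l n \<le> (1 + \<eta>) * G n" using elim(2) lG[of n] by (simp add: algebra_simps)
    \<comment> \<open>The purpose of the logarithmic bound on \<open>l\<close>: the factor
      \<open>1 - \<kappa>\<close> acts on \<open>Y\<close> alone, but as \<open>Y\<close> is at
      least 1/3 it can be traded for a factor \<open>1 - \<kappa> / 4\<close> on
      \<open>Y + 1\<close>, and so on the whole right-hand side of \<open>hyp\<close>.\<close>
    have Y_ge: "1 \<le> 3 * Y"
    proof -
      have "l n \<le> 3 * ln (real n)" using C[of n] ln1 elim(5) by simp
      also have "\<dots> \<le> 3 * ((1 + \<delta>) * ln (real n))" using \<delta> lnn by (simp add: algebra_simps)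
      finally show ?thesis using lpos by (simp add: Y_def field_simps)
    qed
    have "(1 + \<delta> / 2) * ln (real n + 1) / G n \<le> (1 - \<kappa>) * Y"
    proof -
      have "1 / G n \<le> (1 + \<eta>) / l n" using l_le lpos G by (simp add: field_simps)
      then have "(1 + \<delta> / 2) * ln (real n + 1) * (1 / G n)
          \<le> ((1 + \<delta> / 2) * ((1 + \<eta>) * ln (real n))) * ((1 + \<eta>) / l n)"
        using ln1' \<delta> lnn G \<eta> by (intro mult_mono mult_left_mono mult_nonneg_nonneg) auto
      also have "\<dots> = ((1 + \<delta> / 2) * (1 + \<eta>) ^ 2) * (ln (real n) / l n)"
        by (simp add: power2_eq_square)
      also have "\<dots> \<le> ((1 - \<kappa>) * (1 + \<delta>)) * (ln (real n) / l n)"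
        using \<eta>\<kappa> lnn lpos by (intro mult_right_mono) auto
      finally show ?thesis by (simp add: Y_def)
    qed
    then have "A * ((1 + \<delta> / 2) * ln (real n + 1) / G n) \<le> A * ((1 - \<kappa>) * Y)"
      using A0 by (rule mult_left_mono)
    moreover have "(1 + \<delta> / 2) / g n * ln (real n + 1) / 2 = A * ((1 + \<delta> / 2) * ln (real n + 1) / G n)"
      using G lnaG[of n] by (simp add: A_def)
    ultimately have "E n \<le> A + A * ((1 - \<kappa>) * Y) + real n * ln D - (\<Sum>k<n. G k)"
      by (simp add: E_def A_def)
    also have "A + A * ((1 - \<kappa>) * Y) \<le> (1 - \<kappa> / 4) * (A * (Y + 1))"
    proof -
      have "0 \<le> \<kappa> * A * (3 * Y - 1)" using \<kappa> A0 Y_ge by (intro mult_nonneg_nonneg) auto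
      then show ?thesis by (simp add: algebra_simps)
    qed
    also have "(1 - \<kappa> / 4) * (A * (Y + 1)) \<le> (1 - \<kappa> / 4) * (real n + (\<Sum>k<n. l k))"
      using elim(1) \<kappa> by (intro mult_left_mono) (auto simp: A_def Y_def)
    also have "(1 - \<kappa> / 4) * (real n + (\<Sum>k<n. l k)) + real n * ln D - (\<Sum>k<n. G k)
        = (\<Sum>k<n. (1 - \<kappa> / 4) * (1 + l k) + ln D - G k)"
      by (simp add: sum.distrib sum_subtractf sum_distrib_left[symmetric])
    also have "\<dots> = - (\<Sum>k<n. c k)"
      unfolding sum_negf[symmetric] by (rule sum.cong) (auto simp: c_def lG algebra_simps)
    finally show ?case by simp
  qed
  moreover have "filterlim (\<lambda>n. - (\<Sum>k<n. c k)) at_bot sequentially"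
    by (rule filterlim_uminus_at_top[THEN iffD1, OF sum_at_top[OF c_top]])
  ultimately have "filterlim E at_bot sequentially"
    by (rule filterlim_at_bot_mono[rotated])
  then have "(\<lambda>n. exp (E n)) \<longlonglongrightarrow> 0" by (rule filterlim_compose[OF exp_at_bot])
  then have lim: "(\<lambda>n. sqrt 2 * exp (E n)) \<longlonglongrightarrow> 0" by (rule tendsto_mult_right_zero)
  have "norm (sqrt (real (trunc a (\<delta> / 2) n)) * (D ^ n * (\<Prod>k<n. gam a k))) \<le> sqrt 2 * exp (E n)" for n
  proof -
    have prod: "(\<Prod>k<n. g k) = exp (- (\<Sum>k<n. G k))"
      using g by (simp add: G_def exp_sum sum_negf)
    have Dn: "D ^ n = exp (real n * ln D)" using D by (simp add: exp_of_nat_mult)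
    have "sqrt (real (trunc a (\<delta> / 2) n)) \<le> sqrt (2 * (real (a n) * (real n + 1) powr ((1 + \<delta> / 2) / g n)))"
      using trunc_bounds(2)[of a n "\<delta> / 2"] a1 \<delta> by (simp add: g_def)
    also have "\<dots> = sqrt 2 * sqrt (exp (ln (real (a n)) + (1 + \<delta> / 2) / g n * ln (real n + 1)))"
      using a1[of n] by (simp add: real_sqrt_mult exp_add powr_def)
    also have "\<dots> = sqrt 2 * exp (ln (real (a n)) / 2 + (1 + \<delta> / 2) / g n * ln (real n + 1) / 2)"
    proof -
      have "sqrt (exp x) = exp (x / 2)" for x :: real
        by (rule real_sqrt_unique) (simp_all add: exp_double[symmetric])
      then show ?thesis by (simp add: add_divide_distrib)
    qed
    finally have "sqrt (real (trunc a (\<delta> / 2) n)) * (D ^ n * (\<Prod>k<n. gam a k))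
        \<le> sqrt 2 * exp (ln (real (a n)) / 2 + (1 + \<delta> / 2) / g n * ln (real n + 1) / 2)
          * (D ^ n * (\<Prod>k<n. gam a k))"
      using g D by (intro mult_right_mono) (auto intro!: mult_nonneg_nonneg prod_nonneg simp: g_def less_imp_le)
    also have "\<dots> = sqrt 2 * exp (E n)"
    proof -
      have "E n = (ln (real (a n)) / 2 + (1 + \<delta> / 2) / g n * ln (real n + 1) / 2)
          + (real n * ln D + - (\<Sum>k<n. G k))" by (simp add: E_def)
      then show ?thesis unfolding Dn prod[unfolded g_def] by (simp only: exp_add mult.assoc)
    qed
    finally have le: "sqrt (real (trunc a (\<delta> / 2) n)) * (D ^ n * (\<Prod>k<n. gam a k)) \<le> sqrt 2 * exp (E n)" .
    have "0 \<le> sqrt (real (trunc a (\<delta> / 2) n)) * (D ^ n * (\<Prod>k<n. gam a k))"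
      using g D by (intro mult_nonneg_nonneg prod_nonneg) (auto simp: g_def less_imp_le)
    then show ?thesis using le by (simp only: real_norm_def abs_of_nonneg)
  qed
  then have ev: "\<forall>\<^sub>F n in sequentially. norm (sqrt (real (trunc a (\<delta> / 2) n)) *
      (D ^ n * (\<Prod>k<n. gam a k))) \<le> sqrt 2 * exp (E n)"
    by (rule always_eventually[OF allI])
  show ?thesis by (rule Lim_null_comparison[OF ev lim])
qed


section \<open>Positive mass forces infinite Hausdorff measure\<close>

text \<open>\<open>D\<close> is left free because two laws are plugged in: \<open>p\<close> with
  \<open>D = 1\<close> and \<open>doubled\<close> with \<open>D = 4\<close>.\<close>

locale digit_decay =
  fixes a :: "nat \<Rightarrow> nat" and p :: "nat \<Rightarrow> nat pmf" and D :: real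
  assumes a_ge_1: "1 \<le> a n" and a_top: "filterlim a at_top sequentially"
    and D_ge_1: "1 \<le> D"
    and pmf_le: "1 \<le> l \<Longrightarrow> pmf (p n) l \<le> D * real l powr - (1 + gam a n)"
begin

text \<open>A lower bound for \<open>1 - \<theta>\<close>, where \<open>\<theta>\<close> is the value of the tail from index \<open>n + 1\<close> of a sequence
  bounded by \<open>T\<close>: if digit \<open>n + 1\<close> may be 1, then only the bound on digit \<open>n + 2\<close> keeps \<open>\<theta>\<close> away from 1.\<close>

definition gap :: "(nat \<Rightarrow> nat) \<Rightarrow> nat \<Rightarrow> real" where
  "gap T n = (if 2 \<le> a (Suc n) then 1 / 2 else 1 / (real (T (n + 2)) + 2))"

lemma gap_range: "0 < gap T n" "gap T n \<le> 1 / 2"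
  by (auto simp: gap_def field_simps)

lemma eventually_gap: "\<forall>\<^sub>F n in sequentially. gap T n = 1 / 2"
proof -
  have "\<forall>\<^sub>F n in sequentially. 2 \<le> a n"
    using a_top by (auto simp: filterlim_at_top)
  then have "\<forall>\<^sub>F n in sequentially. 2 \<le> a (Suc n)"
    by (rule eventually_sequentially_Suc[THEN iffD2])
  then show ?thesis by eventually_elim (simp add: gap_def)
qed

lemma growth_factor_nonneg: "0 \<le> (2 * D) ^ n * (\<Prod>k<n. gam a k)"
  using D_ge_1 gam_pos[where a = a, OF a_ge_1]
  by (intro mult_nonneg_nonneg zero_le_power prod_nonneg) (auto intro: less_imp_le)

lemma seq_space_bounds:
  assumes "z \<in> seq_space a 0" shows "1 \<le> z i" "a i \<le> z i"
  using assms by (auto simp: seq_space_def alphabet_def)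

lemma cf_value_tail_le:
  assumes z: "z \<in> seq_space a 0" "\<And>i. z i \<le> T i"
  shows "cf_value (shift (Suc n) z) \<le> 1 - gap T n"
proof (cases "2 \<le> a (Suc n)")
  case True
  have "2 \<le> z (Suc n)" using True seq_space_bounds(2)[OF z(1), of "Suc n"] by simp
  then have "1 / real (z (Suc n)) \<le> 1 / 2" by (simp add: field_simps)
  then show ?thesis
    using cf_value_less[OF positive_seq_shift[OF seq_space_positive[OF z(1)]], of "Suc n"] True
    by (simp add: gap_def shift_def)
next
  case False
  note p1 = positive_seq_shift[OF seq_space_positive[OF z(1)], of "Suc n"]
  note p2 = positive_seq_shift[OF seq_space_positive[OF z(1)], of "n + 2"]
  have step: "cf_value (shift (Suc n) z) = 1 / (real (z (Suc n)) + cf_value (shift (n + 2) z))"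
  proof -
    have "shift (Suc n) z 0 = z (Suc n)" by (simp add: shift_def)
    then show ?thesis using cf_value_step[OF p1] by simp
  qed
  have "1 / (real (T (n + 2)) + 1) \<le> 1 / (real (z (n + 2)) + 1)"
    using z(2)[of "n + 2"] by (intro divide_left_mono) auto
  also have "\<dots> \<le> cf_value (shift (n + 2) z)"
    using cf_value_ge[OF p2] by (simp add: shift_def)
  finally have le: "1 + 1 / (real (T (n + 2)) + 1) \<le> real (z (Suc n)) + cf_value (shift (n + 2) z)"
    using seq_space_bounds(1)[OF z(1), of "Suc n"] by (intro add_mono) auto
  have pos: "0 < 1 + 1 / (real (T (n + 2)) + 1)" by (intro add_pos_nonneg) auto
  have "cf_value (shift (Suc n) z) \<le> 1 / (1 + 1 / (real (T (n + 2)) + 1))"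
    unfolding step by (rule divide_left_mono[OF le _ mult_pos_pos[OF less_le_trans[OF pos le] pos]]) simp
  also have "\<dots> = 1 - 1 / (real (T (n + 2)) + 2)" by (simp add: field_simps)
  finally show ?thesis using False by (simp add: gap_def)
qed

text \<open>Beyond the common prefix the values are \<open>1 / (l + \<theta>)\<close> and
  \<open>1 / (L + \<theta>')\<close>, whose difference has numerator
  \<open>L - l + \<theta>' - \<theta>\<close>. Only the sequence with the smaller letter has to be
  truncated, as only its tail can push the two values together.\<close>

lemma cf_value_separation:
  assumes x: "x \<in> seq_space a 0" "\<And>i. x i \<le> T i" and y: "y \<in> seq_space a 0"
    and eq: "\<And>i. i < n \<Longrightarrow> x i = y i" and less: "x n < y n"
  shows "(\<Prod>i<n. 1 / (real (x i) + 1)\<^sup>2) *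
      (gap T n * (real (y n) - real (x n)) / (4 * real (x n) * real (y n))) \<le> \<bar>cf_value x - cf_value y\<bar>"
proof -
  define l L \<theta> \<theta>' where "l = real (x n)" and "L = real (y n)"
    and "\<theta> = cf_value (shift (Suc n) x)" and "\<theta>' = cf_value (shift (Suc n) y)"
  note px = positive_seq_shift[OF seq_space_positive[OF x(1)]]
  note py = positive_seq_shift[OF seq_space_positive[OF y]]
  have l: "1 \<le> l" "l + 1 \<le> L" using less seq_space_bounds(1)[OF x(1), of n] by (auto simp: l_def L_def)
  have \<theta>: "0 \<le> \<theta>" "\<theta> \<le> 1" "\<theta> \<le> 1 - gap T n" "0 \<le> \<theta>'" "\<theta>' \<le> 1"
    using cf_value_unit[OF px] cf_value_unit[OF py] cf_value_tail_le[OF x]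
    by (auto simp: \<theta>_def \<theta>'_def)
  have cf: "cf_value (shift n x) = 1 / (l + \<theta>)" "cf_value (shift n y) = 1 / (L + \<theta>')"
  proof -
    have "shift n x 0 = x n" "shift n y 0 = y n" by (simp_all add: shift_def)
    then show "cf_value (shift n x) = 1 / (l + \<theta>)" "cf_value (shift n y) = 1 / (L + \<theta>')"
      using cf_value_step[OF px, of n] cf_value_step[OF py, of n]
      by (simp_all add: l_def L_def \<theta>_def \<theta>'_def)
  qed
  have "gap T n * (L - l) \<le> L - l + \<theta>' - \<theta>"
  proof -
    have "(1 - gap T n) * 1 \<le> (1 - gap T n) * (L - l)"
      using gap_range[of T n] l by (intro mult_left_mono) auto
    then show ?thesis using \<theta> by (simp add: algebra_simps)
  qed
  moreover have "(l + \<theta>) * (L + \<theta>') \<le> (2 * l) * (2 * L)"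
    using l \<theta> by (intro mult_mono) auto
  moreover have "0 < (l + \<theta>) * (L + \<theta>')" using l \<theta> by (intro mult_pos_pos) auto
  moreover have "0 \<le> gap T n * (L - l)" using gap_range[of T n] l by simp
  ultimately have "gap T n * (L - l) / ((2 * l) * (2 * L)) \<le> (L - l + \<theta>' - \<theta>) / ((l + \<theta>) * (L + \<theta>'))"
    by (intro frac_le) auto
  also have "\<dots> = cf_value (shift n x) - cf_value (shift n y)"
    unfolding cf using l \<theta> by (simp add: field_simps)
  also have "\<dots> \<le> \<bar>cf_value (shift n x) - cf_value (shift n y)\<bar>" by simp
  finally have "(\<Prod>i<n. 1 / (real (x i) + 1)\<^sup>2) * (gap T n * (L - l) / (4 * l * L))
      \<le> (\<Prod>i<n. 1 / (real (x i) + 1)\<^sup>2) * \<bar>cf_value (shift n x) - cf_value (shift n y)\<bar>"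
    by (intro mult_left_mono prod_nonneg) (auto simp: mult_ac)
  also have "\<dots> \<le> \<bar>cf_value x - cf_value y\<bar>"
    using cf_value_cong_prefix(3)[OF seq_space_positive[OF x(1)] seq_space_positive[OF y] eq] .
  finally show ?thesis by (simp add: l_def L_def)
qed

text \<open>A bound for the mass of a block at level \<open>n\<close> over the square root of its
  width. The middle factor comes from the \<open>n\<close> common letters, the two roots from the
  interval of letters at level \<open>n\<close>.\<close>

definition mass_ratio :: "(nat \<Rightarrow> nat) \<Rightarrow> nat \<Rightarrow> real" where
  "mass_ratio T n = sqrt (real (T n)) * ((2 * D) ^ n * (\<Prod>k<n. gam a k)) * sqrt (8 * D / gap T n)"

text \<open>\<open>v powr - gam a i\<close> is at most its value at \<open>a i\<close>, which is
  \<open>gam a i\<close>. The factor 2 pays for passing from \<open>1 / v\<close> to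
  \<open>1 / (v + 1)\<close>, so that the product over a word becomes exactly the root of the
  contraction factor in the lower distance bound.\<close>

lemma pmf_letter_le:
  assumes "a i \<le> v" shows "pmf (p i) v \<le> (2 * D * gam a i) * (1 / (real v + 1))"
proof -
  have v: "1 \<le> v" using assms a_ge_1[of i] by simp
  have "pmf (p i) v \<le> D * real v powr - (1 + gam a i)" by (rule pmf_le[OF v])
  also have "\<dots> = D * (real v powr - gam a i * (1 / real v))"
    using v by (simp add: powr_add[symmetric] powr_minus_divide add.commute powr_diff)
  also have "\<dots> \<le> D * (gam a i * (2 / (real v + 1)))"
  proof (intro mult_left_mono mult_mono)
    have "real v powr - gam a i \<le> real (a i) powr - gam a i"
      using assms a_ge_1[of i] gam_pos[of a i] by (intro powr_mono2') auto
    then show "real v powr - gam a i \<le> gam a i" using gam_eq_powr[of a i] a_ge_1[of i] by simp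
    show "1 / real v \<le> 2 / (real v + 1)" using v by (simp add: field_simps)
  qed (use D_ge_1 gam_pos[of a i] a_ge_1[of i] in auto)
  finally show ?thesis by (simp add: mult_ac)
qed

lemma prod_pmf_le:
  assumes "x \<in> seq_space a 0"
  shows "(\<Prod>i<n. pmf (p i) (x i)) \<le> ((2 * D) ^ n * (\<Prod>k<n. gam a k)) * (\<Prod>i<n. 1 / (real (x i) + 1))"
proof -
  have "(\<Prod>i<n. pmf (p i) (x i)) \<le> (\<Prod>i<n. (2 * D * gam a i) * (1 / (real (x i) + 1)))"
    using pmf_letter_le seq_space_bounds(2)[OF assms] by (intro prod_mono) auto
  then show ?thesis by (simp only: prod.distrib prod_constant card_lessThan power_mult_distrib)
qed

lemma emeasure_block_le:
  assumes x: "x \<in> seq_space a 0" "\<And>i. x i \<le> T i" and y: "y \<in> seq_space a 0" "y n \<le> T n"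
    and eq: "\<And>i. i < n \<Longrightarrow> x i = y i" and less: "x n < y n"
    and r: "\<bar>cf_value x - cf_value y\<bar> \<le> r"
  shows "emeasure (digit_measure p) {z. (\<forall>i<n. z i = x i) \<and> x n \<le> z n \<and> z n \<le> y n}
    \<le> ennreal (mass_ratio T n * sqrt r)"
proof -
  define l L where "l = real (x n)" and "L = real (y n)"
  define Q where "Q = gap T n * (L - l) / (4 * l * L)"
  define P where "P = (\<Prod>i<n. 1 / (real (x i) + 1))"
  have l: "1 \<le> l" "l < L" "L \<le> T n"
    using less y seq_space_bounds(1)[OF x(1), of n] by (auto simp: l_def L_def)
  define X where "X i = (if i = n then {x n..y n} else {x i})" for i
  have "{z. (\<forall>i<n. z i = x i) \<and> x n \<le> z n \<and> z n \<le> y n} = {z. \<forall>i\<in>{..n}. z i \<in> X i}"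
    by (auto simp: X_def le_less split: if_splits)
  then have "emeasure (digit_measure p) {z. (\<forall>i<n. z i = x i) \<and> x n \<le> z n \<and> z n \<le> y n}
      = (\<Prod>i\<in>{..n}. emeasure (measure_pmf (p i)) (X i))"
    by (simp only: emeasure_digit_measure_box finite_atMost)
  also have "\<dots> = (\<Prod>i<n. ennreal (pmf (p i) (x i))) * emeasure (measure_pmf (p n)) {x n..y n}"
    by (simp add: lessThan_Suc_atMost[symmetric] X_def emeasure_pmf_single)
  also have "\<dots> = ennreal ((\<Prod>i<n. pmf (p i) (x i)) * measure (measure_pmf (p n)) {x n..y n})"
    by (simp add: prod_ennreal measure_pmf.emeasure_eq_measure ennreal_mult prod_nonneg)
  also have "\<dots> \<le> ennreal (mass_ratio T n * sqrt r)"
  proof (rule ennreal_leI)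
    define \<mu> where "\<mu> = measure (measure_pmf (p n)) {x n..y n}"
    have \<mu>: "0 \<le> \<mu>" "\<mu> \<le> 1" "\<mu> \<le> 2 * D * ((L - l) / l)"
      using measure_pmf_atLeastAtMost_le[OF gam_pos[of a n, OF a_ge_1], of D "x n" "y n" "p n"] pmf_le
        D_ge_1 less l by (auto simp: \<mu>_def l_def L_def)
    \<comment> \<open>A square root is wanted, so one factor is estimated by 1 and the other by
      \<open>2 * D * ((L - l) / l)\<close>. The latter is \<open>8 * D / gap T n * L * Q\<close>
      with \<open>Q\<close> the relative distance, and \<open>L \<le> T n\<close> is where the
      truncation enters.\<close>
    have "\<mu> = sqrt (\<mu> * \<mu>)" using \<mu> by simp
    also have "\<dots> \<le> sqrt (1 * (2 * D * ((L - l) / l)))"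
      using \<mu> by (intro real_sqrt_le_mono mult_mono) auto
    also have "\<dots> = sqrt ((8 * D / gap T n * L) * Q)"
      using gap_range(1)[of T n] l by (simp add: Q_def field_simps)
    also have "\<dots> \<le> sqrt ((8 * D / gap T n * T n) * Q)"
      using gap_range(1)[of T n] l D_ge_1
      by (intro real_sqrt_le_mono mult_right_mono mult_left_mono) (auto simp: Q_def)
    also have "\<dots> = sqrt (8 * D / gap T n) * sqrt (T n) * sqrt Q"
      by (simp only: real_sqrt_mult)
    also have "\<dots> = sqrt (T n) * sqrt (8 * D / gap T n) * sqrt Q" by simp
    finally have \<mu>': "\<mu> \<le> sqrt (T n) * sqrt (8 * D / gap T n) * sqrt Q" .
    have Q0: "0 \<le> Q" using gap_range(1)[of T n] l by (simp add: Q_def)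
    have P0: "0 \<le> P" by (auto simp: P_def intro!: prod_nonneg)
    have "P\<^sup>2 * Q \<le> r"
      using cf_value_separation[OF x y(1) eq less] r
      by (simp add: P_def Q_def l_def L_def prod_power_distrib power_one_over mult.assoc)
    then have "sqrt (P\<^sup>2 * Q) \<le> sqrt r" by (rule real_sqrt_le_mono)
    then have PQ: "P * sqrt Q \<le> sqrt r" using P0 by (simp add: real_sqrt_mult)
    have K0: "0 \<le> (2 * D) ^ n * (\<Prod>k<n. gam a k)"
      by (rule growth_factor_nonneg)
    have "(\<Prod>i<n. pmf (p i) (x i)) * \<mu>
        \<le> (((2 * D) ^ n * (\<Prod>k<n. gam a k)) * P) * (sqrt (T n) * sqrt (8 * D / gap T n) * sqrt Q)"
      using prod_pmf_le[OF x(1), of n] \<mu>' \<mu>(1) K0 P0 unfolding P_def[symmetric]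
      by (intro mult_mono) auto
    also have "\<dots> = mass_ratio T n * (P * sqrt Q)" by (simp add: mass_ratio_def mult_ac)
    also have "\<dots> \<le> mass_ratio T n * sqrt r"
      using K0 D_ge_1 gap_range(1)[of T n] PQ
      by (intro mult_left_mono) (auto simp: mass_ratio_def intro!: mult_nonneg_nonneg)
    finally show "(\<Prod>i<n. pmf (p i) (x i)) * measure (measure_pmf (p n)) {x n..y n} \<le> mass_ratio T n * sqrt r"
      by (simp add: \<mu>_def)
  qed
  finally show ?thesis .
qed

end


section \<open>From blocks to arbitrary covering sets\<close>

context digit_decay
begin

text \<open>Needed for covering sets that meet the truncated set in one sequence: they may have
  diameter 0, so no positive mass can be tolerated there.\<close>

lemma emeasure_point_eq_0:
  assumes z: "z \<in> seq_space a 0" and lim: "(\<lambda>n. (2 * D) ^ n * (\<Prod>k<n. gam a k)) \<longlonglongrightarrow> 0"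
  shows "{z} \<in> sets (digit_measure p)" "emeasure (digit_measure p) {z} = 0"
proof -
  have "{z' \<in> space (digit_measure p). \<forall>i. z' i = z i} \<in> sets (digit_measure p)" by measurable
  also have "{z' \<in> space (digit_measure p). \<forall>i. z' i = z i} = {z}" by auto
  finally show "{z} \<in> sets (digit_measure p)" .
  have le: "emeasure (digit_measure p) {z} \<le> ennreal ((2 * D) ^ n * (\<Prod>k<n. gam a k))" for n
  proof -
    have "emeasure (digit_measure p) {z} \<le> emeasure (digit_measure p) {z'. \<forall>i\<in>{..<n}. z' i \<in> {z i}}"
      by (intro emeasure_mono sets_digit_box) auto
    also have "\<dots> = ennreal (\<Prod>i<n. pmf (p i) (z i))"
      by (simp only: emeasure_digit_measure_box finite_lessThan emeasure_pmf_single prod_ennreal pmf_nonneg)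
    also have "\<dots> \<le> ennreal ((2 * D) ^ n * (\<Prod>k<n. gam a k))"
    proof (rule ennreal_leI)
      have "(\<Prod>i<n. 1 / (real (z i) + 1)) \<le> 1" by (intro prod_le_1) auto
      then have "((2 * D) ^ n * (\<Prod>k<n. gam a k)) * (\<Prod>i<n. 1 / (real (z i) + 1))
          \<le> ((2 * D) ^ n * (\<Prod>k<n. gam a k)) * 1"
        by (rule mult_left_mono[OF _ growth_factor_nonneg])
      then show "(\<Prod>i<n. pmf (p i) (z i)) \<le> (2 * D) ^ n * (\<Prod>k<n. gam a k)"
        using prod_pmf_le[OF z, of n] by linarith
    qed
    finally show ?thesis .
  qed
  have "(\<lambda>n. ennreal ((2 * D) ^ n * (\<Prod>k<n. gam a k))) \<longlonglongrightarrow> ennreal 0"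
    by (rule tendsto_ennrealI[OF lim])
  then have "emeasure (digit_measure p) {z} \<le> ennreal 0"
    by (rule LIMSEQ_le_const) (use le in blast)
  then show "emeasure (digit_measure p) {z} = 0" by simp
qed

text \<open>The worst case of \<open>cf_value_separation\<close> under the truncation, with letters
  replaced by their bounds and their difference by 1. As it is positive at each level, sets of small
  diameter can only split at a late level.\<close>

definition least_sep :: "(nat \<Rightarrow> nat) \<Rightarrow> nat \<Rightarrow> real" where
  "least_sep T n = (\<Prod>i<n. 1 / (real (T i) + 1)\<^sup>2) * (gap T n / (4 * real (T n) * real (T n)))"

lemma least_sep_le:
  assumes x: "x \<in> seq_space a 0" "\<And>i. x i \<le> T i" and y: "y \<in> seq_space a 0" "y n \<le> T n"
    and eq: "\<And>i. i < n \<Longrightarrow> x i = y i" and less: "x n < y n"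
  shows "least_sep T n \<le> \<bar>cf_value x - cf_value y\<bar>"
proof -
  have pos: "0 < x n" "0 < y n" using seq_space_bounds(1)[OF x(1), of n] less by auto
  have "least_sep T n \<le> (\<Prod>i<n. 1 / (real (x i) + 1)\<^sup>2) *
      (gap T n * (real (y n) - real (x n)) / (4 * real (x n) * real (y n)))"
    unfolding least_sep_def
  proof (intro mult_mono prod_mono conjI prod_nonneg)
    have "gap T n * 1 \<le> gap T n * (real (y n) - real (x n))"
      using gap_range(1)[of T n] less by (intro mult_left_mono) auto
    then show "gap T n / (4 * real (T n) * real (T n))
        \<le> gap T n * (real (y n) - real (x n)) / (4 * real (x n) * real (y n))"
      using gap_range(1)[of T n] x(2)[of n] y(2) pos by (intro frac_le mult_mono mult_pos_pos) auto
    fix i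
    show "1 / (real (T i) + 1)\<^sup>2 \<le> 1 / (real (x i) + 1)\<^sup>2"
      using x(2)[of i] by (intro divide_left_mono power_mono mult_pos_pos) auto
  qed (use gap_range(1)[of T n] in auto)
  also have "\<dots> \<le> \<bar>cf_value x - cf_value y\<bar>"
    by (rule cf_value_separation[OF x y(1) eq less])
  finally show ?thesis .
qed

text \<open>\<open>n\<close> is the first index at which two members of \<open>F\<close> disagree;
  the smallest and largest letters occurring there span a block that contains \<open>F\<close>.
  \<open>F\<close> itself may be nonmeasurable.\<close>

lemma emeasure_truncated_le:
  assumes F: "F \<subseteq> seq_space a 0" "\<And>z i. z \<in> F \<Longrightarrow> z i \<le> T i"
    and xy: "x0 \<in> F" "y0 \<in> F" "x0 \<noteq> y0"
    and r: "\<And>x y. x \<in> F \<Longrightarrow> y \<in> F \<Longrightarrow> \<bar>cf_value x - cf_value y\<bar> \<le> r"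
  shows "\<exists>n S. S \<in> sets (digit_measure p) \<and> F \<subseteq> S \<and> least_sep T n \<le> r \<and>
    emeasure (digit_measure p) S \<le> ennreal (mass_ratio T n * sqrt r)"
proof -
  define n where "n = (LEAST n. \<exists>x\<in>F. \<exists>y\<in>F. x n \<noteq> y n)"
  have "\<exists>n. \<exists>x\<in>F. \<exists>y\<in>F. x n \<noteq> y n" using xy by (meson ext)
  then have ex: "\<exists>x\<in>F. \<exists>y\<in>F. x n \<noteq> y n" unfolding n_def by (rule LeastI_ex)
  have agree: "x i = y i" if "i < n" "x \<in> F" "y \<in> F" for x y i
    using not_less_Least[of i "\<lambda>n. \<exists>x\<in>F. \<exists>y\<in>F. x n \<noteq> y n"] that unfolding n_def by blast
  define V where "V = (\<lambda>z. z n) ` F"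
  \<comment> \<open>The truncation makes \<open>V\<close> finite, so both extreme letters are
    attained by members of \<open>F\<close>, to which the distance bound \<open>r\<close>
    applies.\<close>
  have V: "finite V" "V \<noteq> {}"
    using F(2) xy finite_subset[of V "{..T n}"] by (auto simp: V_def)
  obtain x where x: "x \<in> F" "x n = Min V" using Min_in[OF V] by (auto simp: V_def)
  obtain y where y: "y \<in> F" "y n = Max V" using Max_in[OF V] by (auto simp: V_def)
  have between: "x n \<le> z n \<and> z n \<le> y n" if "z \<in> F" for z
    using V that by (simp add: x y V_def)
  have less: "x n < y n"
  proof (rule ccontr)
    assume "\<not> x n < y n"
    then have "z n = x n" if "z \<in> F" for z using between[OF that] by simp
    then show False using ex by metis
  qed
  have xs: "x \<in> seq_space a 0" "\<And>i. x i \<le> T i" and ys: "y \<in> seq_space a 0" "y n \<le> T n"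
    using x y F by blast+
  have eq: "x i = y i" if "i < n" for i using agree[OF that x(1) y(1)] .
  let ?S = "{z. (\<forall>i<n. z i = x i) \<and> x n \<le> z n \<and> z n \<le> y n}"
  have "{z \<in> space (digit_measure p). (\<forall>i\<in>{..<n}. z i = x i) \<and> x n \<le> z n \<and> z n \<le> y n} \<in> sets (digit_measure p)"
    by measurable
  then have S: "?S \<in> sets (digit_measure p)" by (simp add: Ball_def)
  have FS: "F \<subseteq> ?S"
  proof
    fix z assume z: "z \<in> F"
    then show "z \<in> ?S" using between[OF z] agree[OF _ z x(1)] by simp
  qed
  have "least_sep T n \<le> r"
    using least_sep_le[OF xs ys eq less] r[OF x(1) y(1)] by linarith
  moreover have "emeasure (digit_measure p) ?S \<le> ennreal (mass_ratio T n * sqrt r)"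
    by (rule emeasure_block_le[OF xs ys eq less r[OF x(1) y(1)]])
  ultimately show ?thesis using S FS by blast
qed

lemma hausdorff_measure_truncated:
  assumes E: "E \<in> sets (digit_measure p)" "E \<subseteq> seq_space a 0" "emeasure (digit_measure p) E > 0"
    and B: "cf_value ` E \<subseteq> B"
    and T: "\<And>z i. z \<in> E \<Longrightarrow> z i \<le> T i" "\<And>i. 1 \<le> T i"
    and lim: "(\<lambda>n. sqrt (real (T n)) * ((2 * D) ^ n * (\<Prod>k<n. gam a k))) \<longlonglongrightarrow> 0"
  shows "hausdorff_measure (1 / 2) B = \<infinity>"
proof (rule hausdorff_measure_eq_top[OF _ E(1,3) B])
  interpret prob_space "digit_measure p" by (rule prob_space_digit_measure)
  show "emeasure (digit_measure p) E < \<infinity>" by (simp add: emeasure_eq_measure)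
  have lim0: "(\<lambda>n. (2 * D) ^ n * (\<Prod>k<n. gam a k)) \<longlonglongrightarrow> 0"
  proof (rule tendsto_sandwich[OF _ _ tendsto_const lim])
    show "\<forall>\<^sub>F n in sequentially. (2 * D) ^ n * (\<Prod>k<n. gam a k)
        \<le> sqrt (real (T n)) * ((2 * D) ^ n * (\<Prod>k<n. gam a k))"
    proof (intro always_eventually allI)
      fix n
      have "1 * ((2 * D) ^ n * (\<Prod>k<n. gam a k)) \<le> sqrt (real (T n)) * ((2 * D) ^ n * (\<Prod>k<n. gam a k))"
        using T(2)[of n] by (intro mult_right_mono growth_factor_nonneg) auto
      then show "(2 * D) ^ n * (\<Prod>k<n. gam a k) \<le> sqrt (real (T n)) * ((2 * D) ^ n * (\<Prod>k<n. gam a k))"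
        by simp
    qed
    show "\<forall>\<^sub>F n in sequentially. 0 \<le> (2 * D) ^ n * (\<Prod>k<n. gam a k)"
      by (intro always_eventually allI growth_factor_nonneg)
  qed
  \<comment> \<open>\<open>gap\<close> is eventually 1/2, which turns the last factor of
    \<open>mass_ratio\<close> into the constant \<open>sqrt (16 * D)\<close>.\<close>
  have "(\<lambda>n. sqrt (real (T n)) * ((2 * D) ^ n * (\<Prod>k<n. gam a k)) * sqrt (16 * D)) \<longlonglongrightarrow> 0"
    by (rule tendsto_mult_left_zero[OF lim])
  moreover have "\<forall>\<^sub>F n in sequentially. sqrt (real (T n)) * ((2 * D) ^ n * (\<Prod>k<n. gam a k)) * sqrt (16 * D) = mass_ratio T n"
    using eventually_gap[of T]
  proof eventually_elim
    case (elim n)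
    have "16 * D = 8 * D / gap T n" unfolding elim by simp
    then show ?case by (simp only: mass_ratio_def)
  qed
  ultimately have ratio_lim: "(\<lambda>n. mass_ratio T n) \<longlonglongrightarrow> 0"
    by (rule Lim_transform_eventually)
  fix e :: real assume e: "0 < e"
  obtain N where N: "\<And>n. N \<le> n \<Longrightarrow> mass_ratio T n < e"
    using order_tendstoD(2)[OF ratio_lim e] by (auto simp: eventually_sequentially)
  have sep_pos: "0 < least_sep T n" for n
    unfolding least_sep_def using gap_range(1)[of T n] T(2)[of n]
    by (intro mult_pos_pos prod_pos divide_pos_pos) auto
  \<comment> \<open>All separations at levels up to \<open>N\<close> exceed \<open>d\<close>, so a
    set of diameter at most \<open>d\<close> can split only beyond \<open>N\<close>, where
    \<open>mass_ratio\<close> is below \<open>e\<close>.\<close>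
  define d where "d = Min (least_sep T ` {..N}) / 2"
  have d: "0 < d" unfolding d_def using sep_pos by (simp add: Min_gr_iff)
  have d_less: "d < least_sep T n" if "n \<le> N" for n
  proof -
    have "Min (least_sep T ` {..N}) \<le> least_sep T n" using that by (intro Min_le) auto
    then show ?thesis using sep_pos[of n] d unfolding d_def by linarith
  qed
  have "\<exists>S\<in>sets (digit_measure p). E \<inter> cf_value -` U \<subseteq> S \<and>
      emeasure (digit_measure p) S \<le> ennreal (e * diameter U powr (1 / 2))"
    if U: "bounded U" "diameter U \<le> d" for U
  proof (cases "\<exists>x\<in>E \<inter> cf_value -` U. \<exists>y\<in>E \<inter> cf_value -` U. x \<noteq> y")
    case True
    then obtain x0 y0 where xy: "x0 \<in> E \<inter> cf_value -` U" "y0 \<in> E \<inter> cf_value -` U" "x0 \<noteq> y0" by blast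
    have r: "\<bar>cf_value x - cf_value y\<bar> \<le> diameter U"
      if "x \<in> E \<inter> cf_value -` U" "y \<in> E \<inter> cf_value -` U" for x y
      using diameter_bounded_bound[OF U(1), of "cf_value x" "cf_value y"] that by (simp add: dist_real_def)
    have F: "E \<inter> cf_value -` U \<subseteq> seq_space a 0" "\<And>z i. z \<in> E \<inter> cf_value -` U \<Longrightarrow> z i \<le> T i"
      using E(2) T(1) by auto
    have "\<exists>n S. S \<in> sets (digit_measure p) \<and> E \<inter> cf_value -` U \<subseteq> S \<and> least_sep T n \<le> diameter U \<and>
        emeasure (digit_measure p) S \<le> ennreal (mass_ratio T n * sqrt (diameter U))"
      by (rule emeasure_truncated_le[OF F(1) _ xy]) (fact F(2), fact r)
    then obtain n S where S: "S \<in> sets (digit_measure p)" "E \<inter> cf_value -` U \<subseteq> S" "least_sep T n \<le> diameter U"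
      "emeasure (digit_measure p) S \<le> ennreal (mass_ratio T n * sqrt (diameter U))" by blast
    have "N \<le> n" using d_less[of n] S(3) U(2) by (cases "n \<le> N") auto
    then have "mass_ratio T n * sqrt (diameter U) \<le> e * sqrt (diameter U)"
      using N[of n] diameter_ge_0[OF U(1)] by (intro mult_right_mono) auto
    also have "\<dots> = e * diameter U powr (1 / 2)"
      using diameter_ge_0[OF U(1)] by (simp add: powr_half_sqrt)
    finally have "emeasure (digit_measure p) S \<le> ennreal (e * diameter U powr (1 / 2))"
      using S(4) ennreal_leI order_trans by blast
    then show ?thesis using S by blast
  next
    case False
    then have "E \<inter> cf_value -` U = {} \<or> (\<exists>z. z \<in> E \<and> E \<inter> cf_value -` U = {z})" by blast
    then show ?thesis
    proof
      assume "E \<inter> cf_value -` U = {}"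
      then show ?thesis by (intro bexI[of _ "{}"]) auto
    next
      assume "\<exists>z. z \<in> E \<and> E \<inter> cf_value -` U = {z}"
      then obtain z where z: "z \<in> E" "E \<inter> cf_value -` U = {z}" by blast
      then show ?thesis
        using emeasure_point_eq_0[OF subsetD[OF E(2) z(1)] lim0] by (intro bexI[of _ "{z}"]) auto
    qed
  qed
  then show "\<exists>d>0. \<forall>U. bounded U \<and> diameter U \<le> d \<longrightarrow>
      (\<exists>S\<in>sets (digit_measure p). E \<inter> cf_value -` U \<subseteq> S \<and>
        emeasure (digit_measure p) S \<le> ennreal (e * diameter U powr (1 / 2)))"
    using d by blast
qed simp

lemma hausdorff_half_eq_top:
  assumes E: "E \<in> sets (digit_measure p)" "E \<subseteq> seq_space a 0" "emeasure (digit_measure p) E > 0"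
    and B: "cf_value ` E \<subseteq> B"
    and \<delta>: "0 < (\<delta>::real)"
    and growth: "limsup (\<lambda>n. ereal (1 / real n *
        (ln (real (a n)) / 2 * ((1 + \<delta>) * ln (real n) / ln (ln (real (a n))) + 1)
          - (\<Sum>k<n. ln (ln (real (a k))))))) < 1"
  shows "hausdorff_measure (1 / 2) B = \<infinity>"
proof -
  define t where "t = trunc a (\<delta> / 2)"
  have t1: "1 \<le> t n" for n using trunc_bounds(3)[of a n "\<delta> / 2"] a_ge_1 \<delta> by (simp add: t_def)
  have "AE z in digit_measure p. \<forall>\<^sub>F n in sequentially. z n \<le> t n"
  proof (rule digit_measure_eventually_le)
    fix n
    have "emeasure (measure_pmf (p n)) {t n<..} \<le> ennreal (D * (real (t n) powr - gam a n / gam a n))"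
      using D_ge_1 pmf_le gam_pos[of a n] a_ge_1[of n] t1[of n]
      by (intro emeasure_pmf_greaterThan_le) auto
    also have "\<dots> \<le> ennreal (D * (real n + 1) powr - (1 + \<delta> / 2))"
      using trunc_powr_le[of a n "\<delta> / 2"] a_ge_1[of n] \<delta> D_ge_1
      by (intro ennreal_leI mult_left_mono) (auto simp: t_def)
    finally show "emeasure (measure_pmf (p n)) {t n<..} \<le> ennreal (D * (real n + 1) powr - (1 + \<delta> / 2))" .
    show "0 \<le> D * (real n + 1) powr - (1 + \<delta> / 2)" using D_ge_1 by simp
  next
    have "summable (\<lambda>n. real (1 + n) powr - (1 + \<delta> / 2))"
      by (rule summable_zeta_tail) (use \<delta> in simp)
    then show "summable (\<lambda>n. D * (real n + 1) powr - (1 + \<delta> / 2))"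
      by (intro summable_mult) (simp add: add.commute)
  qed
  \<comment> \<open>Borel-Cantelli bounds the digits only from an index on that depends on the
    sequence. A multiplicative constant absorbs the initial digits, so up to a null set
    \<open>E\<close> is the countable union of the \<open>EC C\<close> below, one of which has
    positive mass; the constant merely contributes \<open>sqrt (Suc C)\<close>.\<close>
  then have AE_C: "AE z in digit_measure p. \<exists>C. \<forall>n. z n \<le> Suc C * t n"
  proof (rule AE_mp, intro AE_I2 impI)
    fix z :: "nat \<Rightarrow> nat" assume "\<forall>\<^sub>F n in sequentially. z n \<le> t n"
    then obtain N where N: "\<And>n. N \<le> n \<Longrightarrow> z n \<le> t n" by (auto simp: eventually_sequentially)
    have "z n \<le> Suc (\<Sum>i<N. z i) * t n" for n
    proof (cases "n < N")
      case True
      then have "z n \<le> (\<Sum>i<N. z i)" by (intro member_le_sum) auto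
      also have "\<dots> \<le> Suc (\<Sum>i<N. z i) * 1" by simp
      also have "\<dots> \<le> Suc (\<Sum>i<N. z i) * t n" using t1 by (intro mult_le_mono) auto
      finally show ?thesis .
    next
      case False
      then have "z n \<le> 1 * t n" using N by simp
      also have "\<dots> \<le> Suc (\<Sum>i<N. z i) * t n" by (intro mult_le_mono) auto
      finally show ?thesis .
    qed
    then show "\<exists>C. \<forall>n. z n \<le> Suc C * t n" by blast
  qed
  define EC where "EC C = E \<inter> {z. \<forall>n. z n \<le> Suc C * t n}" for C
  have EC: "EC C \<in> sets (digit_measure p)" for C
  proof -
    have "{z \<in> space (digit_measure p). \<forall>n. z n \<le> Suc C * t n} \<in> sets (digit_measure p)" by measurable
    then show ?thesis unfolding EC_def using E(1) by (intro sets.Int) simp_all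
  qed
  have "\<exists>C. emeasure (digit_measure p) (EC C) \<noteq> 0"
  proof (rule ccontr)
    assume "\<nexists>C. emeasure (digit_measure p) (EC C) \<noteq> 0"
    then have "EC C \<in> null_sets (digit_measure p)" for C using EC by (auto simp: null_sets_def)
    then have "AE z in digit_measure p. \<forall>C. z \<notin> EC C"
      unfolding AE_all_countable using AE_not_in by blast
    with AE_C have "AE z in digit_measure p. z \<notin> E"
      by eventually_elim (auto simp: EC_def)
    then have "E \<in> null_sets (digit_measure p)"
      using E(1) by (simp add: AE_iff_null_sets)
    then show False using E(3) by (auto simp: null_sets_def)
  qed
  then obtain C where C: "emeasure (digit_measure p) (EC C) \<noteq> 0" by blast
  show ?thesis
  proof (rule hausdorff_measure_truncated[OF EC])
    show "EC C \<subseteq> seq_space a 0" "cf_value ` EC C \<subseteq> B" using E(2) B by (auto simp: EC_def)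
    show "emeasure (digit_measure p) (EC C) > 0" using C by (simp add: zero_less_iff_neq_zero)
    show "z i \<le> Suc C * t i" if "z \<in> EC C" for z i using that by (auto simp: EC_def)
    show "1 \<le> Suc C * t i" for i using t1[of i] by simp
    have "(\<lambda>n. sqrt (real (Suc C)) * (sqrt (real (t n)) * ((2 * D) ^ n * (\<Prod>k<n. gam a k)))) \<longlonglongrightarrow> 0"
      unfolding t_def using a_ge_1 a_top D_ge_1 \<delta> growth
      by (intro tendsto_mult_right_zero sqrt_trunc_prod_tendsto_0) auto
    then show "(\<lambda>n. sqrt (real (Suc C * t n)) * ((2 * D) ^ n * (\<Prod>k<n. gam a k))) \<longlonglongrightarrow> 0"
      by (simp only: of_nat_mult real_sqrt_mult mult.assoc)
  qed
qed

end


section \<open>The upper bound for the dimension\<close>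

lemma prod_tendsto_0:
  fixes f :: "nat \<Rightarrow> real"
  assumes "f \<longlonglongrightarrow> 0" "\<And>n. 0 \<le> f n"
  shows "(\<lambda>n. \<Prod>i<n. f i) \<longlonglongrightarrow> 0"
proof -
  obtain N where N: "\<And>n. N \<le> n \<Longrightarrow> f n < 1 / 2"
    using order_tendstoD(2)[OF assms(1), of "1 / 2"] by (auto simp: eventually_sequentially)
  have le: "(\<Prod>i<k + N. f i) \<le> (\<Prod>i<N. f i) * (1 / 2) ^ k" for k
  proof (induction k)
    case (Suc k)
    have "(\<Prod>i<k + N. f i) * f (k + N) \<le> ((\<Prod>i<N. f i) * (1 / 2) ^ k) * (1 / 2)"
      using Suc N[of "k + N"] assms(2) by (intro mult_mono mult_nonneg_nonneg prod_nonneg) auto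
    then show ?case by simp
  qed simp
  have lim: "(\<lambda>k. (\<Prod>i<N. f i) * (1 / 2) ^ k) \<longlonglongrightarrow> 0"
    by (intro tendsto_mult_right_zero LIMSEQ_realpow_zero) auto
  have "(\<lambda>k. \<Prod>i<k + N. f i) \<longlonglongrightarrow> 0"
    by (rule tendsto_sandwich[OF _ _ tendsto_const lim])
      (use le assms(2) in \<open>auto intro!: always_eventually prod_nonneg\<close>)
  then show ?thesis by (rule LIMSEQ_offset)
qed

lemma power_inverse_square_powr:
  assumes "1 \<le> (x::nat)" shows "(1 / (real x)\<^sup>2) powr s = real x powr - (2 * s)"
  using assms by (simp add: powr_divide powr_minus_divide powr_powr[symmetric])

text \<open>A cylinder of length \<open>n\<close> has diameter at most the product of the
  \<open>1 / z\<^sub>i\<^sup>2\<close>. Raised to the power \<open>s\<close>, this is its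
  probability under weights proportional to \<open>l powr - (2 * s)\<close> times the product of the
  normalising constants \<open>zeta_tail (a i) (2 * s)\<close>. The probabilities sum to at most 1,
  and the constants tend to 0 as \<open>a i\<close> grows.\<close>

lemma hausdorff_measure_X_alpha_eq_0:
  assumes a1: "\<And>n. 1 \<le> a n" and atop: "filterlim a at_top sequentially" and s: "1 / 2 < s"
  shows "hausdorff_measure s (X_alpha a) = 0"
proof (rule hausdorff_measure_eq_0I)
  show "0 < s" using s by simp
  fix e d :: real assume e: "0 < e" and d: "0 < d"
  define p where "p i = power_pmf (a i) (2 * s)" for i
  interpret prob_space "digit_measure p" by (rule prob_space_digit_measure)
  have Zpos: "0 < zeta_tail (a i) (2 * s)" for i using zeta_tail_pos[of "2 * s" "a i"] a1 s by simp
  have "(\<lambda>i. zeta_tail (a i) (2 * s)) \<longlonglongrightarrow> 0"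
    by (rule filterlim_compose[OF zeta_tail_tendsto_0 atop]) (use s in simp)
  then have "(\<lambda>n. \<Prod>i<n. zeta_tail (a i) (2 * s)) \<longlonglongrightarrow> 0"
    by (rule prod_tendsto_0) (use Zpos in \<open>auto intro: less_imp_le\<close>)
  moreover have "(\<lambda>n. 2 * (1 / 2) ^ n :: real) \<longlonglongrightarrow> 0"
    by (intro tendsto_mult_right_zero LIMSEQ_realpow_zero) auto
  ultimately have "\<forall>\<^sub>F n in sequentially. (\<Prod>i<n. zeta_tail (a i) (2 * s)) < e \<and> 2 * (1 / 2) ^ n < d"
    using e d by (intro eventually_conj order_tendstoD(2)) auto
  then obtain n where n: "(\<Prod>i<n. zeta_tail (a i) (2 * s)) < e" "2 * (1 / 2) ^ n < d"
    by (auto simp: eventually_sequentially)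
  define Z where "Z = (\<Prod>i<n. zeta_tail (a i) (2 * s))"
  have Z: "0 < Z" unfolding Z_def using Zpos by (intro prod_pos) auto
  \<comment> \<open>Cylinders are listed by coding their words as natural numbers; a number that
    codes no word of length \<open>n\<close> gives the empty set.\<close>
  define C :: "nat \<Rightarrow> (nat \<Rightarrow> nat) set" where "C k = {z. to_nat (map z [0..<n]) = k}" for k
  define U where "U k = cf_value ` (seq_space a 0 \<inter> C k)" for k
  have C_sets: "C k \<in> sets (digit_measure p)" for k
  proof -
    have "(\<lambda>z. map z [0..<n]) -` {w. to_nat w = k} \<inter> space (digit_measure p) \<in> sets (digit_measure p)"
      by (rule measurable_sets[OF measurable_map_digits]) simp
    then show ?thesis by (simp add: C_def vimage_def)
  qed
  have prefix: "x i = y i" if "x \<in> C k" "y \<in> C k" "i < n" for x y k i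
  proof -
    have "map x [0..<n] = map y [0..<n]" using that by (auto simp: C_def)
    then show ?thesis using that(3) by simp
  qed
  have diam: "bounded (U k) \<and> diameter (U k) \<le> d \<and>
      ennreal (diameter (U k) powr s) \<le> ennreal Z * emeasure (digit_measure p) (C k)" for k
  proof (cases "seq_space a 0 \<inter> C k = {}")
    case True
    then show ?thesis using d s by (simp add: U_def)
  next
    case False
    then obtain z where z: "z \<in> seq_space a 0" "z \<in> C k" by blast
    have z1: "1 \<le> z i" "a i \<le> z i" for i using z(1) by (auto simp: seq_space_def alphabet_def)
    have "U k \<subseteq> {0..1}" using cf_value_unit seq_space_positive by (force simp: U_def)
    then have bdd: "bounded (U k)" using bounded_subset bounded_closed_interval by blast
    have dist: "norm (u - v) \<le> (\<Prod>i<n. 1 / (real (z i))\<^sup>2) \<and> norm (u - v) \<le> 2 * (1 / 2) ^ n"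
      if uv: "u \<in> U k" "v \<in> U k" for u v
    proof -
      obtain x y where xy: "x \<in> seq_space a 0" "x \<in> C k" "u = cf_value x"
        "y \<in> seq_space a 0" "y \<in> C k" "v = cf_value y" using uv by (auto simp: U_def)
      have "(\<Prod>i<n. 1 / (real (x i))\<^sup>2) = (\<Prod>i<n. 1 / (real (z i))\<^sup>2)"
        using prefix[OF xy(2) z(2)] by (intro prod.cong) auto
      then show ?thesis
        using cf_value_cong_prefix(1,2)[where n = n, OF seq_space_positive[OF xy(1)] seq_space_positive[OF xy(4)] prefix[OF xy(2,5)]]
        by (simp add: xy)
    qed
    have d1: "diameter (U k) \<le> (\<Prod>i<n. 1 / (real (z i))\<^sup>2)"
      by (rule diameter_le) (use dist in \<open>auto intro!: prod_nonneg\<close>)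
    have "diameter (U k) \<le> 2 * (1 / 2) ^ n"
      by (rule diameter_le) (use dist in auto)
    then have d2: "diameter (U k) \<le> d" using n by simp
    have "C k = {z'. \<forall>i\<in>{..<n}. z' i \<in> {z i}}"
    proof (intro equalityI subsetI)
      fix z' assume "z' \<in> C k" then show "z' \<in> {z'. \<forall>i\<in>{..<n}. z' i \<in> {z i}}"
        using prefix[OF _ z(2)] by auto
    next
      fix z' assume "z' \<in> {z'. \<forall>i\<in>{..<n}. z' i \<in> {z i}}"
      then have eq: "map z' [0..<n] = map z [0..<n]" by simp
      show "z' \<in> C k" using z(2) unfolding C_def mem_Collect_eq eq .
    qed
    then have "emeasure (digit_measure p) (C k) = ennreal (\<Prod>i<n. pmf (p i) (z i))"
      by (simp only: emeasure_digit_measure_box finite_lessThan emeasure_pmf_single prod_ennreal pmf_nonneg)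
    also have "(\<Prod>i<n. pmf (p i) (z i)) = (\<Prod>i<n. real (z i) powr - (2 * s) / zeta_tail (a i) (2 * s))"
      using s a1 z1 by (intro prod.cong) (auto simp: p_def pmf_power_pmf)
    also have "\<dots> = (\<Prod>i<n. real (z i) powr - (2 * s)) / Z" by (simp add: Z_def prod_dividef)
    finally have em: "emeasure (digit_measure p) (C k) = ennreal ((\<Prod>i<n. real (z i) powr - (2 * s)) / Z)" .
    have "diameter (U k) powr s \<le> (\<Prod>i<n. 1 / (real (z i))\<^sup>2) powr s"
      using d1 s diameter_ge_0[OF bdd] by (intro powr_mono2) auto
    also have "\<dots> = (\<Prod>i<n. real (z i) powr - (2 * s))"
      using z1 by (simp add: prod_powr_distrib power_inverse_square_powr del: minus_mult_right)
    also have "\<dots> = Z * ((\<Prod>i<n. real (z i) powr - (2 * s)) / Z)" using Z by simp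
    finally have "ennreal (diameter (U k) powr s) \<le> ennreal (Z * ((\<Prod>i<n. real (z i) powr - (2 * s)) / Z))"
      by (rule ennreal_leI)
    also have "\<dots> = ennreal Z * emeasure (digit_measure p) (C k)"
      unfolding em using Z by (intro ennreal_mult) (auto intro!: divide_nonneg_pos prod_nonneg)
    finally show ?thesis using bdd d2 by simp
  qed
  show "\<exists>U. X_alpha a \<subseteq> (\<Union>i. U i) \<and> (\<forall>i. bounded (U i) \<and> diameter (U i) \<le> d) \<and>
      (\<Sum>i. ennreal (diameter (U i) powr s)) \<le> ennreal e"
  proof (intro exI[of _ U] conjI allI)
    show "X_alpha a \<subseteq> (\<Union>i. U i)" unfolding X_alpha_eq_image U_def by (auto simp: C_def)
    show "bounded (U k)" "diameter (U k) \<le> d" for k using diam[of k] by simp_all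
    have "(\<Sum>k. ennreal (diameter (U k) powr s)) \<le> (\<Sum>k. ennreal Z * emeasure (digit_measure p) (C k))"
      by (rule suminf_le[OF conjunct2[OF conjunct2[OF diam]]]) simp_all
    also have "\<dots> = ennreal Z * (\<Sum>k. emeasure (digit_measure p) (C k))"
      by (rule ennreal_suminf_cmult)
    also have "(\<Sum>k. emeasure (digit_measure p) (C k)) = emeasure (digit_measure p) (\<Union>k. C k)"
      using C_sets by (intro suminf_emeasure) (auto simp: disjoint_family_on_def C_def)
    also have "\<dots> \<le> 1" by (rule emeasure_le_1)
    finally have "(\<Sum>k. ennreal (diameter (U k) powr s)) \<le> ennreal Z * 1"
      using mult_left_mono order_trans zero_le by metis
    also have "\<dots> \<le> ennreal e" using n by (simp add: Z_def ennreal_leI)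
    finally show "(\<Sum>k. ennreal (diameter (U k) powr s)) \<le> ennreal e" .
  qed
qed


section \<open>The transfer operators as integrals\<close>

definition cat :: "nat \<Rightarrow> (nat \<Rightarrow> 'a) \<Rightarrow> (nat \<Rightarrow> 'a) \<Rightarrow> nat \<Rightarrow> 'a" where
  "cat n z x = (\<lambda>i. if i < n then z i else x (i - n))"

lemma cat_0 [simp]: "cat 0 z x = x"
  by (simp add: cat_def)

lemma shift_cat [simp]: "shift n (cat n z x) = x"
  by (simp add: cat_def shift_def)

lemma cat_at [simp]: "cat n z x n = x 0"
  by (simp add: cat_def)

text \<open>The letter prepended by the outermost of \<open>n + 1\<close> operators is digit
  \<open>n\<close> of the glued sequence.\<close>

lemma cat_Suc_upd: "cat (Suc n) (z(n := w)) x = cat n z (prepend w x)"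
proof
  fix i
  consider "i < n" | "i = n" | k where "i = Suc (n + k)"
    using less_imp_Suc_add linorder_cases by metis
  then show "cat (Suc n) (z(n := w)) x i = cat n z (prepend w x) i"
    by cases (simp_all add: cat_def prepend_def)
qed

lemma cat_in_seq_space:
  assumes "\<And>i. i < n \<Longrightarrow> z i \<in> alphabet a (m + i)" "x \<in> seq_space a (m + n)"
  shows "cat n z x \<in> seq_space a m"
  unfolding seq_space_def
proof (intro CollectI allI)
  fix i
  have "x (i - n) \<in> alphabet a (m + n + (i - n))" using assms(2) by (simp add: seq_space_def)
  then show "cat n z x i \<in> alphabet a (m + i)" using assms(1)[of i] by (cases "i < n") (simp_all add: cat_def)
qed

lemma shift_in_seq_space: "x \<in> seq_space a m \<Longrightarrow> shift n x \<in> seq_space a (m + n)"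
  by (auto simp: seq_space_def shift_def add.assoc)

text \<open>Integrands over the first \<open>n\<close> digits are thereby measurable for arbitrary
  \<open>F\<close>.\<close>

lemma prefix_determined_cat: "prefix_determined n (\<lambda>z. F (cat n z x))"
proof -
  have "cat n z x = cat n z' x" if "\<forall>i<n. z i = z' i" for z z'
    using that by (auto simp: cat_def)
  then show ?thesis unfolding prefix_determined_def by (intro allI impI arg_cong[of _ _ F])
qed

lemma expectation_eq_infsum:
  fixes J :: "'a \<Rightarrow> real"
  assumes "\<And>w. w \<in> set_pmf q \<Longrightarrow> \<bar>J w\<bar> \<le> B"
  shows "measure_pmf.expectation q J = infsum (\<lambda>w. pmf q w * J w) (set_pmf q)"
proof -
  have "integrable (measure_pmf q) J"
    using assms by (intro measure_pmf.integrable_const_bound[where B = B]) (auto simp: AE_measure_pmf_iff)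
  then have "integrable (density (count_space UNIV) (\<lambda>w. ennreal (pmf q w))) J"
    by (simp add: measure_pmf_eq_density[symmetric])
  then have "integrable (count_space UNIV) (\<lambda>w. pmf q w *\<^sub>R J w)"
    by (subst (asm) integrable_density) auto
  then have "infsetsum (\<lambda>w. pmf q w * J w) UNIV = infsum (\<lambda>w. pmf q w * J w) UNIV"
    by (intro infsetsum_infsum) (simp add: Infinite_Set_Sum.abs_summable_on_def)
  also have "\<dots> = infsum (\<lambda>w. pmf q w * J w) (set_pmf q)"
    by (rule infsum_cong_neutral) (auto simp: pmf_eq_0_set_pmf)
  finally show ?thesis by (simp only: pmf_expectation_eq_infsetsum)
qed

lemma L_iter_add: "L_iter a 0 (n + k) f = L_iter a n k (L_iter a 0 n f)"
  by (induction k) simp_all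

text \<open>The operators sum over the first \<open>n\<close> digits only, so a factor that depends
  on the later ones is constant in these sums.\<close>

lemma L_iter_pull_out:
  "L_iter a 0 n (\<lambda>y. f (shift n y) * h y) = (\<lambda>x. f x * L_iter a 0 n h x)"
proof (induction n arbitrary: f)
  case (Suc n)
  have step: "L_iter a 0 n (\<lambda>y. f (shift (Suc n) y) * h y) = (\<lambda>x. f (shift 1 x) * L_iter a 0 n h x)"
    using Suc[of "\<lambda>x. f (shift 1 x)"] by simp
  have sh: "shift 1 (prepend w x) = x" for w and x :: "nat \<Rightarrow> nat"
    by (simp add: shift_def prepend_def)
  show ?case
  proof
    fix x
    have "L_iter a 0 (Suc n) (\<lambda>y. f (shift (Suc n) y) * h y) x
        = infsum (\<lambda>w. f x * (phi a n (prepend w x) * L_iter a 0 n h (prepend w x))) (alphabet a n)"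
      unfolding L_iter.simps L_op_def step sh by (simp add: mult.left_commute)
    also have "\<dots> = f x * infsum (\<lambda>w. phi a n (prepend w x) * L_iter a 0 n h (prepend w x)) (alphabet a n)"
      by (rule infsum_cmult_right')
    finally show "L_iter a 0 (Suc n) (\<lambda>y. f (shift (Suc n) y) * h y) x = f x * L_iter a 0 (Suc n) h x"
      by (simp add: L_op_def)
  qed
qed simp

lemma P_iter_eq:
  "P_iter a n k f x = L_iter a 0 (n + k) (\<lambda>y. f (shift n y)) x / L_iter a 0 (n + k) (\<lambda>_. 1) x"
  using L_iter_pull_out[of a n f "\<lambda>_. 1"] by (simp add: P_iter_def L_iter_add)

section \<open>The product measure and the correction factors\<close>

locale summable_reciprocals =
  fixes a :: "nat \<Rightarrow> nat"
  assumes a_ge_1: "1 \<le> a n" and summable_reciprocal: "summable (\<lambda>n. 1 / real (a n))"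
begin

lemma a_top: "filterlim a at_top sequentially"
  unfolding filterlim_at_top
proof
  fix K :: nat
  have "(\<lambda>n. 1 / real (a n)) \<longlonglongrightarrow> 0" by (rule summable_LIMSEQ_zero[OF summable_reciprocal])
  then have "\<forall>\<^sub>F n in sequentially. 1 / real (a n) < 1 / (real K + 1)"
    by (rule order_tendstoD) simp
  then show "\<forall>\<^sub>F n in sequentially. K \<le> a n"
  proof eventually_elim
    case (elim n)
    then have "real K + 1 < real (a n)" using a_ge_1[of n] by (simp add: field_simps)
    then show ?case by linarith
  qed
qed

lemma alphabet_eq: "alphabet a n = {a n..}"
  using a_ge_1[of n] by (auto simp: alphabet_def)

definition p :: "nat \<Rightarrow> nat pmf" where
  "p i = power_pmf (a i) (1 + gam a i)"

definition Z :: "nat \<Rightarrow> real" where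
  "Z i = zeta_tail (a i) (1 + gam a i)"

definition m :: "(nat \<Rightarrow> nat) measure" where
  "m = digit_measure p"

lemma gam_pos': "0 < gam a i" and gam_le_1': "gam a i \<le> 1"
  using gam_pos gam_le_1 a_ge_1 by blast+

lemma Z_ge_1: "1 \<le> Z i"
proof -
  have "real (a i) powr - gam a i / gam a i = 1"
    using gam_eq_powr[of a i] a_ge_1[of i] gam_pos'[of i] by simp
  then show ?thesis using zeta_tail_ge[of "gam a i" "a i"] gam_pos' a_ge_1 by (simp add: Z_def)
qed

lemma pmf_p: "pmf (p i) l = (if a i \<le> l then real l powr - (1 + gam a i) / Z i else 0)"
  unfolding p_def Z_def using pmf_power_pmf[of "1 + gam a i" "a i" l] gam_pos'[of i] a_ge_1[of i] by simp

lemma set_pmf_p: "set_pmf (p i) = {a i..}"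
  unfolding p_def using set_power_pmf[of "1 + gam a i" "a i"] gam_pos'[of i] a_ge_1[of i] by simp

lemma pmf_p_le: "1 \<le> l \<Longrightarrow> pmf (p i) l \<le> real l powr - (1 + gam a i)"
  using Z_ge_1[of i] mult_left_mono[OF Z_ge_1[of i], of "real l powr - (1 + gam a i)"]
  by (simp add: pmf_p divide_le_eq)

sublocale m: prob_space m
  unfolding m_def by (rule prob_space_digit_measure)

lemma space_m [simp]: "space m = UNIV"
  by (simp add: m_def)

lemma measurable_digit_m [measurable]: "(\<lambda>z. z i) \<in> measurable m (count_space UNIV)"
  unfolding m_def by (rule measurable_digit)

lemma AE_seq_space: "AE z in m. z \<in> seq_space a 0"
  unfolding m_def using AE_digit_measure_digits
  by (rule AE_mp) (auto intro!: AE_I2 simp: seq_space_def alphabet_eq set_pmf_p)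

lemma seq_space_digits: "z \<in> seq_space a 0 \<longleftrightarrow> (\<forall>i. z i \<in> set_pmf (p i))"
  by (auto simp: seq_space_def alphabet_eq set_pmf_p)

text \<open>The factor by which \<open>\<phi>\<^sub>i(y\<^sub>i, y\<^sub>i\<^sub>+\<^sub>1, \<dots>)\<close> differs from \<open>y\<^sub>i powr - (1 + \<gamma>\<^sub>i)\<close>.\<close>

definition \<rho> :: "nat \<Rightarrow> (nat \<Rightarrow> nat) \<Rightarrow> real" where
  "\<rho> i y = (real (y i) * cf_value (shift i y)) powr (1 + gam a i)"

text \<open>The product is \<open>y i / (y i + \<theta>)\<close> with \<open>\<theta>\<close> in the
  unit interval, so its deviation from 1 is of order \<open>1 / a i\<close>.\<close>

lemma digit_cf_bounds:
  assumes y: "y \<in> seq_space a 0"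
  shows "1 / (1 + 1 / real (a i)) \<le> real (y i) * cf_value (shift i y)"
    "real (y i) * cf_value (shift i y) \<le> 1"
proof -
  have p1: "positive_seq (shift i y)" using positive_seq_shift seq_space_positive[OF y] by blast
  have yi: "a i \<le> y i" "1 \<le> y i" using y by (auto simp: seq_space_def alphabet_def)
  define \<theta> where "\<theta> = cf_value (shift 1 (shift i y))"
  have \<theta>: "0 \<le> \<theta>" "\<theta> \<le> 1" using cf_value_unit[OF positive_seq_shift[OF p1, of 1]] by (simp_all add: \<theta>_def)
  have eq: "real (y i) * cf_value (shift i y) = real (y i) / (real (y i) + \<theta>)"
    using cf_value_step[OF p1] by (simp add: \<theta>_def shift_apply)
  show "real (y i) * cf_value (shift i y) \<le> 1" unfolding eq using yi \<theta> by (simp add: divide_le_eq)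
  have "\<theta> * real (a i) \<le> 1 * real (y i)" using yi \<theta> by (intro mult_mono) auto
  then have "real (y i) + \<theta> \<le> real (y i) * (1 + 1 / real (a i))"
    using a_ge_1[of i] by (simp add: field_simps)
  then have "real (y i) / (real (y i) * (1 + 1 / real (a i))) \<le> real (y i) / (real (y i) + \<theta>)"
    using yi \<theta> a_ge_1[of i] by (intro divide_left_mono mult_pos_pos add_pos_nonneg) auto
  then show "1 / (1 + 1 / real (a i)) \<le> real (y i) * cf_value (shift i y)"
    unfolding eq using yi by simp
qed

text \<open>The exponent \<open>1 + gam a i\<close> is at most 2. With
  \<open>summable_reciprocal\<close> the logarithms are summable, uniformly in \<open>y\<close>, and
  the infinite product of the \<open>\<rho> i\<close> stays away from 0.\<close>

lemma \<rho>_bounds: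
  assumes y: "y \<in> seq_space a 0"
  shows "0 < \<rho> i y" "\<rho> i y \<le> 1" "\<bar>ln (\<rho> i y)\<bar> \<le> 2 * (1 / real (a i))"
proof -
  let ?b = "real (y i) * cf_value (shift i y)"
  note b = digit_cf_bounds[OF y, of i]
  have pos: "0 < 1 / (1 + 1 / real (a i))" by (intro divide_pos_pos add_pos_nonneg) auto
  then have b0: "0 < ?b" using b by linarith
  then show "0 < \<rho> i y" unfolding \<rho>_def powr_gt_zero by (rule less_imp_neq[THEN not_sym])
  show "\<rho> i y \<le> 1" unfolding \<rho>_def using b b0 gam_pos'[of i] by (intro powr_le1) auto
  have "ln (1 / (1 + 1 / real (a i))) \<le> ln ?b" using b pos b0 by (subst ln_le_cancel_iff) auto
  moreover have "ln (1 / (1 + 1 / real (a i))) = - ln (1 + 1 / real (a i))"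
    by (simp add: ln_div add_pos_nonneg)
  moreover have "ln (1 + 1 / real (a i)) \<le> 1 / real (a i)" by (intro ln_add_one_self_le_self) simp
  ultimately have l1: "- ln ?b \<le> 1 / real (a i)" by linarith
  have l2: "0 \<le> - ln ?b" using b b0 by simp
  have "(1 + gam a i) * (- ln ?b) \<le> 2 * (1 / real (a i))"
    using l1 l2 gam_pos'[of i] gam_le_1'[of i] by (intro mult_mono) auto
  moreover have "ln (\<rho> i y) = (1 + gam a i) * ln ?b" using b0 by (simp add: \<rho>_def ln_powr)
  moreover have "0 \<le> (1 + gam a i) * (- ln ?b)" using l2 gam_pos'[of i] by (intro mult_nonneg_nonneg) auto
  ultimately show "\<bar>ln (\<rho> i y)\<bar> \<le> 2 * (1 / real (a i))" by simp
qed

definition R :: "nat \<Rightarrow> (nat \<Rightarrow> nat) \<Rightarrow> real" where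
  "R n y = (\<Prod>i<n. \<rho> i y)"

lemma R_range: "y \<in> seq_space a 0 \<Longrightarrow> 0 \<le> R n y \<and> R n y \<le> 1"
  unfolding R_def using \<rho>_bounds by (auto intro!: prod_nonneg prod_le_1 intro: less_imp_le)

lemma phi_prepend:
  assumes x: "x \<in> seq_space a (Suc n)" and w: "w \<in> alphabet a n"
  shows "phi a n (prepend w x) = Z n * pmf (p n) w * \<rho> n (cat n z (prepend w x))"
proof -
  have w1: "1 \<le> w" "a n \<le> w" using w by (auto simp: alphabet_def)
  have c: "0 \<le> cf_value (prepend w x)"
  proof -
    have "prepend w x \<in> seq_space a n"
      using x w by (auto simp: seq_space_def prepend_def split: nat.split)
    then show ?thesis using cf_value_unit seq_space_positive by blast
  qed
  have "cat n z (prepend w x) n = w" by (simp add: cat_def prepend_def)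
  then have "\<rho> n (cat n z (prepend w x)) = real w powr (1 + gam a n) * cf_value (prepend w x) powr (1 + gam a n)"
    using w1 c by (simp add: \<rho>_def powr_mult)
  moreover have "Z n * pmf (p n) w = real w powr - (1 + gam a n)"
    using w1 Z_ge_1[of n] by (simp add: pmf_p)
  moreover have "real w powr - (1 + gam a n) * (real w powr (1 + gam a n) * c) = c" for c
  proof -
    have "real w powr - (1 + gam a n) * real w powr (1 + gam a n) = real w powr (- (1 + gam a n) + (1 + gam a n))"
      by (rule powr_add[symmetric])
    also have "\<dots> = 1" using w1 by simp
    finally show ?thesis by (simp only: mult.assoc[symmetric] mult_1_left)
  qed
  moreover have "2 * delt a n = 1 + gam a n" by (simp add: delt_def)
  ultimately show ?thesis by (simp only: phi_def)
qed

text \<open>Induction on the number of operators: the outermost one sums over digit \<open>n\<close>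
  with weights \<open>Z n\<close> times a probability, times \<open>\<rho> n\<close>, and Fubini
  merges this sum with the integral over the earlier digits.\<close>

lemma L_iter_eq_integral:
  assumes f: "\<And>y. y \<in> seq_space a 0 \<Longrightarrow> \<bar>f y\<bar> \<le> B" and x: "x \<in> seq_space a n"
  shows "L_iter a 0 n f x = (\<Prod>i<n. Z i) * (\<integral>z. f (cat n z x) * R n (cat n z x) \<partial>m)"
  using x
proof (induction n arbitrary: x)
  case 0
  then show ?case using m.prob_space by (simp add: R_def)
next
  case (Suc n)
  define F where "F z = f (cat (Suc n) z x) * R (Suc n) (cat (Suc n) z x)" for z
  define J where "J w = (\<integral>z. F (z(n := w)) \<partial>m)" for w
  have bound: "\<bar>F (z(n := w))\<bar> \<le> B" if "w \<in> set_pmf (p n)" "z \<in> seq_space a 0" for w z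
  proof -
    have "cat (Suc n) (z(n := w)) x \<in> seq_space a 0"
      using that Suc.prems by (intro cat_in_seq_space) (auto simp: seq_space_digits alphabet_eq set_pmf_p)
    then have "\<bar>f (cat (Suc n) (z(n := w)) x)\<bar> * \<bar>R (Suc n) (cat (Suc n) (z(n := w)) x)\<bar> \<le> B * 1"
      using f R_range by (intro mult_mono) (auto intro: order_trans[OF abs_ge_zero])
    then show ?thesis by (simp add: F_def abs_mult)
  qed
  have Fmeas: "F \<in> borel_measurable (digit_measure p)"
    unfolding F_def by (rule prefix_determined_measurable[OF prefix_determined_cat]) simp
  have int: "(\<integral>z. F z \<partial>m) = (\<integral>w. J w \<partial>measure_pmf (p n))"
    unfolding J_def m_def
    by (rule integral_digit_measure_upd[OF Fmeas bound]) (auto simp: seq_space_digits)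
  have Jbound: "\<bar>J w\<bar> \<le> B" if w: "w \<in> set_pmf (p n)" for w
  proof -
    have Fw: "(\<lambda>z. F (z(n := w))) \<in> borel_measurable m"
      unfolding F_def cat_Suc_upd m_def by (rule prefix_determined_measurable[OF prefix_determined_cat]) simp
    have "norm (J w) \<le> (\<integral>z. norm (F (z(n := w))) \<partial>m)" unfolding J_def by (rule integral_norm_bound)
    also have "\<dots> \<le> (\<integral>z. B \<partial>m)"
    proof (rule integral_mono_AE)
      have AE: "AE z in m. \<bar>F (z(n := w))\<bar> \<le> B"
        using AE_seq_space by (rule AE_mp) (auto intro!: AE_I2 bound[OF w])
      then show "AE z in m. norm (F (z(n := w))) \<le> B" by simp
      show "integrable m (\<lambda>z. norm (F (z(n := w))))"
        using AE Fw by (intro integrable_norm m.integrable_const_bound[of _ B]) auto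
    qed simp
    also have "\<dots> = B" using m.prob_space by simp
    finally show ?thesis by simp
  qed
  have pre: "prepend w x \<in> seq_space a n" if "w \<in> alphabet a n" for w
    using that Suc.prems by (auto simp: seq_space_def prepend_def split: nat.split)
  have summand: "phi a n (prepend w x) * L_iter a 0 n f (prepend w x)
      = (\<Prod>i<Suc n. Z i) * (pmf (p n) w * J w)" if w: "w \<in> alphabet a n" for w
  proof -
    \<comment> \<open>\<open>\<rho> n\<close> reads only digits from index \<open>n\<close> on,
      which are fixed here, so it leaves the integral; hence also the arbitrary
      \<open>undefined\<close>.\<close>
    define c where "c = \<rho> n (cat n undefined (prepend w x))"
    have c: "\<rho> n (cat n z (prepend w x)) = c" for z
      by (simp add: c_def \<rho>_def)
    have "J w = (\<integral>z. f (cat n z (prepend w x)) * R n (cat n z (prepend w x)) * c \<partial>m)"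
      unfolding J_def F_def cat_Suc_upd by (simp add: R_def c mult.assoc)
    also have "\<dots> = (\<integral>z. f (cat n z (prepend w x)) * R n (cat n z (prepend w x)) \<partial>m) * c"
      by (rule integral_mult_left_zero)
    finally show ?thesis
      using phi_prepend[OF Suc.prems w, of undefined] Suc.IH[OF pre[OF w]] by (simp add: c_def)
  qed
  have "L_iter a 0 (Suc n) f x = infsum (\<lambda>w. (\<Prod>i<Suc n. Z i) * (pmf (p n) w * J w)) (alphabet a n)"
    unfolding L_iter.simps L_op_def add_0 by (rule infsum_cong) (use summand in simp)
  also have "\<dots> = (\<Prod>i<Suc n. Z i) * infsum (\<lambda>w. pmf (p n) w * J w) (alphabet a n)"
    by (rule infsum_cmult_right')
  also have "alphabet a n = set_pmf (p n)" by (simp add: alphabet_eq set_pmf_p)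
  also have "infsum (\<lambda>w. pmf (p n) w * J w) (set_pmf (p n)) = (\<integral>w. J w \<partial>measure_pmf (p n))"
    by (rule expectation_eq_infsum[OF Jbound, symmetric])
  finally show ?case unfolding int[symmetric] F_def .
qed

end


section \<open>The measures \<open>\<nu>\<^sub>n\<close>\<close>

lemma holder_coeff_leI:
  assumes "0 < r" "0 \<le> K" "\<And>k x y. 1 \<le> k \<Longrightarrow> x \<in> seq_space a n \<Longrightarrow> y \<in> seq_space a n \<Longrightarrow>
    (\<forall>i<k. x i = y i) \<Longrightarrow> \<bar>f x - f y\<bar> \<le> K * r ^ k"
  shows "holder_coeff a n r f \<le> ennreal K"
  unfolding holder_coeff_def
proof (rule Sup_least)
  fix v assume "v \<in> {ennreal (\<bar>f x - f y\<bar> / r ^ k) | k x y.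
    1 \<le> k \<and> (\<exists>u. length u = k \<and> x \<in> seq_cylinder a n u \<and> y \<in> seq_cylinder a n u)}"
  then obtain k x y u where v: "v = ennreal (\<bar>f x - f y\<bar> / r ^ k)" "1 \<le> k" "length u = k"
    "x \<in> seq_cylinder a n u" "y \<in> seq_cylinder a n u" by blast
  then have "\<bar>f x - f y\<bar> \<le> K * r ^ k" by (intro assms(3)) (auto simp: seq_cylinder_def)
  then show "v \<le> ennreal K" unfolding v(1) using assms(1) by (intro ennreal_leI) (simp add: divide_le_eq)
qed

lemma holder_coeff_finiteD:
  assumes fin: "holder_coeff a n r f < \<infinity>" and r: "0 < r"
  shows "\<exists>K. \<forall>k x y. 1 \<le> k \<longrightarrow> x \<in> seq_space a n \<longrightarrow> y \<in> seq_space a n \<longrightarrow>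
    (\<forall>i<k. x i = y i) \<longrightarrow> \<bar>f x - f y\<bar> \<le> K * r ^ k"
proof -
  obtain K where K: "0 \<le> K" "holder_coeff a n r f = ennreal K"
    using fin by (cases "holder_coeff a n r f") auto
  have "\<bar>f x - f y\<bar> \<le> K * r ^ k"
    if "1 \<le> k" "x \<in> seq_space a n" "y \<in> seq_space a n" "\<forall>i<k. x i = y i" for k x y
  proof -
    have "x \<in> seq_cylinder a n (map x [0..<k])" "y \<in> seq_cylinder a n (map x [0..<k])"
      using that by (auto simp: seq_cylinder_def)
    moreover have "length (map x [0..<k]) = k" by simp
    ultimately have "\<exists>k' x' y'. ennreal (\<bar>f x - f y\<bar> / r ^ k) = ennreal (\<bar>f x' - f y'\<bar> / r ^ k') \<and> 1 \<le> k' \<and>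
        (\<exists>u. length u = k' \<and> x' \<in> seq_cylinder a n u \<and> y' \<in> seq_cylinder a n u)"
      using that(1) by blast
    then have "ennreal (\<bar>f x - f y\<bar> / r ^ k) \<le> holder_coeff a n r f"
      unfolding holder_coeff_def by (intro Sup_upper CollectI)
    then have "\<bar>f x - f y\<bar> / r ^ k \<le> K" using K by (simp add: ennreal_le_iff)
    then show ?thesis using r by (simp add: divide_le_eq)
  qed
  then show ?thesis by blast
qed

lemma space_seq_sigma [simp]: "space (sigma (seq_space a n) (range (seq_cylinder a n))) = seq_space a n"
  by (rule space_measure_of) (auto simp: seq_cylinder_def)

lemma sets_seq_sigma: "sets (sigma (seq_space a n) (range (seq_cylinder a n))) = seq_algebra a n"
  unfolding seq_algebra_def by (rule sets_measure_of) (auto simp: seq_cylinder_def)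

lemma measurable_map_seq_sigma:
  assumes N: "space N = seq_space a n" "sets N = seq_algebra a n"
  shows "(\<lambda>y. map y [0..<k]) \<in> measurable N (count_space UNIV)"
  unfolding measurable_count_space_eq2_countable
proof (intro conjI ballI)
  fix u :: "nat list"
  show "(\<lambda>y. map y [0..<k]) -` {u} \<inter> space N \<in> sets N"
  proof (cases "length u = k")
    case True
    have iff: "map y [0..<k] = u \<longleftrightarrow> (\<forall>i<length u. y i = u ! i)" for y
    proof
      assume e: "map y [0..<k] = u"
      show "\<forall>i<length u. y i = u ! i"
      proof (intro allI impI)
        fix i assume "i < length u"
        then have "map y [0..<k] ! i = y i" using True by simp
        then show "y i = u ! i" unfolding e by (rule sym)
      qed
    next
      assume "\<forall>i<length u. y i = u ! i"
      then show "map y [0..<k] = u" by (intro nth_equalityI) (simp_all add: True)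
    qed
    have "(\<lambda>y. map y [0..<k]) -` {u} \<inter> space N = seq_cylinder a n u"
      unfolding N(1) seq_cylinder_def vimage_def singleton_iff iff by blast
    moreover have "seq_cylinder a n u \<in> seq_algebra a n"
      unfolding seq_algebra_def by (intro sigma_sets.Basic rangeI)
    ultimately show ?thesis by (simp only: N(2))
  next
    case False
    then have "map y [0..<k] \<noteq> u" for y by auto
    then have "(\<lambda>y. map y [0..<k]) -` {u} \<inter> space N = {}" by blast
    then show ?thesis by (simp only: sets.empty_sets)
  qed
qed auto

text \<open>Replacing all digits from index \<open>k\<close> on by those of a fixed sequence changes
  \<open>f\<close> by at most \<open>K * r ^ k\<close> and leaves a function of a finite word, so
  \<open>f\<close> is a pointwise limit of measurable functions.\<close>

lemma holder_measurable:
  fixes f :: "(nat \<Rightarrow> nat) \<Rightarrow> real"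
  assumes N: "space N = seq_space a n" "sets N = seq_algebra a n"
    and r: "0 < r" "r < 1" and hold: "holder_coeff a n r f < \<infinity>"
  shows "f \<in> borel_measurable N"
proof (cases "seq_space a n = {}")
  case True
  then show ?thesis using N(1) by (simp add: measurable_def)
next
  case False
  then obtain e where e: "e \<in> seq_space a n" by blast
  obtain K where K: "\<And>k x y. 1 \<le> k \<Longrightarrow> x \<in> seq_space a n \<Longrightarrow> y \<in> seq_space a n \<Longrightarrow>
    (\<forall>i<k. x i = y i) \<Longrightarrow> \<bar>f x - f y\<bar> \<le> K * r ^ k"
    using holder_coeff_finiteD[OF hold r(1)] by blast
  define t where "t k y = cat k y (shift k e)" for k and y :: "nat \<Rightarrow> nat"
  have t_space: "t k y \<in> seq_space a n" if "y \<in> seq_space a n" for k y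
    unfolding t_def
    by (rule cat_in_seq_space) (use that shift_in_seq_space[OF e] in \<open>auto simp: seq_space_def\<close>)
  show ?thesis
  proof (rule borel_measurable_LIMSEQ_real)
    fix y assume "y \<in> space N"
    then have y: "y \<in> seq_space a n" by (simp add: N)
    have "(\<lambda>k. K * r ^ k) \<longlonglongrightarrow> 0"
      using r by (intro tendsto_mult_right_zero LIMSEQ_realpow_zero) auto
    moreover have "\<forall>\<^sub>F k in sequentially. norm (f (t k y) - f y) \<le> K * r ^ k"
      using eventually_ge_at_top[of 1]
    proof eventually_elim
      case (elim k)
      then show ?case using K[OF elim t_space[OF y] y] by (simp add: t_def cat_def)
    qed
    ultimately have "(\<lambda>k. f (t k y) - f y) \<longlonglongrightarrow> 0" by (rule Lim_null_comparison[rotated])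
    then show "(\<lambda>k. f (t k y)) \<longlonglongrightarrow> f y" by (simp add: LIM_zero_iff)
  next
    fix k
    have "(\<lambda>y. (\<lambda>u. f (t k (\<lambda>i. u ! i))) (map y [0..<k])) \<in> borel_measurable N"
      by (rule measurable_compose[OF measurable_map_seq_sigma[OF N]]) simp
    moreover have "t k (\<lambda>i. map y [0..<k] ! i) = t k y" for y
      by (auto simp: t_def cat_def)
    ultimately show "(\<lambda>y. f (t k y)) \<in> borel_measurable N" by simp
  qed
qed

lemma holder_coeff_cf_value: "holder_coeff a n (1 / 2) cf_value < \<infinity>"
proof -
  have "holder_coeff a n (1 / 2) cf_value \<le> ennreal 2"
    by (rule holder_coeff_leI) (use cf_value_cong_prefix(2) seq_space_positive in auto)
  then show ?thesis by (rule order_le_less_trans) simp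
qed

text \<open>\<open>ln (phi a n x)\<close> is \<open>- (1 + gam a n)\<close> times
  \<open>ln (b + s)\<close> with \<open>b\<close> the first digit. Removing it leaves
  \<open>k - 1\<close> common digits in the tails, which gives \<open>4 * (1 / 2) ^ k\<close>; the
  factor \<open>1 + gam a n \<le> 2\<close> makes 8, the same for all \<open>n\<close>.\<close>

lemma holder_coeff_ln_phi:
  assumes "1 \<le> a n" shows "holder_coeff a n (1 / 2) (\<lambda>x. ln (phi a n x)) \<le> ennreal 8"
proof (rule holder_coeff_leI)
  fix k x y assume k: "1 \<le> k" and x: "x \<in> seq_space a n" and y: "y \<in> seq_space a n"
    and eq: "\<forall>i<k. x i = y i"
  have px: "positive_seq x" and py: "positive_seq y" using x y seq_space_positive by blast+
  define s t b where "s = cf_value (shift 1 x)" and "t = cf_value (shift 1 y)" and "b = real (x 0)"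
  have s: "0 \<le> s" and t: "0 \<le> t" using cf_value_unit positive_seq_shift px py by (auto simp: s_def t_def)
  have "y 0 = x 0" using eq[rule_format, of 0] k by simp
  moreover have "1 \<le> b" using px by (simp add: b_def positive_seq_def)
  ultimately have b: "1 \<le> b" "y 0 = x 0" by blast+
  have cf: "cf_value x = 1 / (b + s)" "cf_value y = 1 / (b + t)"
    using cf_value_step[OF px] cf_value_step[OF py] b(2) by (simp_all add: b_def s_def t_def)
  have ln_phi': "ln ((1 / (b + u)) powr (2 * delt a n)) = - ((1 + gam a n) * ln (b + u))" if "0 \<le> u" for u
  proof -
    have "ln (1 / (b + u)) = - ln (b + u)" using b(1) that by (simp add: ln_div)
    moreover have "2 * delt a n = 1 + gam a n" by (simp add: delt_def)
    ultimately show ?thesis using b(1) that by (simp add: ln_powr)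
  qed
  have ln_phi: "ln (phi a n x) = - ((1 + gam a n) * ln (b + s))" "ln (phi a n y) = - ((1 + gam a n) * ln (b + t))"
    unfolding phi_def cf by (rule ln_phi'[OF s], rule ln_phi'[OF t])
  have ln_lip: "\<bar>ln u - ln v\<bar> \<le> \<bar>u - v\<bar>" if "1 \<le> u" "1 \<le> v" for u v :: real
  proof -
    have *: "ln u - ln v \<le> u - v" if "1 \<le> v" "v \<le> u" for u v :: real
    proof -
      have "ln u - ln v = ln (u / v)" using that by (simp add: ln_div)
      also have "\<dots> \<le> u / v - 1" using that by (intro ln_le_minus_one) auto
      also have "\<dots> = (u - v) / v" using that by (simp add: field_simps)
      also have "\<dots> \<le> (u - v) / 1" using that by (intro divide_left_mono) auto
      finally show ?thesis by simp
    qed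
    show ?thesis
    proof (cases "v \<le> u")
      case True
      then show ?thesis using *[OF that(2) True] that by (simp add: abs_of_nonneg)
    next
      case False
      then show ?thesis using *[OF that(1), of v] that by (simp add: abs_of_nonpos)
    qed
  qed
  have agree: "shift 1 x i = shift 1 y i" if "i < k - 1" for i
    using eq that by (simp add: shift_def)
  have "\<bar>ln (b + s) - ln (b + t)\<bar> \<le> \<bar>s - t\<bar>" using ln_lip[of "b + s" "b + t"] b s t by simp
  also have "\<dots> \<le> 2 * (1 / 2) ^ (k - 1)"
    unfolding s_def t_def
    by (rule cf_value_cong_prefix(2)[OF positive_seq_shift[OF px] positive_seq_shift[OF py] agree])
  also have "\<dots> = 4 * (1 / 2) ^ k" using k by (cases k) auto
  finally have le: "\<bar>ln (b + s) - ln (b + t)\<bar> \<le> 4 * (1 / 2) ^ k" .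
  have g: "0 < gam a n" "gam a n \<le> 1" using gam_pos gam_le_1 assms by blast+
  have "ln (phi a n x) - ln (phi a n y) = - ((1 + gam a n) * (ln (b + s) - ln (b + t)))"
    unfolding ln_phi by (simp add: algebra_simps)
  then have "\<bar>ln (phi a n x) - ln (phi a n y)\<bar> = (1 + gam a n) * \<bar>ln (b + s) - ln (b + t)\<bar>"
    using g by (simp add: abs_mult)
  also have "\<dots> \<le> 2 * (4 * (1 / 2) ^ k)" using g le by (intro mult_mono) auto
  finally show "\<bar>ln (phi a n x) - ln (phi a n y)\<bar> \<le> 8 * (1 / 2) ^ k" by simp
qed auto

lemma Int_stable_seq_cylinders: "Int_stable (range (seq_cylinder a n))"
proof (rule Int_stableI)
  have swap: "seq_cylinder a n u \<inter> seq_cylinder a n v \<in> range (seq_cylinder a n)" if "length u \<le> length v" for u v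
  proof (cases "\<forall>i<length u. u ! i = v ! i")
    case True
    then have "seq_cylinder a n u \<inter> seq_cylinder a n v = seq_cylinder a n v"
      using that by (auto simp: seq_cylinder_def)
    then show ?thesis by blast
  next
    case False
    \<comment> \<open>The empty set must be a cylinder too; the word \<open>[0]\<close> gives it,
      since letters are at least 1.\<close>
    have empty: "seq_cylinder a n [0] = {}"
      by (auto simp: seq_cylinder_def seq_space_def alphabet_def intro!: exI[of _ 0])
    obtain i where i: "i < length u" "u ! i \<noteq> v ! i" using False by blast
    have iv: "i < length v" using i(1) that by simp
    have "x i = u ! i \<and> x i = v ! i" if "x \<in> seq_cylinder a n u \<inter> seq_cylinder a n v" for x
      using that i(1) iv unfolding seq_cylinder_def by blast
    then have "seq_cylinder a n u \<inter> seq_cylinder a n v = {}" using i(2) by force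
    then show ?thesis using rangeI[of "seq_cylinder a n" "[0]"] empty by simp
  qed
  fix A B assume "A \<in> range (seq_cylinder a n)" "B \<in> range (seq_cylinder a n)"
  then obtain u v where AB: "A = seq_cylinder a n u" "B = seq_cylinder a n v" by blast
  show "A \<inter> B \<in> range (seq_cylinder a n)"
  proof (cases "length u \<le> length v")
    case True
    then show ?thesis unfolding AB by (rule swap)
  next
    case False
    then have "length v \<le> length u" by simp
    then show ?thesis unfolding AB by (subst Int_commute) (rule swap)
  qed
qed

lemma holder_coeff_indicator_cylinder:
  assumes "0 < r" "r < 1"
  shows "holder_coeff a n r (indicator (seq_cylinder a n u)) < \<infinity>"
proof -
  have "holder_coeff a n r (indicator (seq_cylinder a n u)) \<le> ennreal ((1 / r) ^ length u)"
  proof (rule holder_coeff_leI)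
    fix k x y assume k: "1 \<le> k" and x: "x \<in> seq_space a n" and y: "y \<in> seq_space a n"
      and eq: "\<forall>i<k. x i = y i"
    show "\<bar>indicator (seq_cylinder a n u) x - indicator (seq_cylinder a n u) y\<bar> \<le> (1 / r) ^ length u * r ^ k"
    proof (cases "length u \<le> k")
      case True
      then have "x \<in> seq_cylinder a n u \<longleftrightarrow> y \<in> seq_cylinder a n u"
        using x y eq by (auto simp: seq_cylinder_def)
      then show ?thesis using assms by (simp add: indicator_def)
    next
      case False
      have "\<bar>indicator (seq_cylinder a n u) x - indicator (seq_cylinder a n u) y :: real\<bar> \<le> 1"
        by (simp add: indicator_def)
      also have "1 = (1 / r) ^ length u * r ^ length u" using assms by (simp add: power_mult_distrib[symmetric])
      also have "\<dots> \<le> (1 / r) ^ length u * r ^ k"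
        using assms False by (intro mult_left_mono power_decreasing) auto
      finally show ?thesis .
    qed
  qed (use assms in auto)
  then show ?thesis by (rule order_le_less_trans) simp
qed

text \<open>The two sequences may come with different \<open>r\<close>. Indicators of cylinders are
  admissible for each, and along one common choice of \<open>xs\<close> their limits do not involve
  \<open>r\<close>; so the measures agree on a generator stable under intersections.\<close>

lemma is_nu_seq_unique:
  assumes ne: "\<And>n. seq_space a n \<noteq> {}" and nu: "is_nu_seq a \<nu>" "is_nu_seq a \<nu>'"
  shows "\<nu> = \<nu>'"
proof
  fix n
  define xs where "xs k = (SOME x. x \<in> seq_space a (n + k))" for k
  have xs: "xs k \<in> seq_space a (n + k)" for k
    unfolding xs_def some_in_eq by (rule ne)
  have lim: "(\<lambda>k. P_iter a n k (indicator (seq_cylinder a n u)) (xs k)) \<longlonglongrightarrow> measure (\<mu> n) (seq_cylinder a n u)"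
    and basic: "prob_space (\<mu> n)" "space (\<mu> n) = seq_space a n" "sets (\<mu> n) = seq_algebra a n"
    if \<mu>: "is_nu_seq a \<mu>" for \<mu> u
  proof -
    from \<mu> obtain r where r: "0 < r" "r < 1" and all: "\<forall>n. prob_space (\<mu> n) \<and> space (\<mu> n) = seq_space a n \<and>
        sets (\<mu> n) = seq_algebra a n \<and>
        (\<forall>f xs. bounded (f ` seq_space a n) \<and> holder_coeff a n r f < \<infinity> \<and>
          (\<forall>k. xs k \<in> seq_space a (n + k)) \<longrightarrow> (\<lambda>k. P_iter a n k f (xs k)) \<longlonglongrightarrow> integral\<^sup>L (\<mu> n) f)"
      unfolding is_nu_seq_def by (elim exE conjE)
    note all_n = spec[OF all, of n]
    have b: "prob_space (\<mu> n)" "space (\<mu> n) = seq_space a n" "sets (\<mu> n) = seq_algebra a n"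
      by (rule conjunct1[OF all_n], rule conjunct1[OF conjunct2[OF all_n]],
          rule conjunct1[OF conjunct2[OF conjunct2[OF all_n]]])
    have conv: "(\<lambda>k. P_iter a n k f (xs k)) \<longlonglongrightarrow> integral\<^sup>L (\<mu> n) f"
      if "bounded (f ` seq_space a n)" "holder_coeff a n r f < \<infinity>" for f
      by (rule mp[OF spec[OF spec[OF all_n[THEN conjunct2, THEN conjunct2, THEN conjunct2], of f], of xs]])
        (intro conjI allI that xs)
    show "prob_space (\<mu> n)" "space (\<mu> n) = seq_space a n" "sets (\<mu> n) = seq_algebra a n" by fact+
    have "bounded (indicator (seq_cylinder a n u) ` seq_space a n :: real set)"
      by (rule bounded_subset[of "{0, 1}"]) (auto simp: indicator_def)
    then have "(\<lambda>k. P_iter a n k (indicator (seq_cylinder a n u)) (xs k))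
        \<longlonglongrightarrow> integral\<^sup>L (\<mu> n) (indicator (seq_cylinder a n u))"
      by (rule conv[OF _ holder_coeff_indicator_cylinder[OF r]])
    moreover have "seq_cylinder a n u \<inter> space (\<mu> n) = seq_cylinder a n u"
      unfolding b(2) by (auto simp: seq_cylinder_def)
    ultimately show "(\<lambda>k. P_iter a n k (indicator (seq_cylinder a n u)) (xs k)) \<longlonglongrightarrow> measure (\<mu> n) (seq_cylinder a n u)"
      by simp
  qed
  interpret \<nu>: prob_space "\<nu> n" by (rule basic[OF nu(1)])
  interpret \<nu>': prob_space "\<nu>' n" by (rule basic[OF nu(2)])
  show "\<nu> n = \<nu>' n"
  proof (rule measure_eqI_generator_eq[OF Int_stable_seq_cylinders])
    show "range (seq_cylinder a n) \<subseteq> Pow (seq_space a n)" by (auto simp: seq_cylinder_def)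
    show "sets (\<nu> n) = sigma_sets (seq_space a n) (range (seq_cylinder a n))"
      "sets (\<nu>' n) = sigma_sets (seq_space a n) (range (seq_cylinder a n))"
      using basic(3)[OF nu(1)] basic(3)[OF nu(2)] by (simp_all add: seq_algebra_def)
    fix X assume "X \<in> range (seq_cylinder a n)"
    then obtain u where u: "X = seq_cylinder a n u" by blast
    show "emeasure (\<nu> n) X = emeasure (\<nu>' n) X"
      unfolding u \<nu>.emeasure_eq_measure \<nu>'.emeasure_eq_measure
      using LIMSEQ_unique[OF lim[OF nu(1)] lim[OF nu(2)]] by simp
  next
    show "range (\<lambda>_. seq_cylinder a n []) \<subseteq> range (seq_cylinder a n)" by blast
    show "(\<Union>i::nat. seq_cylinder a n []) = seq_space a n" by (auto simp: seq_cylinder_def)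
    show "emeasure (\<nu> n) (seq_cylinder a n []) \<noteq> \<infinity>" by simp
  qed
qed


section \<open>The limiting density and the measures built from it\<close>

context summable_reciprocals
begin

lemma a_in_seq_space: "a \<in> seq_space a 0"
  using a_ge_1 by (simp add: seq_space_def alphabet_def)

lemma seq_space_nonempty: "seq_space a n \<noteq> {}"
  using shift_in_seq_space[OF a_in_seq_space, of n] by auto

lemma seq_space_sets: "seq_space a 0 \<in> sets m"
proof -
  have "{z \<in> space m. \<forall>i. a i \<le> z i} \<in> sets m" by measurable
  then show ?thesis by (simp add: seq_space_def alphabet_eq)
qed

text \<open>The infinite product of the \<open>\<rho> i y\<close>. The exponential form makes it
  positive for every argument, also outside \<open>seq_space a 0\<close>.\<close>

definition R_lim :: "(nat \<Rightarrow> nat) \<Rightarrow> real" where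
  "R_lim y = exp (\<Sum>i. ln (\<rho> i y))"

lemma R_lim_pos: "0 < R_lim y"
  by (simp add: R_lim_def)

lemma measurable_cf_value_shift [measurable]: "(\<lambda>z. cf_value (shift i z)) \<in> borel_measurable m"
proof -
  have "(\<lambda>z. cf_convergent k (shift i z)) \<in> borel_measurable (digit_measure p)" for k
  proof (rule prefix_determined_measurable)
    have "cf_convergent k (shift i z) = cf_convergent k (shift i z')" if "\<forall>j<i + k. z j = z' j" for z z'
      unfolding cf_convergent_eq_fold by (rule cf_fold_cong) (use that in \<open>simp add: shift_apply\<close>)
    then show "prefix_determined (i + k) (\<lambda>z. cf_convergent k (shift i z))"
      unfolding prefix_determined_def by blast
  qed simp
  then show ?thesis unfolding cf_value_def m_def by measurable
qed

lemma measurable_\<rho> [measurable]: "\<rho> i \<in> borel_measurable m"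
  unfolding \<rho>_def by measurable

lemma measurable_R_lim [measurable]: "R_lim \<in> borel_measurable m"
  unfolding R_lim_def by measurable

lemma R_lim_bounds:
  assumes "y \<in> seq_space a 0"
  shows "exp (- (\<Sum>i. 2 * (1 / real (a i)))) \<le> R_lim y" "R_lim y \<le> 1"
proof -
  have M: "summable (\<lambda>i. 2 * (1 / real (a i)))" by (rule summable_mult[OF summable_reciprocal])
  have s: "summable (\<lambda>i. ln (\<rho> i y))"
    by (rule summable_comparison_test'[OF M, of 0]) (use \<rho>_bounds(3)[OF assms] in simp)
  have "- (\<Sum>i. 2 * (1 / real (a i))) = (\<Sum>i. - (2 * (1 / real (a i))))"
    by (rule suminf_minus[OF M, symmetric])
  also have "\<dots> \<le> (\<Sum>i. ln (\<rho> i y))"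
  proof (rule suminf_le[OF _ summable_minus[OF M] s])
    show "- (2 * (1 / real (a i))) \<le> ln (\<rho> i y)" for i using \<rho>_bounds(3)[OF assms, of i] by linarith
  qed
  finally show "exp (- (\<Sum>i. 2 * (1 / real (a i)))) \<le> R_lim y" by (simp add: R_lim_def)
  have "(\<Sum>i. ln (\<rho> i y)) \<le> (\<Sum>i. 0 :: real)"
    using \<rho>_bounds[OF assms] by (intro suminf_le s) auto
  then show "R_lim y \<le> 1" by (simp add: R_lim_def)
qed

lemma cf_value_cat_tendsto:
  assumes z: "z \<in> seq_space a 0" and xs: "\<And>k. xs k \<in> seq_space a (n + k)"
  shows "(\<lambda>k. cf_value (shift i (cat (n + k) z (xs k)))) \<longlonglongrightarrow> cf_value (shift i z)"
proof -
  have y: "cat (n + k) z (xs k) \<in> seq_space a 0" for k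
    by (rule cat_in_seq_space) (use z xs in \<open>auto simp: seq_space_def\<close>)
  have "\<forall>k. norm (cf_value (shift i (cat (n + k) z (xs k))) - cf_value (shift i z)) \<le> 2 * (1 / 2) ^ (k - i)"
  proof
    fix k
    show "norm (cf_value (shift i (cat (n + k) z (xs k))) - cf_value (shift i z)) \<le> 2 * (1 / 2) ^ (k - i)"
  proof -
    have "shift i (cat (n + k) z (xs k)) j = shift i z j" if "j < k - i" for j
    proof -
      have "i + j < n + k" using that by linarith
      then show ?thesis by (simp add: shift_apply cat_def)
    qed
    then show ?thesis
      using cf_value_cong_prefix(2)[OF positive_seq_shift[OF seq_space_positive[OF y]]
          positive_seq_shift[OF seq_space_positive[OF z]]] by simp
  qed
  qed
  then have ev: "\<forall>\<^sub>F k in sequentially.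
      norm (cf_value (shift i (cat (n + k) z (xs k))) - cf_value (shift i z)) \<le> 2 * (1 / 2) ^ (k - i)"
    by (rule always_eventually)
  have lim: "(\<lambda>k. 2 * (1 / 2) ^ (k - i) :: real) \<longlonglongrightarrow> 0"
  proof (rule LIMSEQ_offset[of _ i])
    show "(\<lambda>k. 2 * (1 / 2) ^ (k + i - i) :: real) \<longlonglongrightarrow> 0"
      by (simp, intro tendsto_mult_right_zero LIMSEQ_realpow_zero) auto
  qed
  have "(\<lambda>k. cf_value (shift i (cat (n + k) z (xs k))) - cf_value (shift i z)) \<longlonglongrightarrow> 0"
    by (rule Lim_null_comparison[OF ev lim])
  then show ?thesis by (simp add: LIM_zero_iff)
qed

text \<open>Dominated convergence for series: the logarithms are extended by 0 beyond the first
  \<open>n + k\<close> indices and dominated by \<open>2 / a i\<close>. The limit forgets the tails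
  \<open>xs\<close>, as the characterisation of the measures demands.\<close>

lemma R_cat_tendsto:
  assumes z: "z \<in> seq_space a 0" and xs: "\<And>k. xs k \<in> seq_space a (n + k)"
  shows "(\<lambda>k. R (n + k) (cat (n + k) z (xs k))) \<longlonglongrightarrow> R_lim z"
proof -
  define y where "y k = cat (n + k) z (xs k)" for k
  have y: "y k \<in> seq_space a 0" for k
    unfolding y_def by (rule cat_in_seq_space) (use z xs in \<open>auto simp: seq_space_def\<close>)
  define t where "t i k = (if i < n + k then ln (\<rho> i (y k)) else 0)" for i k
  have \<rho>_lim: "(\<lambda>k. \<rho> i (y k)) \<longlonglongrightarrow> \<rho> i z" for i
  proof -
    have "(\<lambda>k. (real (z i) * cf_value (shift i (y k))) powr (1 + gam a i)) \<longlonglongrightarrow> \<rho> i z"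
      unfolding \<rho>_def y_def
    proof (intro tendsto_powr tendsto_mult tendsto_const cf_value_cat_tendsto[OF z xs])
      have "0 < cf_value (shift i z)"
        using cf_value_pos positive_seq_shift seq_space_positive[OF z] by blast
      moreover have "1 \<le> z i" using z by (simp add: seq_space_def alphabet_def)
      ultimately show "real (z i) * cf_value (shift i z) \<noteq> 0" by simp
    qed
    moreover have "\<forall>\<^sub>F k in sequentially. (real (z i) * cf_value (shift i (y k))) powr (1 + gam a i) = \<rho> i (y k)"
      using eventually_gt_at_top[of i]
    proof eventually_elim
      case (elim k)
      then have "y k i = z i" by (simp add: y_def cat_def)
      then show ?case by (simp add: \<rho>_def)
    qed
    ultimately show ?thesis by (rule Lim_transform_eventually)
  qed
  have t_lim: "(\<lambda>k. t i k) \<longlonglongrightarrow> ln (\<rho> i z)" for i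
  proof -
    have "(\<lambda>k. ln (\<rho> i (y k))) \<longlonglongrightarrow> ln (\<rho> i z)"
      by (rule tendsto_ln[OF \<rho>_lim]) (use \<rho>_bounds(1)[OF z, of i] in simp)
    moreover have "\<forall>\<^sub>F k in sequentially. ln (\<rho> i (y k)) = t i k"
      using eventually_gt_at_top[of i] by eventually_elim (simp add: t_def)
    ultimately show ?thesis by (rule Lim_transform_eventually)
  qed
  have "\<forall>\<^sub>F (i, k) in at_top \<times>\<^sub>F sequentially. norm (t i k) \<le> 2 * (1 / real (a i))"
    using \<rho>_bounds(3)[OF y] by (intro always_eventually) (auto simp: t_def)
  then have "(\<lambda>k. \<Sum>i. t i k) \<longlonglongrightarrow> (\<Sum>i. ln (\<rho> i z))"
    using tannerys_theorem[of t "\<lambda>i. ln (\<rho> i z)" sequentially "\<lambda>i. 2 * (1 / real (a i))"]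
      t_lim summable_mult[OF summable_reciprocal, of 2] by simp
  then have "(\<lambda>k. exp (\<Sum>i. t i k)) \<longlonglongrightarrow> R_lim z"
    unfolding R_lim_def by (rule tendsto_exp)
  moreover have "exp (\<Sum>i. t i k) = R (n + k) (y k)" for k
  proof -
    have "(\<Sum>i. t i k) = (\<Sum>i<n + k. t i k)" by (rule suminf_finite) (auto simp: t_def)
    also have "\<dots> = (\<Sum>i<n + k. ln (\<rho> i (y k)))" by (rule sum.cong) (auto simp: t_def)
    finally show ?thesis using \<rho>_bounds(1)[OF y] by (simp add: exp_sum R_def)
  qed
  ultimately show ?thesis by (simp add: y_def)
qed

text \<open>\<open>m\<close> lives on all sequences, \<open>nu n\<close> on
  \<open>seq_space a n\<close>. The exceptional null set is sent to \<open>a\<close> itself, which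
  is admissible because each digit equals its lower bound.\<close>

definition retract :: "(nat \<Rightarrow> nat) \<Rightarrow> nat \<Rightarrow> nat" where
  "retract z = (if z \<in> seq_space a 0 then z else a)"

lemma retract_in: "retract z \<in> seq_space a 0"
  by (simp add: retract_def a_in_seq_space)

lemma measurable_shift_retract:
  "(\<lambda>z. shift n (retract z)) \<in> measurable m (sigma (seq_space a n) (range (seq_cylinder a n)))"
proof (rule measurable_measure_of)
  show "range (seq_cylinder a n) \<subseteq> Pow (seq_space a n)" by (auto simp: seq_cylinder_def)
  show "(\<lambda>z. shift n (retract z)) \<in> space m \<rightarrow> seq_space a n"
    using shift_in_seq_space[OF retract_in, of n] by auto
  fix Y assume "Y \<in> range (seq_cylinder a n)"
  then obtain u where u: "Y = seq_cylinder a n u" by blast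
  have "{z \<in> space m. (if z \<in> seq_space a 0 then \<forall>i\<in>{..<length u}. z (n + i) = u ! i
      else \<forall>i\<in>{..<length u}. a (n + i) = u ! i)} \<in> sets m"
    using seq_space_sets by measurable
  also have "{z \<in> space m. (if z \<in> seq_space a 0 then \<forall>i\<in>{..<length u}. z (n + i) = u ! i
      else \<forall>i\<in>{..<length u}. a (n + i) = u ! i)} = (\<lambda>z. shift n (retract z)) -` Y \<inter> space m"
    using shift_in_seq_space[OF retract_in, of n]
    by (auto simp: u seq_cylinder_def shift_apply retract_def split: if_splits)
  finally show "(\<lambda>z. shift n (retract z)) -` Y \<inter> space m \<in> sets m" .
qed

definition c :: real where
  "c = (\<integral>z. R_lim z \<partial>m)"

lemma integrable_R_lim: "integrable m R_lim"
  by (rule m.integrable_const_bound[where B = 1])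
    (use AE_seq_space R_lim_bounds(2) R_lim_pos in \<open>auto elim!: eventually_mono simp: less_imp_le\<close>)

lemma c_pos: "0 < c"
proof -
  have "0 < exp (- (\<Sum>i. 2 * (1 / real (a i))))" by simp
  also have "\<dots> = (\<integral>z. exp (- (\<Sum>i. 2 * (1 / real (a i)))) \<partial>m)" using m.prob_space by simp
  also have "\<dots> \<le> (\<integral>z. R_lim z \<partial>m)"
    by (rule integral_mono_AE[OF _ integrable_R_lim])
      (use AE_seq_space R_lim_bounds(1) in \<open>auto elim!: eventually_mono\<close>)
  finally show ?thesis by (simp add: c_def)
qed

definition \<mu> :: "(nat \<Rightarrow> nat) measure" where
  "\<mu> = density m (\<lambda>z. ennreal (R_lim z / c))"

text \<open>Discarding the first \<open>n\<close> digits is right for every \<open>n\<close>,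
  because \<open>P_iter_eq\<close> treats a function on the later digits as a function of the whole
  sequence.\<close>

definition nu :: "nat \<Rightarrow> (nat \<Rightarrow> nat) measure" where
  "nu n = distr \<mu> (sigma (seq_space a n) (range (seq_cylinder a n))) (\<lambda>z. shift n (retract z))"

lemma sets_\<mu> [simp, measurable_cong]: "sets \<mu> = sets m"
  by (simp add: \<mu>_def)

lemma space_\<mu> [simp]: "space \<mu> = UNIV"
  by (simp add: \<mu>_def)

lemma measurable_shift_retract_\<mu>:
  "(\<lambda>z. shift n (retract z)) \<in> measurable \<mu> (sigma (seq_space a n) (range (seq_cylinder a n)))"
  using measurable_shift_retract by (simp add: measurable_cong_sets[OF sets_\<mu> refl])

lemma prob_space_\<mu>: "prob_space \<mu>"
proof
  have "emeasure \<mu> UNIV = (\<integral>\<^sup>+ z. ennreal (R_lim z / c) \<partial>m)"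
    unfolding \<mu>_def using sets.top[of m] by (subst emeasure_density) auto
  also have "\<dots> = ennreal (\<integral>z. R_lim z / c \<partial>m)"
    using integrable_R_lim R_lim_pos c_pos
    by (intro nn_integral_eq_integral) (auto intro: divide_nonneg_pos less_imp_le)
  also have "\<dots> = 1" using c_pos by (simp add: c_def[symmetric])
  finally show "emeasure \<mu> (space \<mu>) = 1" by simp
qed

lemma prob_space_nu: "prob_space (nu n)"
  unfolding nu_def by (rule prob_space.prob_space_distr[OF prob_space_\<mu> measurable_shift_retract_\<mu>])

lemma space_nu: "space (nu n) = seq_space a n" and sets_nu: "sets (nu n) = seq_algebra a n"
  by (simp_all add: nu_def sets_seq_sigma)

lemma integral_nu:
  assumes "f \<in> borel_measurable (nu n)"
  shows "integral\<^sup>L (nu n) f = (\<integral>z. f (shift n (retract z)) * R_lim z \<partial>m) / c"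
proof -
  have f: "f \<in> borel_measurable (sigma (seq_space a n) (range (seq_cylinder a n)))"
    using assms by (simp add: nu_def)
  have "integral\<^sup>L (nu n) f = (\<integral>z. f (shift n (retract z)) \<partial>\<mu>)"
    unfolding nu_def by (rule integral_distr[OF measurable_shift_retract_\<mu> f])
  also have "\<dots> = (\<integral>z. (R_lim z / c) *\<^sub>R f (shift n (retract z)) \<partial>m)"
    unfolding \<mu>_def
    using measurable_compose[OF measurable_shift_retract f] R_lim_pos c_pos
    by (intro integral_density) (auto intro!: AE_I2 divide_nonneg_pos intro: less_imp_le)
  also have "\<dots> = (\<integral>z. f (shift n (retract z)) * R_lim z / c \<partial>m)"
    by (simp add: mult.commute)
  finally show ?thesis by simp
qed

lemma L_iter_integral_tendsto:
  assumes r: "0 < r" "r < 1" and hold: "holder_coeff a n r f < \<infinity>"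
    and B: "\<And>x. x \<in> seq_space a n \<Longrightarrow> \<bar>f x\<bar> \<le> B"
    and xs: "\<And>k. xs k \<in> seq_space a (n + k)"
  shows "(\<lambda>k. \<integral>z. f (shift n (cat (n + k) z (xs k))) * R (n + k) (cat (n + k) z (xs k)) \<partial>m)
    \<longlonglongrightarrow> (\<integral>z. f (shift n (retract z)) * R_lim z \<partial>m)"
proof (rule integral_dominated_convergence[where w = "\<lambda>_. B"])
  obtain K where K: "\<And>k x y. 1 \<le> k \<Longrightarrow> x \<in> seq_space a n \<Longrightarrow> y \<in> seq_space a n \<Longrightarrow>
    (\<forall>i<k. x i = y i) \<Longrightarrow> \<bar>f x - f y\<bar> \<le> K * r ^ k"
    using holder_coeff_finiteD[OF hold r(1)] by blast
  have y: "cat (n + k) z (xs k) \<in> seq_space a 0" if "z \<in> seq_space a 0" for k z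
    by (rule cat_in_seq_space) (use that xs in \<open>auto simp: seq_space_def\<close>)
  have fm: "f \<in> borel_measurable (sigma (seq_space a n) (range (seq_cylinder a n)))"
    by (rule holder_measurable[OF space_seq_sigma sets_seq_sigma r hold])
  show "(\<lambda>z. f (shift n (retract z)) * R_lim z) \<in> borel_measurable m"
    using measurable_compose[OF measurable_shift_retract fm] by measurable
  show "(\<lambda>z. f (shift n (cat (n + k) z (xs k))) * R (n + k) (cat (n + k) z (xs k))) \<in> borel_measurable m" for k
    unfolding m_def by (rule prefix_determined_measurable[OF prefix_determined_cat]) simp
  show "integrable m (\<lambda>_. B)" by simp
  show "AE z in m. (\<lambda>k. f (shift n (cat (n + k) z (xs k))) * R (n + k) (cat (n + k) z (xs k)))
      \<longlonglongrightarrow> f (shift n (retract z)) * R_lim z"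
    using AE_seq_space
  proof (rule AE_mp, intro AE_I2 impI)
    fix z assume z: "z \<in> seq_space a 0"
    have "(\<lambda>k. K * r ^ k) \<longlonglongrightarrow> 0"
      using r by (intro tendsto_mult_right_zero LIMSEQ_realpow_zero) auto
    moreover have "\<forall>\<^sub>F k in sequentially. norm (f (shift n (cat (n + k) z (xs k))) - f (shift n z)) \<le> K * r ^ k"
      using eventually_ge_at_top[of 1]
    proof eventually_elim
      case (elim k)
      then show ?case
        using K[OF elim, of "shift n (cat (n + k) z (xs k))" "shift n z"]
          shift_in_seq_space[OF y[OF z], of n k] shift_in_seq_space[OF z, of n]
        by (simp add: shift_apply cat_def[of _ z])
    qed
    ultimately have "(\<lambda>k. f (shift n (cat (n + k) z (xs k))) - f (shift n z)) \<longlonglongrightarrow> 0"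
      by (rule Lim_null_comparison[rotated])
    then have "(\<lambda>k. f (shift n (cat (n + k) z (xs k)))) \<longlonglongrightarrow> f (shift n z)" by (simp add: LIM_zero_iff)
    then show "(\<lambda>k. f (shift n (cat (n + k) z (xs k))) * R (n + k) (cat (n + k) z (xs k)))
        \<longlonglongrightarrow> f (shift n (retract z)) * R_lim z"
      using tendsto_mult[OF _ R_cat_tendsto[OF z xs]] z by (simp add: retract_def)
  qed
  show "AE z in m. norm (f (shift n (cat (n + k) z (xs k))) * R (n + k) (cat (n + k) z (xs k))) \<le> B" for k
    using AE_seq_space
  proof (rule AE_mp, intro AE_I2 impI)
    fix z assume z: "z \<in> seq_space a 0"
    have "\<bar>f (shift n (cat (n + k) z (xs k)))\<bar> \<le> B" using B shift_in_seq_space[OF y[OF z], of n k] by simp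
    then have "\<bar>f (shift n (cat (n + k) z (xs k)))\<bar> * \<bar>R (n + k) (cat (n + k) z (xs k))\<bar> \<le> B * 1"
      using R_range[OF y[OF z], of "n + k" k] by (intro mult_mono) (auto intro: order_trans[OF abs_ge_zero])
    then show "norm (f (shift n (cat (n + k) z (xs k))) * R (n + k) (cat (n + k) z (xs k))) \<le> B"
      by (simp add: abs_mult)
  qed
qed

text \<open>Numerator and denominator carry the same product of the \<open>Z i\<close>, which
  cancels; what remains converges to integrals against \<open>R_lim\<close>.\<close>

lemma P_iter_tendsto:
  assumes r: "0 < r" "r < 1" and hold: "holder_coeff a n r f < \<infinity>"
    and B: "\<And>x. x \<in> seq_space a n \<Longrightarrow> \<bar>f x\<bar> \<le> B"
    and xs: "\<And>k. xs k \<in> seq_space a (n + k)"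
  shows "(\<lambda>k. P_iter a n k f (xs k)) \<longlonglongrightarrow> integral\<^sup>L (nu n) f"
proof -
  let ?I = "\<lambda>f k. \<integral>z. f (shift n (cat (n + k) z (xs k))) * R (n + k) (cat (n + k) z (xs k)) \<partial>m"
  have zeroZ: "(\<Prod>i<n + k. Z i) \<noteq> 0" for k
  proof -
    have "Z i \<noteq> 0" for i using Z_ge_1[of i] by linarith
    then show ?thesis by simp
  qed
  have e1: "L_iter a 0 (n + k) (\<lambda>y. f (shift n y)) (xs k) = (\<Prod>i<n + k. Z i) * ?I f k" for k
    using shift_in_seq_space[of _ a 0 n] by (intro L_iter_eq_integral[OF B xs]) simp
  have e2: "L_iter a 0 (n + k) (\<lambda>_. 1) (xs k) = (\<Prod>i<n + k. Z i) * ?I (\<lambda>_. 1) k" for k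
    by (rule L_iter_eq_integral[where B = 1 and f = "\<lambda>_. 1", OF _ xs]) simp
  have P: "P_iter a n k f (xs k) = ?I f k / ?I (\<lambda>_. 1) k" for k
    unfolding P_iter_eq e1 e2 by (rule mult_divide_mult_cancel_left[OF zeroZ])
  have "holder_coeff a n r (\<lambda>_. 1) \<le> ennreal 0"
    by (rule holder_coeff_leI) (use r in auto)
  then have h1: "holder_coeff a n r (\<lambda>_. 1) < \<infinity>" by (rule order_le_less_trans) simp
  have lim1: "(\<lambda>k. ?I (\<lambda>_. 1) k) \<longlonglongrightarrow> (\<integral>z. 1 * R_lim z \<partial>m)"
    by (rule L_iter_integral_tendsto[OF r h1 _ xs, of 1]) simp
  have "(\<lambda>k. ?I f k / ?I (\<lambda>_. 1) k) \<longlonglongrightarrow> (\<integral>z. f (shift n (retract z)) * R_lim z \<partial>m) / (\<integral>z. 1 * R_lim z \<partial>m)"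
    by (rule tendsto_divide[OF L_iter_integral_tendsto[OF r hold B xs] lim1])
      (use c_pos in \<open>simp_all add: c_def\<close>)
  moreover have "f \<in> borel_measurable (nu n)"
    by (rule holder_measurable[OF space_nu sets_nu r hold])
  ultimately show ?thesis unfolding P by (simp add: integral_nu c_def)
qed

lemma is_nu_seq_nu: "is_nu_seq a nu"
  unfolding is_nu_seq_def
proof (intro exI[of _ "1 / 2"] conjI allI impI)
  have "(SUP n. holder_coeff a n (1 / 2) (\<lambda>x. ln (phi a n x))) \<le> ennreal 8"
    using holder_coeff_ln_phi a_ge_1 by (intro SUP_least) auto
  then show "(SUP n. holder_coeff a n (1 / 2) (\<lambda>x. ln (phi a n x))) < \<infinity>"
    by (rule order_le_less_trans) simp
  fix n
  show "prob_space (nu n)" "space (nu n) = seq_space a n" "sets (nu n) = seq_algebra a n"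
    by (rule prob_space_nu space_nu sets_nu)+
  fix f xs
  assume *: "bounded (f ` seq_space a n) \<and> holder_coeff a n (1 / 2) f < \<infinity> \<and> (\<forall>k. xs k \<in> seq_space a (n + k))"
  then obtain B where "\<And>x. x \<in> seq_space a n \<Longrightarrow> \<bar>f x\<bar> \<le> B" by (auto simp: bounded_iff)
  then show "(\<lambda>k. P_iter a n k f (xs k)) \<longlonglongrightarrow> integral\<^sup>L (nu n) f"
    using * by (intro P_iter_tendsto[where r = "1 / 2" and B = B]) auto
qed auto

lemma nu_seq_eq: "nu_seq a = nu"
  unfolding nu_seq_def
  by (rule the_equality[where a = nu]) (auto intro: is_nu_seq_nu is_nu_seq_unique[OF seq_space_nonempty])

lemma measurable_cf_value_nu: "cf_value \<in> measurable (nu 0) (restrict_space borel (X_alpha a))"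
proof (rule measurable_restrict_space2)
  show "cf_value \<in> space (nu 0) \<rightarrow> X_alpha a" by (auto simp: space_nu X_alpha_eq_image)
  show "cf_value \<in> borel_measurable (nu 0)"
    by (rule holder_measurable[OF space_nu sets_nu _ _ holder_coeff_cf_value]) auto
qed

text \<open>The density \<open>R_lim / c\<close> is positive everywhere, so it creates no new null
  sets. In this form null sets of \<open>nu0 a\<close> become a matter of independent
  digits.\<close>

lemma nu0_null_iff:
  assumes A: "A \<in> sets (nu0 a)"
  defines "E \<equiv> {z \<in> seq_space a 0. cf_value z \<in> A}"
  shows "E \<in> sets m" "emeasure (nu0 a) A = 0 \<longleftrightarrow> emeasure m E = 0"
proof -
  have A': "A \<in> sets (restrict_space borel (X_alpha a))" using A by (simp add: nu0_def)
  define E' where "E' = {z. cf_value (retract z) \<in> A}"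
  have comp: "(\<lambda>z. cf_value (shift 0 (retract z))) \<in> measurable m (restrict_space borel (X_alpha a))"
    using measurable_compose[OF measurable_shift_retract[of 0], of cf_value "restrict_space borel (X_alpha a)"]
      measurable_cf_value_nu by (simp add: nu_def)
  have E'_sets: "E' \<in> sets m"
    using measurable_sets[OF comp A'] by (simp add: E'_def vimage_def)
  have EE': "E = seq_space a 0 \<inter> E'" by (auto simp: E_def E'_def retract_def)
  then show E_sets: "E \<in> sets m" using E'_sets seq_space_sets by simp
  have "emeasure (nu0 a) A = emeasure (nu 0) (cf_value -` A \<inter> space (nu 0))"
    unfolding nu0_def nu_seq_eq by (rule emeasure_distr[OF measurable_cf_value_nu A'])
  also have "\<dots> = emeasure \<mu> ((\<lambda>z. shift 0 (retract z)) -` (cf_value -` A \<inter> space (nu 0)) \<inter> space \<mu>)"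
    unfolding nu_def using measurable_sets[OF measurable_cf_value_nu A']
    by (intro emeasure_distr[OF measurable_shift_retract_\<mu>]) (simp add: nu_def)
  also have "(\<lambda>z. shift 0 (retract z)) -` (cf_value -` A \<inter> space (nu 0)) \<inter> space \<mu> = E'"
    using retract_in by (auto simp: E'_def space_nu)
  finally have "emeasure (nu0 a) A = emeasure \<mu> E'" .
  moreover have "emeasure \<mu> E' = 0 \<longleftrightarrow> (AE z in m. z \<notin> E')"
  proof -
    have "E' \<in> null_sets \<mu> \<longleftrightarrow> E' \<in> sets m \<and> (AE z in m. z \<in> E' \<longrightarrow> ennreal (R_lim z / c) = 0)"
      unfolding \<mu>_def by (rule null_sets_density_iff) measurable
    moreover have "ennreal (R_lim z / c) \<noteq> 0" for z
      using R_lim_pos[of z] c_pos by (simp add: ennreal_eq_0_iff not_le)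
    ultimately show ?thesis using E'_sets by (simp add: null_sets_def)
  qed
  moreover have "(AE z in m. z \<notin> E') \<longleftrightarrow> (AE z in m. z \<notin> E)"
  proof
    assume "AE z in m. z \<notin> E'"
    then show "AE z in m. z \<notin> E" by (rule eventually_mono) (simp add: EE')
  next
    assume "AE z in m. z \<notin> E"
    with AE_seq_space show "AE z in m. z \<notin> E'" by eventually_elim (simp add: EE')
  qed
  moreover have "(AE z in m. z \<notin> E) \<longleftrightarrow> emeasure m E = 0"
    using AE_iff_null_sets[OF E_sets] E_sets by (auto simp: null_sets_def)
  ultimately show "emeasure (nu0 a) A = 0 \<longleftrightarrow> emeasure m E = 0" by simp
qed

end


section \<open>A null set of positive Hausdorff measure\<close>

text \<open>Floors of reciprocals along its iterates read off the partial quotients, which expresses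
  the exceptional set below as a Borel condition.\<close>

definition gauss_map :: "real \<Rightarrow> real" where
  "gauss_map t = 1 / t - of_int \<lfloor>1 / t\<rfloor>"

lemma gauss_map_iterate_measurable: "(\<lambda>t. (gauss_map ^^ n) t) \<in> borel_measurable borel"
proof (induction n)
  case (Suc n)
  have "gauss_map \<in> borel_measurable borel" unfolding gauss_map_def by measurable
  then show ?case using measurable_compose[OF Suc] by simp
qed simp

lemma inverse_cf_value:
  assumes "positive_seq x"
  shows "\<lfloor>1 / cf_value x\<rfloor> = int (x 0)" "gauss_map (cf_value x) = cf_value (shift 1 x)"
proof -
  note p = positive_seq_shift[OF assms, of 1]
  have inv: "1 / cf_value x = real (x 0) + cf_value (shift 1 x)"
    using cf_value_step[OF assms] by simp
  have "of_int (int (x 0)) \<le> 1 / cf_value x" "1 / cf_value x < of_int (int (x 0)) + 1"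
    using cf_value_pos[OF p] cf_value_less_1[OF p] unfolding inv by simp_all
  then show fl: "\<lfloor>1 / cf_value x\<rfloor> = int (x 0)" by (rule floor_unique)
  have "gauss_map (cf_value x) = 1 / cf_value x - of_int (int (x 0))"
    unfolding gauss_map_def fl ..
  then show "gauss_map (cf_value x) = cf_value (shift 1 x)" unfolding inv by simp
qed

lemma gauss_map_iterate_cf_value:
  assumes "positive_seq x" shows "(gauss_map ^^ n) (cf_value x) = cf_value (shift n x)"
proof (induction n)
  case (Suc n)
  then show ?case using inverse_cf_value(2)[OF positive_seq_shift[OF assms, of n]] by simp
qed simp

section \<open>Sequences of even digits\<close>

context summable_reciprocals
begin

definition even_digits :: "(nat \<Rightarrow> nat) set" where
  "even_digits = {z \<in> seq_space a 0. \<forall>i. even (z i)}"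

lemma even_digits_sets: "even_digits \<in> sets m"
proof -
  have "{z \<in> space m. \<forall>i. even (z i)} \<in> sets m" by measurable
  then have "seq_space a 0 \<inter> {z \<in> space m. \<forall>i. even (z i)} \<in> sets m"
    using seq_space_sets by (rule sets.Int[rotated])
  also have "seq_space a 0 \<inter> {z \<in> space m. \<forall>i. even (z i)} = even_digits"
    by (auto simp: even_digits_def)
  finally show ?thesis .
qed

lemma cf_value_mem_image_iff:
  assumes "z \<in> seq_space a 0" "E \<subseteq> seq_space a 0"
  shows "cf_value z \<in> cf_value ` E \<longleftrightarrow> z \<in> E"
  using cf_value_inj[OF seq_space_positive[OF assms(1)] seq_space_positive] assms(2) by blast

lemma sets_nu0: "sets (nu0 a) = sets (restrict_space borel (X_alpha a))"
  by (simp add: nu0_def)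

lemma even_digits_image_sets: "cf_value ` even_digits \<in> sets (nu0 a)"
proof -
  let ?T = "{t \<in> space (borel :: real measure). \<forall>n. even \<lfloor>1 / (gauss_map ^^ n) t\<rfloor>}"
  have "?T \<in> sets borel" using gauss_map_iterate_measurable by measurable
  moreover have "cf_value ` even_digits = X_alpha a \<inter> ?T"
  proof -
    have "\<lfloor>1 / (gauss_map ^^ n) (cf_value z)\<rfloor> = int (z n)" if "z \<in> seq_space a 0" for z n
      using inverse_cf_value(1)[OF positive_seq_shift[OF seq_space_positive[OF that], of n]]
      by (simp add: gauss_map_iterate_cf_value[OF seq_space_positive[OF that]] shift_apply)
    then show ?thesis by (auto simp: even_digits_def X_alpha_eq_image)
  qed
  ultimately show ?thesis unfolding sets_nu0 sets_restrict_space by blast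
qed

text \<open>An even digit is at most four times as likely as its odd successor.\<close>

lemma prob_even_le: "measure (measure_pmf (p i)) {l. even l} \<le> 4 / 5"
proof -
  let ?E = "{l::nat. even l}"
  have le: "1 / 4 * pmf (p i) l \<le> pmf (p i) (Suc l)" for l
  proof (cases "a i \<le> l")
    case True
    then have l: "1 \<le> l" using a_ge_1[of i] by simp
    \<comment> \<open>Since \<open>l + 1 \<le> 2 * l\<close> and \<open>gam a i \<le> 1\<close>,
      passing to the successor costs at most \<open>2 powr 2\<close>.\<close>
    have "1 / 4 * real l powr - (1 + gam a i) \<le> 2 powr - (1 + gam a i) * real l powr - (1 + gam a i)"
    proof (rule mult_right_mono)
      have "1 / 4 = (2::real) powr - 2" by (simp add: powr_minus)
      also have "\<dots> \<le> 2 powr - (1 + gam a i)" using gam_le_1'[of i] by (intro powr_mono) auto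
      finally show "1 / 4 \<le> (2::real) powr - (1 + gam a i)" .
    qed simp
    also have "\<dots> = real (2 * l) powr - (1 + gam a i)" by (simp add: powr_mult)
    also have "\<dots> \<le> real (Suc l) powr - (1 + gam a i)"
      using l gam_pos'[of i] by (intro powr_mono2') auto
    finally have "1 / 4 * real l powr - (1 + gam a i) / Z i \<le> real (Suc l) powr - (1 + gam a i) / Z i"
      using Z_ge_1[of i] by (intro divide_right_mono) auto
    then show ?thesis using True by (simp add: pmf_p)
  qed (use Z_ge_1[of i] in \<open>simp add: pmf_p\<close>)
  have "ennreal (1 / 4) * emeasure (measure_pmf (p i)) ?E
      = (\<integral>\<^sup>+ l. ennreal (1 / 4) * ennreal (pmf (p i) l) \<partial>count_space ?E)"
    by (simp add: nn_integral_cmult nn_integral_pmf)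
  also have "\<dots> \<le> (\<integral>\<^sup>+ l. ennreal (pmf (p i) (Suc l)) \<partial>count_space ?E)"
    using le by (intro nn_integral_mono) (simp add: ennreal_mult[symmetric] ennreal_leI)
  also have "\<dots> = emeasure (measure_pmf (p i)) (Suc ` ?E)"
    by (rule nn_integral_pmf') simp
  also have "\<dots> \<le> emeasure (measure_pmf (p i)) (- ?E)"
    by (rule emeasure_mono) auto
  finally have "ennreal (1 / 4) * emeasure (measure_pmf (p i)) ?E \<le> emeasure (measure_pmf (p i)) (- ?E)" .
  moreover have "ennreal (1 / 4) * ennreal (measure (measure_pmf (p i)) ?E)
      = ennreal (1 / 4 * measure (measure_pmf (p i)) ?E)"
    by (rule ennreal_mult[symmetric]) auto
  ultimately have "ennreal (1 / 4 * measure (measure_pmf (p i)) ?E) \<le> ennreal (measure (measure_pmf (p i)) (- ?E))"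
    by (simp only: measure_pmf.emeasure_eq_measure)
  then have "1 / 4 * measure (measure_pmf (p i)) ?E \<le> measure (measure_pmf (p i)) (- ?E)"
    by (simp only: ennreal_le_iff measure_nonneg)
  \<comment> \<open>A probability \<open>e\<close> with \<open>e / 4 \<le> 1 - e\<close> is at most
    4/5.\<close>
  moreover have "measure (measure_pmf (p i)) (- ?E) = 1 - measure (measure_pmf (p i)) ?E"
    using measure_pmf.prob_compl[of ?E "p i"] by (simp add: Compl_eq_Diff_UNIV)
  ultimately show ?thesis by linarith
qed

lemma emeasure_even_digits: "emeasure m even_digits = 0"
proof -
  have le: "emeasure m even_digits \<le> ennreal ((4 / 5) ^ n)" for n
  proof -
    have "emeasure m even_digits \<le> emeasure m {z. \<forall>i\<in>{..<n}. z i \<in> {l. even l}}"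
      unfolding m_def by (intro emeasure_mono sets_digit_box) (auto simp: even_digits_def)
    also have "\<dots> = (\<Prod>i<n. emeasure (measure_pmf (p i)) {l. even l})"
      unfolding m_def by (rule emeasure_digit_measure_box) simp
    also have "\<dots> = ennreal (\<Prod>i<n. measure (measure_pmf (p i)) {l. even l})"
      by (simp add: measure_pmf.emeasure_eq_measure prod_ennreal)
    also have "\<dots> \<le> ennreal (\<Prod>i<n. 4 / 5)"
      by (intro ennreal_leI prod_mono conjI prob_even_le measure_nonneg)
    also have "\<dots> = ennreal ((4 / 5) ^ n)" by simp
    finally show ?thesis .
  qed
  have "(\<lambda>n. ennreal ((4 / 5) ^ n)) \<longlonglongrightarrow> ennreal 0"
    by (intro tendsto_ennrealI LIMSEQ_realpow_zero) auto
  then have "emeasure m even_digits \<le> ennreal 0"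
    by (rule LIMSEQ_le_const) (use le in blast)
  then show ?thesis by simp
qed

definition doubled :: "nat \<Rightarrow> nat pmf" where
  "doubled i = map_pmf (\<lambda>l. 2 * l) (p i)"

text \<open>The weight of \<open>2 * l\<close> is that of \<open>l\<close>, and rescaling costs
  \<open>2 powr (1 + gam a i) \<le> 4\<close>. So a law carried by even digits still has the decay
  on which the infinite Hausdorff measure rests.\<close>

lemma pmf_doubled_le:
  assumes "1 \<le> v" shows "pmf (doubled i) v \<le> 4 * real v powr - (1 + gam a i)"
proof (cases "even v")
  case True
  then obtain l where l: "v = 2 * l" by blast
  have "pmf (doubled i) v = pmf (p i) l"
    unfolding doubled_def l by (rule pmf_map_inj') (simp add: inj_on_def)
  also have "\<dots> \<le> real l powr - (1 + gam a i)" using assms by (intro pmf_p_le) (simp add: l)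
  also have "\<dots> = 2 powr (1 + gam a i) * real v powr - (1 + gam a i)"
  proof -
    have "(2::real) powr (1 + gam a i) * 2 powr - (1 + gam a i) = 1"
      by (subst powr_add[symmetric]) simp
    then show ?thesis unfolding l of_nat_mult of_nat_numeral
      by (simp only: powr_mult mult.assoc[symmetric] mult_1_left)
  qed
  also have "\<dots> \<le> 4 * real v powr - (1 + gam a i)"
  proof (rule mult_right_mono)
    have "(2::real) powr (1 + gam a i) \<le> 2 powr 2" using gam_le_1'[of i] by (intro powr_mono) auto
    then show "(2::real) powr (1 + gam a i) \<le> 4" by simp
  qed simp
  finally show ?thesis .
next
  case False
  then have "v \<notin> set_pmf (doubled i)" by (auto simp: doubled_def)
  then show ?thesis by (simp add: pmf_eq_0_set_pmf[THEN iffD2])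
qed

lemma even_digits_doubled: "emeasure (digit_measure doubled) even_digits = 1"
proof -
  interpret P: prob_space "digit_measure doubled" by (rule prob_space_digit_measure)
  have "AE z in digit_measure doubled. z \<in> even_digits"
    using AE_digit_measure_digits
  proof (rule AE_mp, intro AE_I2 impI)
    fix z assume z: "\<forall>i. z i \<in> set_pmf (doubled i)"
    have "a i \<le> z i \<and> even (z i)" for i
      using z[rule_format, of i] by (auto simp: doubled_def set_pmf_p)
    then show "z \<in> even_digits" by (simp add: even_digits_def seq_space_def alphabet_eq)
  qed
  moreover have "even_digits \<in> sets (digit_measure doubled)"
    using even_digits_sets sets_digit_measure[of p doubled] by (simp add: m_def)
  ultimately show ?thesis
    using P.prob_eq_1 by (simp add: P.emeasure_eq_measure)
qed

lemma emeasure_word: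
  assumes "\<forall>i<length w. a i \<le> w ! i"
  shows "{z \<in> seq_space a 0. \<forall>i<length w. z i = w ! i} \<in> sets m"
    "0 < emeasure m {z \<in> seq_space a 0. \<forall>i<length w. z i = w ! i}"
proof -
  let ?B = "{z. \<forall>i\<in>{..<length w}. z i \<in> {w ! i}}"
  have B: "?B \<in> sets m" unfolding m_def by (rule sets_digit_box) simp
  have eq: "{z \<in> seq_space a 0. \<forall>i<length w. z i = w ! i} = seq_space a 0 \<inter> ?B" by auto
  show "{z \<in> seq_space a 0. \<forall>i<length w. z i = w ! i} \<in> sets m"
    unfolding eq using B seq_space_sets by simp
  have "emeasure m (seq_space a 0 \<inter> ?B) = emeasure m ?B"
    by (rule emeasure_eq_AE) (use AE_seq_space B seq_space_sets in \<open>auto elim!: eventually_mono\<close>)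
  also have "\<dots> = ennreal (\<Prod>i<length w. pmf (p i) (w ! i))"
    unfolding m_def
    by (simp only: emeasure_digit_measure_box finite_lessThan emeasure_pmf_single prod_ennreal pmf_nonneg)
  also have "0 < \<dots>"
  proof -
    have "0 < (\<Prod>i<length w. pmf (p i) (w ! i))"
      using assms by (intro prod_pos) (auto simp: pmf_positive_iff set_pmf_p)
    then show ?thesis by simp
  qed
  finally show "0 < emeasure m {z \<in> seq_space a 0. \<forall>i<length w. z i = w ! i}" unfolding eq .
qed

end

theorem proposition5p1:
  fixes \<alpha> :: real and a :: "nat \<Rightarrow> nat"
  assumes alpha: "\<alpha> \<in> {0..1}" "\<alpha> \<notin> \<rat>"
    and a: "a = partial_quotients \<alpha>"
    and summ: "summable (\<lambda>n. 1 / real (a n))"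
    and growth: "\<exists>\<delta>::real. \<delta> > 0 \<and>
      limsup (\<lambda>n. ereal (1 / real n *
        (ln (real (a n)) / 2 * ((1 + \<delta>) * ln (real n) / ln (ln (real (a n))) + 1)
          - (\<Sum>k<n. ln (ln (real (a k))))))) < 1"
  shows "hausdorff_dim (X_alpha a) = ennreal (1 / 2)
    \<and> (\<forall>A \<in> sets (nu0 a). hausdorff_measure (1 / 2) A = 0 \<longrightarrow> emeasure (nu0 a) A = 0)
    \<and> (\<exists>A. A \<subseteq> X_alpha a \<and> A \<in> sets (nu0 a) \<and> emeasure (nu0 a) A = 0
          \<and> hausdorff_measure (1 / 2) A > 0)
    \<and> (\<forall>w. (\<forall>i < length w. 1 \<le> w ! i \<and> a i \<le> w ! i)
          \<longrightarrow> hausdorff_measure (1 / 2) (word_cylinder a w) = \<infinity>)"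
proof -
  have a1: "1 \<le> a n" for n
    using positive_partial_quotients[OF alpha] by (simp add: a positive_seq_def)
  interpret summable_reciprocals a by unfold_locales (rule a1, rule summ)
  interpret D1: digit_decay a p 1
    by unfold_locales (use a1 a_top pmf_p_le in auto)
  interpret D4: digit_decay a doubled 4
    by unfold_locales (use a1 a_top pmf_doubled_le in auto)
  obtain \<delta> :: real where \<delta>: "0 < \<delta>" and lim: "limsup (\<lambda>n. ereal (1 / real n *
        (ln (real (a n)) / 2 * ((1 + \<delta>) * ln (real n) / ln (ln (real (a n))) + 1)
          - (\<Sum>k<n. ln (ln (real (a k))))))) < 1"
    using growth by blast
  have word: "hausdorff_measure (1 / 2) (word_cylinder a w) = \<infinity>"
    if w: "\<forall>i < length w. 1 \<le> w ! i \<and> a i \<le> w ! i" for w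
  proof (rule D1.hausdorff_half_eq_top[OF _ _ _ _ \<delta> lim])
    let ?E = "{z \<in> seq_space a 0. \<forall>i<length w. z i = w ! i}"
    show "?E \<in> sets (digit_measure p)" "0 < emeasure (digit_measure p) ?E"
      using w by (intro emeasure_word[unfolded m_def]; blast)+
    show "?E \<subseteq> seq_space a 0" by blast
    show "cf_value ` ?E \<subseteq> word_cylinder a w"
    proof
      fix t assume "t \<in> cf_value ` ?E"
      then obtain z where z: "z \<in> ?E" "t = cf_value z" by blast
      then have "partial_quotients t = z"
        using partial_quotients_cf_value[OF seq_space_positive, of z a 0] by blast
      then show "t \<in> word_cylinder a w"
        using z unfolding word_cylinder_def X_alpha_eq_image by blast
    qed
  qed
  \<comment> \<open>The empty word turns the statement on cylinders into the lower bound for the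
    dimension.\<close>
  have "word_cylinder a [] = X_alpha a" by (simp add: word_cylinder_def)
  then have top: "hausdorff_measure (1 / 2) (X_alpha a) = \<infinity>" using word[of "[]"] by simp
  have dim: "hausdorff_dim (X_alpha a) = ennreal (1 / 2)"
    using top hausdorff_measure_X_alpha_eq_0[OF a1 a_top] by (intro hausdorff_dim_eqI) auto
  \<comment> \<open>The contrapositive holds in a stronger form: positive \<open>nu0 a\<close>
    measure forces infinite Hausdorff measure.\<close>
  have ac: "emeasure (nu0 a) A = 0" if A: "A \<in> sets (nu0 a)" "hausdorff_measure (1 / 2) A = 0" for A
  proof (rule ccontr)
    let ?E = "{z \<in> seq_space a 0. cf_value z \<in> A}"
    assume "emeasure (nu0 a) A \<noteq> 0"
    then have "0 < emeasure (digit_measure p) ?E" "?E \<in> sets (digit_measure p)"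
      using nu0_null_iff[OF A(1)] by (simp_all add: m_def zero_less_iff_neq_zero)
    then have "hausdorff_measure (1 / 2) A = \<infinity>"
      by (intro D1.hausdorff_half_eq_top[OF _ _ _ _ \<delta> lim, of ?E]) auto
    then show False using A(2) by simp
  qed
  have "{z \<in> seq_space a 0. cf_value z \<in> cf_value ` even_digits} = even_digits"
    using cf_value_mem_image_iff[of _ even_digits] by (auto simp: even_digits_def)
  then have null: "emeasure (nu0 a) (cf_value ` even_digits) = 0"
    using nu0_null_iff(2)[OF even_digits_image_sets] emeasure_even_digits by simp
  \<comment> \<open>\<open>doubled\<close> gives the even sequences full mass while \<open>m\<close>
    gives them none, and both laws satisfy the decay condition.\<close>
  have "hausdorff_measure (1 / 2) (cf_value ` even_digits) = \<infinity>"
  proof (rule D4.hausdorff_half_eq_top[OF _ _ _ _ \<delta> lim])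
    show "even_digits \<in> sets (digit_measure doubled)"
      using even_digits_sets sets_digit_measure[of p doubled] by (simp add: m_def)
    show "even_digits \<subseteq> seq_space a 0" by (auto simp: even_digits_def)
  qed (simp_all add: even_digits_doubled)
  moreover have "cf_value ` even_digits \<subseteq> X_alpha a"
    by (auto simp: X_alpha_eq_image even_digits_def)
  ultimately have "\<exists>A. A \<subseteq> X_alpha a \<and> A \<in> sets (nu0 a) \<and> emeasure (nu0 a) A = 0
      \<and> hausdorff_measure (1 / 2) A > 0"
    using null even_digits_image_sets by (intro exI[of _ "cf_value ` even_digits"]) simp
  then show ?thesis using dim ac word by blast
qed

end
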